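(* Let $R=\Bbbk[x_1,\ldots,x_{n+1}]/(x_1^{e_1},\ldots,x_n^{e_n})$ with $2\le e_1\le\cdots\le e_n\le\infty$, and let $d\in\mathbb{N}$ be such that $\mathrm{Hilb}^d(\mathrm{Proj}\,R)\neq\emptyset$. In items (C2) and (C4), which involve the components of ideals of $R$, it is understood that $n\ge1$. (C1) $\mathfrak{C}(d,R)$ is almost lex. (C2) Every component $\mathfrak{C}(d,R)_\ell\subseteq\overline{R}$ (for $0\le \ell<e_n$) is equal to $\mathfrak{C}(d_\ell,\overline{R})$ for some $d_\ell\in\mathbb{N}$. (C3) If $d_1<d_2$ (with $\mathrm{Hilb}^{d_1}(\mathrm{Proj}\,R)$ and $\mathrm{Hilb}^{d_2}(\mathrm{Proj}\,R)$ nonempty), then $\mathfrak{C}(d_2,R)\subseteq\mathfrak{C}(d_1,R)$. (C4) If $I\in\mathrm{Hilb}^d(\mathrm{Proj}\,R)$ is strongly stable, then, for every $\rho\in\mathbb{N}$ with $\rho<e_n$, we have $$\sum_{\ell=0}^{\rho}\mathrm{mult}\big(I_\ell\big)\le\sum_{\ell=0}^{\rho}\mathrm{mult}\big(\mathfrak{C}(d,R)_\ell\big).$$ (C5) If $I\in\mathrm{Hilb}^d(\mathrm{Proj}\,R)$ is strongly stable, then $$\mathrm{mult}\big((x_1,\ldots,x_n)I\big)\le\mathrm{mult}\big((x_1,\ldots,x_n)\mathfrak{C}(d,R)\big).$$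
   Context: $\Bbbk$ is an arbitrary field and $\mathbb{N}=\{0,1,2,\ldots\}$. Exponents $e_i$ lie in $\mathbb{N}\cup\{\infty\}$, with the convention $r^\infty:=0$ for a ring element $r$; if $e=\infty$, "$\ell<e$" means $\ell\in\mathbb{N}$, and $\infty-1=\infty$. All rings are standard graded $\Bbbk$-algebras and all ideals are graded. For $n\ge 1$ put $\overline{R}=\Bbbk[x_1,\ldots,x_{n-1},x_{n+1}]/(x_1^{e_1},\ldots,x_{n-1}^{e_{n-1}})$. An ideal $I\subseteq A$ is saturated if $I:\mathfrak{m}_A=I$, where $\mathfrak{m}_A$ is the homogeneous maximal ideal. When $\dim(A/I)=1$, $\mathrm{mult}(I)$ denotes the multiplicity of $A/I$, i.e. the constant value of the Hilbert polynomial of $A/I$; moreover $\mathrm{mult}(A)=0$ for the unit ideal. For $d>0$, $I\in\mathrm{Hilb}^d(\mathrm{Proj}\,A)$ means that $I\subseteq A$ is saturated, $\dim(A/I)=1$ and $\mathrm{mult}(I)=d$; for $d=0$ the unit ideal $A$ is the only element of $\mathrm{Hilb}^0(\mathrm{Proj}\,A)$. For a monomial ideal $I\subseteq R$ (image of a monomial ideal of the polynomial ring), its components are the uniquely determined monomial ideals $I_\ell\subseteq\overline{R}$ such that $I=\bigoplus_{\ell=0}^{e_n-1}I_\ell x_n^\ell$ as $\overline{R}$-modules (the index $\ell$ ranges over all of $\mathbb{N}$ if $e_n=\infty$). A monomial ideal $I$ is strongly stable if $\frac{x_k\mathbf{u}}{x_h}\in I$ whenever $\mathbf{u}\in I$ is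 a nonzero monomial, $x_h$ divides $\mathbf{u}$, and $k<h$. A monomial ideal is lex if each of its graded components is spanned by an initial segment (i.e. the lexicographically largest ones, with $x_1>x_2>\cdots$) of the nonzero monomials of that degree. A monomial ideal $I\subseteq R$ (resp. $I\subseteq\overline{R}$) is almost lex if the last variable $x_{n+1}$ is a non-zerodivisor on $R/I$ (resp. $\overline{R}/I$) and the image of $I$ in $R/(x_{n+1})$ (resp. $\overline{R}/(x_{n+1})$) is lex. For $d$ with $\mathrm{Hilb}^d(\mathrm{Proj}\,R)\ne\emptyset$, $\mathfrak{C}(d,R)$ is the unique almost lex ideal $C\in\mathrm{Hilb}^d(\mathrm{Proj}\,R)$ such that $(x_1,\ldots,x_n)^{p+1}\subseteq C\subseteq(x_1,\ldots,x_n)^p$ for some $p\in\mathbb{N}$; in particular $\mathfrak{C}(0,R)=R$. The ideal $\mathfrak{C}(d,\overline{R})$ is defined in the same way for $\overline{R}$, with $(x_1,\ldots,x_{n-1})$ in place of $(x_1,\ldots,x_n)$. *)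

theory Defs
  imports
    "HOL-Algebra.QuotRing"
    "HOL-Algebra.Ideal_Product"
    "HOL-Algebra.Embedded_Algebras"
    "HOL-Library.Poly_Mapping"
    "HOL-Library.Extended_Nat"
    "HOL-Computational_Algebra.Polynomial"
begin

section \<open>Standard graded algebras with a chosen presentation\<close>

text \<open>
  Polynomials in the variables \<open>x\<^sub>i\<close>, \<open>i :: nat\<close>, are finitely supported maps from exponent
  vectors to coefficients.
\<close>

type_synonym 'k mpoly = "(nat \<Rightarrow>\<^sub>0 nat) \<Rightarrow>\<^sub>0 'k"

definition monom_of :: "(nat \<Rightarrow>\<^sub>0 nat) \<Rightarrow> 'k::field mpoly" where
  "monom_of m = Poly_Mapping.single m 1"

definition X :: "nat \<Rightarrow> 'k::field mpoly" where
  "X i = monom_of (Poly_Mapping.single i 1)"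

definition exps :: "nat set \<Rightarrow> (nat \<Rightarrow>\<^sub>0 nat) set" where
  "exps V = {m. Poly_Mapping.keys m \<subseteq> V}"

definition total_deg :: "(nat \<Rightarrow>\<^sub>0 nat) \<Rightarrow> nat" where
  "total_deg m = (\<Sum>i\<in>Poly_Mapping.keys m. Poly_Mapping.lookup m i)"

text \<open>
  A standard graded \<open>\<bbbk>\<close>-algebra \<open>A\<close> is a ring together with a finite set \<open>vars A\<close> of variable
  indices and the projection \<open>proj A\<close> from \<open>\<bbbk>[x\<^sub>i : i \<in> vars A]\<close> onto \<open>A\<close>. The projection
  determines the \<open>\<bbbk>\<close>-algebra structure, the grading and the monomials of \<open>A\<close>; its values on
  polynomials involving other variables are irrelevant.
\<close>

record (overloaded) ('k, 'a) galg = "'a ring" +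
  vars :: "nat set"
  proj :: "'k mpoly \<Rightarrow> 'a"

definition poly_alg :: "nat set \<Rightarrow> ('k::field, 'k mpoly) galg" where
  "poly_alg V =
    \<lparr>carrier = {p. Poly_Mapping.keys p \<subseteq> exps V}, monoid.mult = (*), one = 1, zero = 0, add = (+),
     vars = V, proj = (\<lambda>p. p)\<rparr>"

definition quot_alg :: "('k::field, 'a) galg \<Rightarrow> 'a set \<Rightarrow> ('k, 'a set) galg" where
  "quot_alg A I = ring.extend (A Quot I) (galg.fields (vars A) (\<lambda>p. I +>\<^bsub>A\<^esub> proj A p))"

definition pow_enat :: "('a, 'b) ring_scheme \<Rightarrow> 'a \<Rightarrow> enat \<Rightarrow> 'a" where
  "pow_enat A r e = (case e of enat k \<Rightarrow> r [^]\<^bsub>A\<^esub> k | \<infinity> \<Rightarrow> \<zero>\<^bsub>A\<^esub>)"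

definition trunc_alg :: "nat set \<Rightarrow> nat set \<Rightarrow> (nat \<Rightarrow> enat) \<Rightarrow> ('k::field, 'k mpoly set) galg" where
  "trunc_alg V W e =
    (let P = poly_alg V in quot_alg P (Idl\<^bsub>P\<^esub> ((\<lambda>i. pow_enat P (X i) (e i)) ` W)))"

definition avar :: "('k::field, 'a) galg \<Rightarrow> nat \<Rightarrow> 'a" where
  "avar A i = proj A (X i)"

definition amon :: "('k::field, 'a) galg \<Rightarrow> (nat \<Rightarrow>\<^sub>0 nat) \<Rightarrow> 'a" where
  "amon A m = proj A (monom_of m)"

text \<open>The \<open>\<bbbk>\<close>-span in \<open>A\<close> of the monomials with exponents in \<open>E\<close>.\<close>

definition mspan :: "('k::field, 'a) galg \<Rightarrow> (nat \<Rightarrow>\<^sub>0 nat) set \<Rightarrow> 'a set" where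
  "mspan A E = proj A ` {p. Poly_Mapping.keys p \<subseteq> E}"

definition gcomp :: "('k::field, 'a) galg \<Rightarrow> nat \<Rightarrow> 'a set" where
  "gcomp A t = mspan A {m \<in> exps (vars A). total_deg m = t}"

definition base_field :: "('k::field, 'a) galg \<Rightarrow> 'a set" where
  "base_field A = (\<lambda>c. proj A (Poly_Mapping.single 0 c)) ` UNIV"

section \<open>Ideals\<close>

definition graded_ideal :: "('k::field, 'a) galg \<Rightarrow> 'a set \<Rightarrow> bool" where
  "graded_ideal A I \<longleftrightarrow> ideal I A \<and> I = Idl\<^bsub>A\<^esub> (\<Union>t. I \<inter> gcomp A t)"

definition monomial_ideal :: "('k::field, 'a) galg \<Rightarrow> 'a set \<Rightarrow> bool" where
  "monomial_ideal A I \<longleftrightarrow>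
    (\<exists>E \<subseteq> exps (vars A). I = proj A ` (Idl\<^bsub>poly_alg (vars A)\<^esub> (monom_of ` E)))"

definition max_ideal :: "('k::field, 'a) galg \<Rightarrow> 'a set" where
  "max_ideal A = Idl\<^bsub>A\<^esub> (avar A ` vars A)"

definition ideal_colon :: "('a, 'b) ring_scheme \<Rightarrow> 'a set \<Rightarrow> 'a set \<Rightarrow> 'a set" where
  "ideal_colon A I J = {f \<in> carrier A. \<forall>g\<in>J. f \<otimes>\<^bsub>A\<^esub> g \<in> I}"

definition saturated :: "('k::field, 'a) galg \<Rightarrow> 'a set \<Rightarrow> bool" where
  "saturated A I \<longleftrightarrow> ideal_colon A I (max_ideal A) = I"

definition nz_exps :: "('k::field, 'a) galg \<Rightarrow> nat \<Rightarrow> (nat \<Rightarrow>\<^sub>0 nat) set" where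
  "nz_exps A t = {m \<in> exps (vars A). total_deg m = t \<and> amon A m \<noteq> \<zero>\<^bsub>A\<^esub>}"

text \<open>
  The order \<open><\<close> on exponent vectors from \<^theory>\<open>HOL-Library.Poly_Mapping\<close> compares the entries at
  the first index where the vectors differ, so it is the lexicographic order with
  \<open>x\<^sub>1 > x\<^sub>2 > \<dots>\<close>.
\<close>

definition lex_ideal :: "('k::field, 'a) galg \<Rightarrow> 'a set \<Rightarrow> bool" where
  "lex_ideal A I \<longleftrightarrow> monomial_ideal A I \<and>
    (\<forall>t. \<exists>E \<subseteq> nz_exps A t.
      (\<forall>m\<in>E. \<forall>m'\<in>nz_exps A t. m < m' \<longrightarrow> m' \<in> E) \<and> I \<inter> gcomp A t = mspan A E)"

text \<open>
  A monomial divisible by \<open>x\<^sub>h\<close> is written as \<open>x\<^sup>m x\<^sub>h\<close>; exchanging \<open>x\<^sub>h\<close> for \<open>x\<^sub>k\<close> yields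
  \<open>x\<^sup>m x\<^sub>k\<close>.
\<close>

definition strongly_stable :: "('k::field, 'a) galg \<Rightarrow> 'a set \<Rightarrow> bool" where
  "strongly_stable A I \<longleftrightarrow> monomial_ideal A I \<and>
    (\<forall>m\<in>exps (vars A). \<forall>h\<in>vars A. \<forall>k\<in>vars A. k < h \<longrightarrow>
      amon A (m + Poly_Mapping.single h 1) \<in> I \<longrightarrow>
      amon A (m + Poly_Mapping.single h 1) \<noteq> \<zero>\<^bsub>A\<^esub> \<longrightarrow>
      amon A (m + Poly_Mapping.single k 1) \<in> I)"

definition last_var :: "('k::field, 'a) galg \<Rightarrow> nat" where
  "last_var A = Max (vars A)"

definition nonzerodivisor_mod :: "('a, 'b) ring_scheme \<Rightarrow> 'a set \<Rightarrow> 'a \<Rightarrow> bool" where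
  "nonzerodivisor_mod A I x \<longleftrightarrow>
    (\<forall>f \<in> carrier (A Quot I).
      (I +>\<^bsub>A\<^esub> x) \<otimes>\<^bsub>A Quot I\<^esub> f = \<zero>\<^bsub>A Quot I\<^esub> \<longrightarrow> f = \<zero>\<^bsub>A Quot I\<^esub>)"

definition almost_lex :: "('k::field, 'a) galg \<Rightarrow> 'a set \<Rightarrow> bool" where
  "almost_lex A I \<longleftrightarrow> monomial_ideal A I \<and>
    (let x = avar A (last_var A); J = PIdl\<^bsub>A\<^esub> x in
      nonzerodivisor_mod A I x \<and> lex_ideal (quot_alg A J) ((\<lambda>f. J +>\<^bsub>A\<^esub> f) ` I))"

section \<open>Dimension, multiplicity and Hilbert schemes of points\<close>

text \<open>
  Krull dimension, the supremum of the lengths of chains of prime ideals (\<open>0\<close> for the zero ring).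
\<close>

definition krull_dim :: "('a, 'b) ring_scheme \<Rightarrow> enat" where
  "krull_dim A = Sup {enat k | k. \<exists>P :: nat \<Rightarrow> 'a set.
     (\<forall>i\<le>k. primeideal (P i) A) \<and> (\<forall>i<k. P i \<subset> P (Suc i))}"

definition hilbert_fun :: "('k::field, 'a) galg \<Rightarrow> nat \<Rightarrow> nat" where
  "hilbert_fun A t = ring.dim A (base_field A) (gcomp A t)"

definition hilbert_poly :: "('k::field, 'a) galg \<Rightarrow> rat poly" where
  "hilbert_poly A =
    (THE p. \<forall>\<^sub>F t in sequentially. poly p (of_nat t) = of_nat (hilbert_fun A t))"

text \<open>
  The constant value of the Hilbert polynomial of \<open>A/I\<close>. It is only meaningful if that polynomial
  is constant, i.e. if \<open>A/I\<close> has dimension at most one; for the unit ideal it is \<open>0\<close>.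
\<close>

definition multiplicity_of :: "('k::field, 'a) galg \<Rightarrow> 'a set \<Rightarrow> nat" where
  "multiplicity_of A I = (THE c. hilbert_poly (quot_alg A I) = [:of_nat c:])"

definition Hilb :: "nat \<Rightarrow> ('k::field, 'a) galg \<Rightarrow> 'a set set" where
  "Hilb d A =
    (if d = 0 then {carrier A}
     else {I. graded_ideal A I \<and> saturated A I \<and> krull_dim (A Quot I) = 1
              \<and> multiplicity_of A I = d})"

definition nonlast_ideal :: "('k::field, 'a) galg \<Rightarrow> 'a set" where
  "nonlast_ideal A = Idl\<^bsub>A\<^esub> (avar A ` (vars A - {last_var A}))"

definition C_ideal :: "nat \<Rightarrow> ('k::field, 'a) galg \<Rightarrow> 'a set" where
  "C_ideal d A = (THE C. C \<in> Hilb d A \<and> almost_lex A C \<and>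
    (\<exists>p::nat. nonlast_ideal A [^]\<^bsub>ideals_set A\<^esub> Suc p \<subseteq> C
            \<and> C \<subseteq> nonlast_ideal A [^]\<^bsub>ideals_set A\<^esub> p))"

section \<open>Components of a monomial ideal\<close>

definition internal_direct_sum ::
  "('a, 'b) ring_scheme \<Rightarrow> 'i set \<Rightarrow> ('i \<Rightarrow> 'a set) \<Rightarrow> 'a set \<Rightarrow> bool" where
  "internal_direct_sum A L M I \<longleftrightarrow>
    I = {finsum A g S | g S. finite S \<and> S \<subseteq> L \<and> g \<in> Pi S M} \<and>
    (\<forall>g S. finite S \<and> S \<subseteq> L \<and> g \<in> Pi S M \<and> finsum A g S = \<zero>\<^bsub>A\<^esub> \<longrightarrow> (\<forall>l\<in>S. g l = \<zero>\<^bsub>A\<^esub>))"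

text \<open>
  Let \<open>B\<close> have fewer variables than \<open>A\<close>, such that the inclusion of polynomial rings induces a
  homomorphism from \<open>B\<close> to \<open>A\<close>. For an ideal \<open>J\<close> of \<open>B\<close>, this is the \<open>B\<close>-submodule \<open>J x\<^sub>y^l\<close> of \<open>A\<close>;
  \<open>p\<close> runs through the polynomial representatives of the elements of \<open>J\<close>.
\<close>

definition shifted :: "('k::field, 'a) galg \<Rightarrow> ('k, 'b) galg \<Rightarrow> nat \<Rightarrow> 'b set \<Rightarrow> nat \<Rightarrow> 'a set" where
  "shifted A B y J l =
    {proj A (p * X y ^ l) | p. p \<in> carrier (poly_alg (vars B)) \<and> proj B p \<in> J}"

text \<open>
  The family of monomial ideals \<open>I\<^sub>l\<close> of \<open>B\<close>, \<open>l < b\<close>, with \<open>I = \<Oplus>\<^sub>l I\<^sub>l x\<^sub>y^l\<close>. It is set to \<open>{}\<close>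
  outside the index range in order to be unique as a function.
\<close>

definition components ::
  "('k::field, 'a) galg \<Rightarrow> ('k, 'b) galg \<Rightarrow> nat \<Rightarrow> enat \<Rightarrow> 'a set \<Rightarrow> nat \<Rightarrow> 'b set" where
  "components A B y b I = (THE F.
    (\<forall>l. enat l < b \<longrightarrow> monomial_ideal B (F l)) \<and>
    (\<forall>l. \<not> enat l < b \<longrightarrow> F l = {}) \<and>
    internal_direct_sum A {l. enat l < b} (\<lambda>l. shifted A B y (F l) l) I)"

end

theory Submission
  imports Defs
begin

text \<open>
  Write \<open>W\<close> for the set of all variables but the last one, \<open>z\<close> for the last one, and \<open>M\<close> for the
  set of exponents of the nonzero monomials of \<open>R\<close> in the variables \<open>W\<close>. A monomial ideal modulo
  which \<open>x\<^sub>z\<close> is a nonzerodivisor is determined by the set \<open>D \<subseteq> M\<close> of the monomials in the variables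
  \<open>W\<close> outside of it. Such a \<open>D\<close> is closed under taking divisors, every divisor-closed \<open>D\<close> arises, and
  \<open>cone_ideal D\<close> denotes the ideal. The quotient is free over \<open>\<bbbk>[x\<^sub>z]\<close> with basis \<open>D\<close>; therefore it has
  dimension one iff \<open>D\<close> is finite and nonempty, and its multiplicity is \<open>card D\<close> (\<open>krull_dim_cone\<close>,
  \<open>krull_dim_cone_infinite\<close>, \<open>multiplicity_cone\<close>).

  The ideal \<open>\<CC>(d,R)\<close> is such an ideal. That it is lex in every degree and lies between two
  consecutive powers of the ideal of the variables \<open>W\<close> says that its \<open>D\<close> consists of the \<open>d\<close> smallest
  elements of \<open>M\<close> in the degree-lexicographic order (\<open>C_ideal_eq_cone\<close>). A Hilbert function argument
  shows that \<open>M\<close> has at least \<open>d\<close> elements whenever \<open>Hilb d R\<close> is nonempty (\<open>Hilb_le_card\<close>). The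
  inclusions between these ideals hold because initial segments are nested. The components of an
  ideal correspond to the slices of \<open>D\<close> by the exponent of \<open>x\<^sub>n\<close> (\<open>components_cone\<close>), and slices of
  initial segments are initial segments.

  A strongly stable saturated ideal has the form \<open>cone_ideal D\<close> as well (\<open>strongly_stable_Hilb\<close>). So
  the two inequalities, for the partial sums of the multiplicities of the components and for the
  product with the variables \<open>W\<close>, become statements on finite sets \<open>D\<close> closed under divisors and under
  exchanging a variable for a later one. Multiplying the ideal by the variables \<open>W\<close> replaces \<open>D\<close> by
  its envelope, the set of all monomials whose quotients by variables are all in \<open>D\<close>. The two
  statements are proved together by induction on the number of variables: the inequality for products
  in \<open>n - 1\<close> variables implies the one for partial sums in \<open>n\<close> variables, which implies the one for
  products in \<open>n\<close> variables.

  For the partial sums, let \<open>d\<^sub>l\<close> and \<open>c\<^sub>l\<close> be the sizes of the slices of \<open>D\<close> and of the initial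
  segment \<open>S\<close> of the same size. The exchange property places slice \<open>l\<close> of \<open>D\<close> into the envelope of slice \<open>l + 1\<close>, so by the
  induction hypothesis \<open>d\<^sub>l\<close> is at most the size of the envelope of an initial segment with \<open>d\<^sub>l\<^sub>+\<^sub>1\<close>
  elements. Let \<open>a\<close> be the exponent of \<open>x\<^sub>n\<close> in the largest element of \<open>S\<close>. Comparing that envelope
  with slice \<open>l\<close> of \<open>S\<close> shows (\<open>slice_card_step\<close>): an inequality \<open>d\<^sub>l\<^sub>+\<^sub>1 < c\<^sub>l\<^sub>+\<^sub>1\<close> passes down to \<open>l\<close> as
  long as \<open>l \<ge> a\<close>, it becomes a weak inequality when \<open>l\<close> drops below \<open>a\<close>, and a weak one passes
  down from there on. Hence one strict inequality \<open>d\<^sub>l < c\<^sub>l\<close> implies \<open>d\<^sub>k \<le> c\<^sub>k\<close> for all \<open>k \<le> l\<close>, and as the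
  totals agree, no partial sum of the \<open>d\<^sub>k\<close> exceeds that of the \<open>c\<^sub>k\<close> (\<open>partial_sums_initial\<close>).

  For the products, slice \<open>0\<close> of the envelope of \<open>D\<close> is the envelope of slice \<open>0\<close>, and slice \<open>l + 1\<close> is slice
  \<open>l\<close> of \<open>D\<close>. So the size of the envelope is controlled by the induction hypothesis and by a partial
  sum of the sizes of the slices (\<open>card_envelope_eq\<close>, \<open>envelope_bound\<close>).
\<close>

section \<open>Exponent vectors\<close>

abbreviation "lookup \<equiv> Poly_Mapping.lookup"
abbreviation "keys \<equiv> Poly_Mapping.keys"
abbreviation "single \<equiv> Poly_Mapping.single"
abbreviation unitv :: "nat \<Rightarrow> (nat \<Rightarrow>\<^sub>0 nat)" where "unitv i \<equiv> single i 1"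

lemma total_deg_eq_sum:
  assumes "finite S" "keys m \<subseteq> S"
  shows "total_deg m = (\<Sum>i\<in>S. lookup m i)"
  unfolding total_deg_def using assms
  by (intro sum.mono_neutral_left) (auto simp: in_keys_iff)

lemma total_deg_add [simp]: "total_deg (u + v) = total_deg u + total_deg v"
proof -
  have "keys (u + v) \<subseteq> keys u \<union> keys v" by (rule keys_add)
  then show ?thesis
    by (simp add: total_deg_eq_sum[of "keys u \<union> keys v"] lookup_add sum.distrib)
qed

lemma total_deg_single [simp]: "total_deg (single i k) = k"
  by (simp add: total_deg_def)

lemma total_deg_zero [simp]: "total_deg 0 = 0"
  by (simp add: total_deg_def)

lemma total_deg_eq_0_iff [simp]: "total_deg u = 0 \<longleftrightarrow> u = 0"
  by (auto simp: total_deg_def in_keys_iff intro: poly_mapping_eqI)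

lemma total_deg_pos_iff [simp]: "0 < total_deg u \<longleftrightarrow> u \<noteq> 0"
  by (metis gr_zeroI less_nat_zero_code total_deg_eq_0_iff)

lemma total_deg_ge_lookup: "lookup u i \<le> total_deg u"
  by (cases "i \<in> keys u") (auto simp: total_deg_def in_keys_iff intro: member_le_sum)

lemma pointwise_le_imp_add:
  fixes u v :: "nat \<Rightarrow>\<^sub>0 nat"
  assumes "\<And>i. lookup u i \<le> lookup v i"
  obtains r where "v = u + r"
proof
  show "v = u + (v - u)"
    using assms by (intro poly_mapping_eqI) (simp add: lookup_add lookup_minus)
qed

lemma total_deg_mono:
  assumes "\<And>i. lookup u i \<le> lookup v i" shows "total_deg u \<le> total_deg v"
  using pointwise_le_imp_add[of u v] assms by (metis le_add1 total_deg_add)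

lemma pointwise_le_same_deg:
  assumes "\<And>i. lookup u i \<le> lookup v i" "total_deg u = total_deg v" shows "u = v"
proof -
  obtain r where "v = u + r" using pointwise_le_imp_add assms(1) by blast
  then show ?thesis using assms(2) by simp
qed

lemma exponent_split_unitv:
  assumes "i \<in> keys u" obtains v where "u = v + unitv i"
proof
  show "u = (u - unitv i) + unitv i"
    using assms by (intro poly_mapping_eqI) (auto simp: lookup_add lookup_minus lookup_single when_def in_keys_iff)
qed

lemma exponent_split_deg:
  assumes "q \<le> total_deg r"
  obtains r1 r2 where "r = r1 + r2" "total_deg r1 = q"
  using assms
proof (induction q arbitrary: thesis)
  case 0
  show ?case using 0(1)[of 0 r] by simp
next
  case (Suc q)
  then obtain r1 r2 where r: "r = r1 + r2" "total_deg r1 = q" by (metis Suc_leD)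
  with Suc.prems(2) have "r2 \<noteq> 0" by auto
  then obtain i where "i \<in> keys r2" by (metis all_not_in_conv keys_eq_empty)
  then obtain r3 where "r2 = r3 + unitv i" by (rule exponent_split_unitv)
  then show ?case using Suc.prems(1)[of "r1 + unitv i" r3] r by (simp add: ac_simps)
qed

lemma exps_iff: "u \<in> exps V \<longleftrightarrow> (\<forall>i. i \<notin> V \<longrightarrow> lookup u i = 0)"
  unfolding exps_def by (auto simp: in_keys_iff)

lemma exps_add [simp]: "u + v \<in> exps V \<longleftrightarrow> u \<in> exps V \<and> v \<in> exps V"
  by (auto simp: exps_iff lookup_add)

lemma exps_zero [simp]: "0 \<in> exps V"
  by (simp add: exps_iff)

lemma exps_single [simp]: "single i k \<in> exps V \<longleftrightarrow> i \<in> V \<or> k = 0"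
  by (auto simp: exps_iff lookup_single when_def)

lemma finite_exps_bounded:
  assumes "finite W"
  shows "finite {m \<in> exps W. \<forall>i\<in>W. lookup m i \<le> b i}"
proof -
  have "lookup ` {m \<in> exps W. \<forall>i\<in>W. lookup m i \<le> b i}
      \<subseteq> {f. \<forall>x. (x \<in> W \<longrightarrow> f x \<in> {0..Max (b ` W)}) \<and> (x \<notin> W \<longrightarrow> f x = 0)}"
    using assms by (auto simp: exps_iff intro: order_trans[OF _ Max_ge])
  then have "finite (lookup ` {m \<in> exps W. \<forall>i\<in>W. lookup m i \<le> b i})"
    by (rule finite_subset) (rule finite_set_of_finite_funs[OF assms finite_atLeastAtMost])
  then show ?thesis by (rule finite_imageD) (auto intro: inj_onI poly_mapping_eqI)
qed

lemma finite_exps_deg: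
  assumes "finite W" shows "finite {m \<in> exps W. total_deg m \<le> t}"
  by (rule finite_subset[OF _ finite_exps_bounded[OF assms, of "\<lambda>_. t"]])
    (auto intro: order_trans[OF total_deg_ge_lookup])

section \<open>The degree-lexicographic order\<close>

lemma exponent_less_iff:
  fixes u v :: "nat \<Rightarrow>\<^sub>0 nat"
  shows "u < v \<longleftrightarrow> (\<exists>i. lookup u i < lookup v i \<and> (\<forall>j<i. lookup u j = lookup v j))"
  by (simp add: less_poly_mapping.rep_eq less_fun_def)

text \<open>
  The first index where the vectors differ is at most \<open>i\<close>, so weak inequalities before \<open>i\<close> are enough.
\<close>

lemma exponent_lessI:
  fixes u v :: "nat \<Rightarrow>\<^sub>0 nat"
  assumes "lookup u i < lookup v i" "\<And>j. j < i \<Longrightarrow> lookup u j \<le> lookup v j"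
  shows "u < v"
proof -
  let ?k = "LEAST k. lookup u k \<noteq> lookup v k"
  have ne: "lookup u ?k \<noteq> lookup v ?k" by (rule LeastI[of _ i]) (use assms in auto)
  have le: "?k \<le> i" by (rule Least_le) (use assms in auto)
  have "lookup u j = lookup v j" if "j < ?k" for j using not_less_Least[OF that] by simp
  moreover have "lookup u ?k < lookup v ?k"
    using le ne assms by (cases "?k = i") (auto simp: le_less)
  ultimately show ?thesis unfolding exponent_less_iff by blast
qed

text \<open>
  Within a degree, lexicographically smaller exponents come first. So the complement of a set that
  is an initial segment of the monomials of each degree in the sense of lex ideals (which start
  with the lexicographically largest monomial) is closed downwards within each degree.
\<close>

definition deglex_less :: "(nat \<Rightarrow>\<^sub>0 nat) \<Rightarrow> (nat \<Rightarrow>\<^sub>0 nat) \<Rightarrow> bool" (infix \<open>\<prec>\<close> 50) where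
  "u \<prec> v \<longleftrightarrow> total_deg u < total_deg v \<or> total_deg u = total_deg v \<and> u < v"

definition deglex_le :: "(nat \<Rightarrow>\<^sub>0 nat) \<Rightarrow> (nat \<Rightarrow>\<^sub>0 nat) \<Rightarrow> bool" (infix \<open>\<preceq>\<close> 50) where
  "u \<preceq> v \<longleftrightarrow> u \<prec> v \<or> u = v"

interpretation deglex: linorder deglex_le deglex_less
  by standard (auto simp: deglex_le_def deglex_less_def)

lemma deglex_less_add [simp]: "u + x \<prec> v + x \<longleftrightarrow> u \<prec> v"
  by (auto simp: deglex_less_def)

lemma deglex_le_iff: "u \<preceq> v \<longleftrightarrow> total_deg u < total_deg v \<or> total_deg u = total_deg v \<and> u \<le> v"
  by (auto simp: deglex_le_def deglex_less_def)

text \<open>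
  The exponents of the monomials in the variables \<open>W\<close> that survive modulo the powers \<open>x\<^sub>i^(e i)\<close>.
\<close>

definition box :: "nat set \<Rightarrow> (nat \<Rightarrow> enat) \<Rightarrow> (nat \<Rightarrow>\<^sub>0 nat) set" where
  "box W e = {m \<in> exps W. \<forall>i\<in>W. enat (lookup m i) < e i}"

definition divisor_closed :: "(nat \<Rightarrow>\<^sub>0 nat) set \<Rightarrow> bool" where
  "divisor_closed D \<longleftrightarrow> (\<forall>u v. u + v \<in> D \<longrightarrow> u \<in> D)"

text \<open>
  Strong stability of an ideal in terms of the monomials outside of it: there, a variable may be
  exchanged for a later one.
\<close>

definition costable :: "nat set \<Rightarrow> (nat \<Rightarrow>\<^sub>0 nat) set \<Rightarrow> (nat \<Rightarrow>\<^sub>0 nat) set \<Rightarrow> bool" where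
  "costable W B D \<longleftrightarrow> (\<forall>m. \<forall>k\<in>W. \<forall>h\<in>W. k < h \<longrightarrow> m + unitv k \<in> D \<longrightarrow> m + unitv h \<in> B \<longrightarrow> m + unitv h \<in> D)"

definition initial :: "(nat \<Rightarrow>\<^sub>0 nat) set \<Rightarrow> (nat \<Rightarrow>\<^sub>0 nat) set \<Rightarrow> bool" where
  "initial B D \<longleftrightarrow> D \<subseteq> B \<and> (\<forall>u\<in>D. \<forall>v\<in>B. v \<prec> u \<longrightarrow> v \<in> D)"

text \<open>
  If \<open>D\<close> is the set of monomials outside of a monomial ideal, then these are the monomials outside of
  the product of that ideal with the ideal generated by the variables.
\<close>

definition envelope :: "(nat \<Rightarrow>\<^sub>0 nat) set \<Rightarrow> (nat \<Rightarrow>\<^sub>0 nat) set \<Rightarrow> (nat \<Rightarrow>\<^sub>0 nat) set" where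
  "envelope B D = {u \<in> B. \<forall>v i. u = v + unitv i \<longrightarrow> v \<in> D}"

definition slice :: "nat \<Rightarrow> nat \<Rightarrow> (nat \<Rightarrow>\<^sub>0 nat) set \<Rightarrow> (nat \<Rightarrow>\<^sub>0 nat) set" where
  "slice y l D = {u. lookup u y = 0 \<and> u + single y l \<in> D}"

lemma enat_less_le_trans: "enat b < x \<Longrightarrow> a \<le> b \<Longrightarrow> enat a < x"
  by (meson enat_ord_simps(1) order_le_less_trans)

lemma divisor_closedD: "divisor_closed D \<Longrightarrow> u + v \<in> D \<Longrightarrow> u \<in> D"
  unfolding divisor_closed_def by blast

lemma divisor_closedD2: "divisor_closed D \<Longrightarrow> u + v \<in> D \<Longrightarrow> v \<in> D"
  by (metis add.commute divisor_closedD)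

lemma box_pointwise_le:
  assumes "v \<in> box W e" "\<And>i. lookup u i \<le> lookup v i" shows "u \<in> box W e"
  using assms unfolding box_def exps_iff
  by (auto intro: enat_less_le_trans) (metis bot_nat_0.extremum_uniqueI)

lemma divisor_closed_box: "divisor_closed (box W e)"
  unfolding divisor_closed_def by (auto intro: box_pointwise_le simp: lookup_add)

lemma initial_divisor_closed:
  assumes "initial (box W e) S" shows "divisor_closed S"
  unfolding divisor_closed_def
proof (intro allI impI)
  fix u v assume uv: "u + v \<in> S"
  then have "u \<in> box W e"
    using assms divisor_closedD[OF divisor_closed_box] by (auto simp: initial_def)
  moreover have "u \<preceq> u + v"
    by (cases "v = 0") (auto simp: deglex_le_def deglex_less_def)
  ultimately show "u \<in> S" using uv assms by (auto simp: initial_def deglex_le_def)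
qed

lemma initial_costable:
  assumes "initial B S" shows "costable W B S"
  unfolding costable_def
proof (intro allI impI ballI)
  fix m k h assume *: "k < h" "m + unitv k \<in> S" "m + unitv h \<in> B"
  have "unitv h < unitv k"
    using \<open>k < h\<close> by (auto simp: exponent_less_iff lookup_single when_def intro!: exI[of _ k])
  then have "m + unitv h \<prec> m + unitv k"
    by (simp add: deglex_less_def)
  with * show "m + unitv h \<in> S" using assms by (auto simp: initial_def)
qed

lemma initial_comparable:
  assumes "initial B S" "initial B T" shows "S \<subseteq> T \<or> T \<subseteq> S"
proof (rule ccontr)
  assume "\<not> ?thesis"
  then obtain s t where "s \<in> S" "s \<notin> T" "t \<in> T" "t \<notin> S" by blast
  with assms show False
    unfolding initial_def by (metis deglex.less_linear subsetD)
qed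

lemma initial_card_le:
  assumes "initial B S" "initial B T" "finite S" "finite T" "card S \<le> card T"
  shows "S \<subseteq> T"
  using initial_comparable[OF assms(1,2)] assms(3-5) by (metis card_seteq subset_refl)

lemma deglex_least_exists:
  assumes "finite W" "A \<subseteq> exps W" "A \<noteq> {}"
  obtains m where "m \<in> A" "\<And>x. x \<in> A \<Longrightarrow> m \<preceq> x"
proof -
  obtain a where a: "a \<in> A" using assms by blast
  let ?F = "{x \<in> A. total_deg x \<le> total_deg a}"
  have fin: "finite ?F"
    by (rule finite_subset[OF _ finite_exps_deg[OF assms(1)]]) (use assms in auto)
  have ne: "?F \<noteq> {}" using a by blast
  define m where "m = deglex.Min ?F"
  have "m \<in> ?F" unfolding m_def by (rule deglex.Min_in[OF fin ne])
  moreover have "m \<preceq> x" if "x \<in> A" for x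
  proof (cases "total_deg x \<le> total_deg a")
    case True then show ?thesis unfolding m_def using fin that by (intro deglex.Min_le) auto
  next
    case False
    then show ?thesis using \<open>m \<in> ?F\<close> by (auto simp: deglex_le_iff)
  qed
  ultimately show ?thesis using that by blast
qed

text \<open>
  Each degree contains finitely many monomials, so every nonempty set of monomials has a least
  element, and initial segments can be built up element by element even if \<open>B\<close> is infinite.
\<close>

lemma initial_exists:
  assumes "finite W" "B \<subseteq> exps W" "finite B \<longrightarrow> d \<le> card B"
  obtains S where "initial B S" "finite S" "card S = d"
  using assms(3)
proof (induction d arbitrary: thesis)
  case 0
  show ?case by (rule 0(1)[of "{}"]) (auto simp: initial_def)
next
  case (Suc d)
  then obtain S where S: "initial B S" "finite S" "card S = d" using Suc_leD by metis
  have SB: "S \<subseteq> B" using S by (simp add: initial_def)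
  have "B - S \<noteq> {}"
  proof
    assume "B - S = {}"
    then have "B = S" using SB by blast
    with S Suc.prems(2) show False by simp
  qed
  then obtain m where m: "m \<in> B - S" "\<And>x. x \<in> B - S \<Longrightarrow> m \<preceq> x"
    using deglex_least_exists[OF assms(1), of "B - S"] assms(2) by blast
  have "initial B (insert m S)"
    unfolding initial_def using m SB S(1)
    by (auto simp: initial_def) (metis DiffI deglex.leD)
  moreover have "card (insert m S) = Suc d" using S m by simp
  ultimately show ?case using Suc.prems(1) S(2) by blast
qed

lemma initial_eq_below_Max:
  assumes "initial B S" "finite S" "S \<noteq> {}"
  obtains w where "w \<in> S" "S = {x \<in> B. x \<preceq> w}"
proof -
  define w where "w = deglex.Max S"
  have "w \<in> S" unfolding w_def using assms by simp
  moreover from this have "S = {x \<in> B. x \<preceq> w}"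
    using assms(1) deglex.Max_ge[OF assms(2), folded w_def] by (auto simp: initial_def deglex_le_def)
  ultimately show ?thesis by (rule that)
qed

section \<open>Envelopes of order ideals\<close>

lemma envelope_mono: "S \<subseteq> T \<Longrightarrow> envelope B S \<subseteq> envelope B T"
  unfolding envelope_def by blast

lemma finite_envelope:
  assumes "finite W" "B \<subseteq> exps W" "finite D" shows "finite (envelope B D)"
proof -
  have "envelope B D \<subseteq> insert 0 (\<Union>i\<in>W. (\<lambda>v. v + unitv i) ` D)"
  proof
    fix u assume u: "u \<in> envelope B D"
    show "u \<in> insert 0 (\<Union>i\<in>W. (\<lambda>v. v + unitv i) ` D)"
    proof (cases "u = 0")
      case False
      then obtain i where i: "i \<in> keys u" by (metis all_not_in_conv keys_eq_empty)
      then obtain v where v: "u = v + unitv i" by (rule exponent_split_unitv)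
      have "i \<in> W" using u i assms(2) by (auto simp: envelope_def exps_def)
      moreover have "v \<in> D" using u v by (auto simp: envelope_def)
      ultimately show ?thesis using v by blast
    qed simp
  qed
  then show ?thesis by (rule finite_subset) (use assms in auto)
qed

lemma split_last_unitv:
  assumes "u \<noteq> 0"
  obtains v j where "u = v + unitv j" "j \<in> keys u" "\<And>i. i > j \<Longrightarrow> lookup u i = 0"
proof -
  have ne: "keys u \<noteq> {}" using assms by (metis keys_eq_empty)
  define j where "j = Max (keys u)"
  have j: "j \<in> keys u" unfolding j_def by (rule Max_in) (use ne in auto)
  moreover have "lookup u i = 0" if "i > j" for i
  proof (rule ccontr)
    assume "lookup u i \<noteq> 0"
    then have "i \<le> j" unfolding j_def by (intro Max_ge) (auto simp: in_keys_iff)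
    with that show False by simp
  qed
  ultimately show ?thesis using that exponent_split_unitv[OF j] by metis
qed

text \<open>
  Among the quotients of a monomial \<open>u\<close> by a variable, the one by the last variable occurring in \<open>u\<close>
  is the largest. If \<open>u'\<close> has the same degree as \<open>u\<close> and is smaller, then all its quotients are at
  most that quotient of \<open>u\<close>.
\<close>

lemma envelope_initial:
  assumes "initial (box W e) T"
  shows "initial (box W e) (envelope (box W e) T)"
  unfolding initial_def
proof (intro conjI ballI impI)
  show "envelope (box W e) T \<subseteq> box W e" by (auto simp: envelope_def)
  fix u u' assume u: "u \<in> envelope (box W e) T" and u': "u' \<in> box W e" and less: "u' \<prec> u"
  have "v' \<in> T" if v': "u' = v' + unitv i" for v' i
  proof -
    have v'B: "v' \<in> box W e" using u' v' divisor_closedD[OF divisor_closed_box] by blast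
    have "u \<noteq> 0" using less by (auto simp: deglex_less_def exponent_less_iff)
    then obtain v j where v: "u = v + unitv j" and j: "\<And>i. i > j \<Longrightarrow> lookup u i = 0"
      by (metis split_last_unitv)
    have vT: "v \<in> T" using u v by (auto simp: envelope_def)
    \<comment> \<open>Let k be the first index where v and v' differ, with the larger entry in v'; compare it with j.\<close>
    have "v' \<preceq> v"
    proof (rule ccontr)
      assume "\<not> v' \<preceq> v"
      then have deg: "total_deg v' = total_deg v" and vv': "v < v'" and uu': "u' < u"
        using less v v' by (auto simp: deglex_le_iff deglex_less_def)
      from vv' obtain k where k: "lookup v k < lookup v' k" "\<And>q. q < k \<Longrightarrow> lookup v q = lookup v' q"
        by (auto simp: exponent_less_iff)
      have zero: "lookup v q = 0" if "q > j" for q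
        using j[OF that] v by (simp add: lookup_add)
      consider "k < j" | "k = j" | "k > j" by linarith
      then show False
      proof cases
        case 1
        have "u < u'"
          by (rule exponent_lessI[of _ k])
            (use k 1 in \<open>auto simp: v v' lookup_add lookup_single when_def\<close>)
        with uu' show False by simp
      next
        case 2
        have "lookup u q \<le> lookup u' q" for q
        proof (cases "q \<le> j")
          case True
          then show ?thesis using k 2
            by (cases "q = j") (auto simp: v v' lookup_add lookup_single when_def)
        qed (use j in auto)
        moreover have "total_deg u = total_deg u'" using deg v v' by simp
        ultimately have "u = u'" by (metis pointwise_le_same_deg)
        with uu' show False by simp
      next
        case 3
        have "lookup v q \<le> lookup v' q" for q
        proof (cases "q \<le> j")
          case True
          then show ?thesis using k(2)[of q] 3 by simp
        qed (use zero in auto)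
        with deg have "v = v'" by (metis pointwise_le_same_deg)
        with vv' show False by simp
      qed
    qed
    then show "v' \<in> T" using vT v'B assms by (auto simp: initial_def deglex_le_def)
  qed
  then show "u' \<in> envelope (box W e) T" using u' by (auto simp: envelope_def)
qed

section \<open>Slices by the exponent of the last variable\<close>

lemma exponent_split_at:
  fixes u :: "nat \<Rightarrow>\<^sub>0 nat"
  obtains v where "u = v + single y (lookup u y)" "lookup v y = 0"
proof
  show "u = (u - single y (lookup u y)) + single y (lookup u y)"
    by (intro poly_mapping_eqI) (simp add: lookup_add lookup_minus lookup_single when_def)
qed (simp add: lookup_minus)

lemma lookup_less_of_deg_eq:
  assumes "total_deg u = total_deg w" "\<And>k. k \<noteq> y \<Longrightarrow> lookup u k \<le> lookup w k" "u \<noteq> w"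
  shows "lookup w y < lookup u y"
proof (rule ccontr)
  assume "\<not> ?thesis"
  then have "lookup u k \<le> lookup w k" for k using assms(2) by (cases "k = y") auto
  then show False using pointwise_le_same_deg assms by blast
qed

text \<open>
  Below, \<open>j\<close> is the last variable that occurs in \<open>v x\<^sub>j\<close>. Trading one \<open>x\<^sub>y\<close> in \<open>v x\<^sub>y^(l+1)\<close> for \<open>x\<^sub>j\<close> makes the
  monomial lexicographically larger, and it could only overtake \<open>w\<close> if \<open>v\<close> and \<open>w\<close> agreed up to \<open>x\<^sub>j\<close>. But \<open>v\<close> involves no
  variable after \<open>x\<^sub>j\<close>, so then \<open>w\<close> would have too few factors \<open>x\<^sub>y\<close> for its degree.
\<close>

lemma move_to_last_le:
  fixes y j l :: nat
  assumes j: "j < y" "\<And>i. i > j \<Longrightarrow> lookup v i = 0"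
    and le: "v + single y (Suc l) \<preceq> w"
    and l: "Suc l \<le> lookup w y" "v + single y (Suc l) \<noteq> w"
  shows "v + unitv j + single y l \<preceq> w"
proof (rule ccontr)
  let ?v = "v + single y (Suc l)" and ?u = "v + unitv j + single y l"
  assume "\<not> ?u \<preceq> w"
  then have deg: "total_deg ?v = total_deg w" and wu: "w < ?u" and "?v \<le> w"
    using le by (auto simp: deglex_le_iff)
  with l have "?v < w" by auto
  then obtain i where i: "lookup ?v i < lookup w i" "\<And>q. q < i \<Longrightarrow> lookup ?v q = lookup w q"
    by (auto simp: exponent_less_iff)
  from wu obtain k where k: "lookup w k < lookup ?u k" "\<And>q. q < k \<Longrightarrow> lookup w q = lookup ?u q"
    by (auto simp: exponent_less_iff)
  have ij: "i \<le> j"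
  proof (rule ccontr)
    assume "\<not> i \<le> j"
    have "lookup ?v q \<le> lookup w q" if "q \<noteq> y" for q
      using i(2)[of q] j(2)[of q] that \<open>\<not> i \<le> j\<close>
      by (cases "q \<le> j") (auto simp: lookup_add lookup_single when_def)
    then have "lookup w y < lookup ?v y" using deg l(2) by (intro lookup_less_of_deg_eq) auto
    with l(1) j show False by (simp add: lookup_add)
  qed
  consider "k < j" | "k = j" | "k > j" by linarith
  then show False
  proof cases
    case 1
    have "w < ?v"
      by (rule exponent_lessI[of _ k])
        (use k 1 j in \<open>auto simp: lookup_add lookup_single when_def split: if_splits\<close>)
    with \<open>?v < w\<close> show False by simp
  next
    case 2
    have "i = j"
    proof (rule ccontr)
      assume "i \<noteq> j"
      then have "i < k" using ij 2 by simp
      then show False using i(1) k(2)[of i] 2 j by (auto simp: lookup_add lookup_single when_def split: if_splits)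
    qed
    with i(1) k(1) 2 j show False by (auto simp: lookup_add lookup_single when_def split: if_splits)
  next
    case 3
    have "k = y"
    proof (rule ccontr)
      assume "k \<noteq> y"
      then show False using k(1) 3 j by (auto simp: lookup_add lookup_single when_def split: if_splits)
    qed
    with k(1) l(1) j show False by (auto simp: lookup_add lookup_single when_def split: if_splits)
  qed
qed

text \<open>
  Replacing the factor \<open>x^r\<close> by a power of the last variable \<open>x\<^sub>y\<close> lowers the monomial.
\<close>

lemma trade_for_last_le:
  fixes y :: nat
  assumes "r \<in> exps {..<y}" "a \<le> l" "total_deg (h + r) + a = total_deg h + l"
  shows "h + single y l \<preceq> h + r + single y a"
proof (cases "r = 0")
  case True
  with assms show ?thesis by simp
next
  case False
  then have ne: "keys r \<noteq> {}" by (metis keys_eq_empty)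
  define k where "k = Min (keys r)"
  have k: "k \<in> keys r" unfolding k_def by (rule Min_in) (use ne in auto)
  then have "k < y" using assms(1) by (auto simp: exps_def)
  have "h + single y l < h + r + single y a"
    by (rule exponent_lessI[of _ k])
      (use k \<open>k < y\<close> in \<open>auto simp: lookup_add lookup_single when_def in_keys_iff\<close>)
  then show ?thesis using assms(3) by (auto simp: deglex_le_iff)
qed

text \<open>
  Every \<open>v\<close> in slice \<open>l + 1\<close> of the initial segment with largest element \<open>w\<close> is bounded by a quotient by
  a variable of some element of slice \<open>l\<close>, as long as \<open>l\<close> is at least the exponent of \<open>x\<^sub>y\<close> in \<open>w\<close>. The
  element is \<open>v x\<^sub>i\<close> with \<open>i\<close> the first index where \<open>v\<close> and \<open>w\<close> differ, or else a divisor of \<open>w\<close>, which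
  is nonzero in the ring because \<open>w\<close> is. Simply multiplying \<open>v\<close> by some variable would not do: the
  result may be zero, or exceed \<open>w\<close>.
\<close>

lemma large_element_above:
  fixes y :: nat
  assumes W: "\<forall>i\<in>W. i < y" and v: "v \<in> box W e" and w: "w \<in> box (insert y W) e"
    and le: "v + single y (Suc l) \<preceq> w" and al: "lookup w y \<le> l"
  obtains x k where "x + unitv k \<in> box W e" "x + unitv k + single y l \<preceq> w" "v \<preceq> x"
proof -
  let ?a = "lookup w y" and ?v = "v + single y (Suc l)"
  obtain w' where w': "w = w' + single y ?a" and w'y: "lookup w' y = 0"
    by (rule exponent_split_at)
  have w'B: "w' \<in> box W e"
  proof -
    have "w' \<in> box (insert y W) e"
      using w w' divisor_closedD[OF divisor_closed_box] by metis
    then show ?thesis using w'y unfolding box_def exps_iff by auto metis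
  qed
  have subW: "u \<in> box W e \<Longrightarrow> u \<in> exps {..<y}" for u
    using W unfolding box_def exps_iff by auto
  have degw: "total_deg w = total_deg w' + ?a" by (subst w') simp
  have degle: "total_deg v + Suc l \<le> total_deg w" using le by (auto simp: deglex_le_iff)
  have trade: "h + single y l \<preceq> w \<and> h \<in> box W e" if h: "w' = h + r" "total_deg h + l = total_deg w" for h r
  proof
    have "r \<in> exps {..<y}" using subW[OF w'B] h by simp
    then have "h + single y l \<preceq> h + r + single y ?a"
      using al h degw by (intro trade_for_last_le) auto
    then show "h + single y l \<preceq> w" using h w' by simp
    show "h \<in> box W e" using w'B h divisor_closedD[OF divisor_closed_box] by metis
  qed
  show ?thesis
  proof (cases "total_deg v + Suc l < total_deg w")
    case True
    \<comment> \<open>Any divisor of w' of degree deg w - l works, since its quotients have larger degree than v.\<close>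
    have "total_deg w - l \<le> total_deg w'" using degw al by linarith
    then obtain r1 r2 where r: "w' = r1 + r2" "total_deg r1 = total_deg w - l"
      by (rule exponent_split_deg)
    with True have "r1 \<noteq> 0" by auto
    then obtain k where "k \<in> keys r1" by (metis all_not_in_conv keys_eq_empty)
    then obtain x where x: "r1 = x + unitv k" by (rule exponent_split_unitv)
    have "total_deg r1 + l = total_deg w" using r True by linarith
    then have "r1 + single y l \<preceq> w \<and> r1 \<in> box W e" using trade r(1) by blast
    moreover have "v \<preceq> x" using r True x by (auto simp: deglex_le_iff)
    ultimately show ?thesis using that x by metis
  next
    case False
    with degle have deg: "total_deg v + Suc l = total_deg w" by simp
    have "?v \<noteq> w"
    proof
      assume "?v = w"
      then have "lookup w y \<ge> Suc l" by (auto simp: lookup_add)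
      with al show False by simp
    qed
    then have "?v < w" using le deg by (auto simp: deglex_le_iff)
    then obtain i where i: "lookup ?v i < lookup w i" "\<And>q. q < i \<Longrightarrow> lookup ?v q = lookup w q"
      by (auto simp: exponent_less_iff)
    have iy: "i < y"
    proof -
      have "i \<noteq> y" using i(1) al by (auto simp: lookup_add)
      moreover have "i \<in> insert y W" using i(1) w by (auto simp: box_def exps_iff)
      ultimately show ?thesis using W by auto
    qed
    have vi: "lookup v i < lookup w i" and vq: "\<And>q. q < i \<Longrightarrow> lookup v q = lookup w q"
      using i iy by (fastforce simp: lookup_add lookup_single when_def)+
    have w'i: "lookup w' q = lookup w q" if "q < y" for q
      using that arg_cong[OF w', of "\<lambda>m. lookup m q"] by (simp add: lookup_add lookup_single when_def)
    show ?thesis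
    proof (cases "Suc (lookup v i) < lookup w i")
      case True
      \<comment> \<open>Even after the multiplication, i is the first index of difference.\<close>
      have "v + unitv i + single y l < w"
        by (rule exponent_lessI[of _ i])
          (use True vq iy in \<open>auto simp: lookup_add lookup_single when_def\<close>)
      then have "v + unitv i + single y l \<preceq> w" using deg by (auto simp: deglex_le_iff)
      moreover have "v + unitv i \<in> box W e"
      proof -
        have "i \<in> W" and ei: "enat (lookup w i) < e i" using vi w iy by (auto simp: box_def exps_iff)
        have "enat (Suc (lookup v i)) < e i"
          using ei True by (rule enat_less_le_trans[OF _ less_imp_le])
        then show ?thesis using v \<open>i \<in> W\<close>
          by (auto simp: box_def lookup_add lookup_single when_def)
      qed
      ultimately show ?thesis using that[of v i] by (simp add: deglex_le_def)
    next
      case False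
      with vi have vi': "lookup w i = Suc (lookup v i)" by simp
      \<comment> \<open>A divisor of w' of degree deg v + 1 that agrees with w up to the variable i.\<close>
      define f where "f = (\<Sum>q\<le>i. single q (lookup w q))"
      have lf: "lookup f q = (if q \<le> i then lookup w q else 0)" for q
        by (simp add: f_def lookup_sum lookup_single when_def)
      have "lookup f q \<le> lookup w' q" for q
        using w'i[of q] iy by (simp add: lf)
      then obtain r where r: "w' = f + r" by (rule pointwise_le_imp_add)
      have "lookup f q \<le> lookup (v + unitv i) q" for q
        using vq[of q] vi' by (auto simp: lf lookup_add lookup_single when_def)
      then have degf: "total_deg f \<le> Suc (total_deg v)"
        using total_deg_mono[of f "v + unitv i"] by simp
      have "Suc (total_deg v) - total_deg f \<le> total_deg r"
        using deg degw al r by simp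
      then obtain r1 r2 where r12: "r = r1 + r2" "total_deg r1 = Suc (total_deg v) - total_deg f"
        by (rule exponent_split_deg)
      have "total_deg (f + r1) + l = total_deg w" using r12 degf deg by simp
      moreover have "w' = (f + r1) + r2" using r r12 by (simp add: ac_simps)
      ultimately have h: "f + r1 + single y l \<preceq> w" "f + r1 \<in> box W e" using trade by blast+
      show ?thesis
      proof (cases "r1 = 0")
        case True
        have "lookup f i \<noteq> 0" using lf vi' by simp
        then obtain x where x: "f = x + unitv i"
          using exponent_split_unitv in_keys_iff by metis
        have "lookup x q \<le> lookup v q" for q
          using arg_cong[OF x, of "\<lambda>m. lookup m q"] vq[of q] vi'
          by (auto simp: lf lookup_add lookup_single when_def split: if_splits)
        moreover have "total_deg x = total_deg v"
          using True r12 degf arg_cong[OF x, of total_deg] by simp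
        ultimately have "x = v" by (rule pointwise_le_same_deg)
        then show ?thesis using that[of x i] h x True by simp
      next
        case False
        then obtain k where "k \<in> keys r1" by (metis all_not_in_conv keys_eq_empty)
        then obtain x where x: "r1 = x + unitv k" by (rule exponent_split_unitv)
        have "v < f + x"
          by (rule exponent_lessI[of _ i]) (use vq vi' in \<open>auto simp: lookup_add lf\<close>)
        moreover have "total_deg v = total_deg (f + x)"
          using r12 degf arg_cong[OF x, of total_deg] by simp
        ultimately have "v \<preceq> f + x" by (auto simp: deglex_le_iff)
        then show ?thesis using that[of "f + x" k] h x by (simp add: ac_simps)
      qed
    qed
  qed
qed

lemma slice_box:
  assumes "y \<notin> W" "enat l < e y"
  shows "slice y l (box (insert y W) e) = box W e"
proof -
  have "(u + single y l \<in> box (insert y W) e) = (u \<in> box W e)" if "lookup u y = 0" for u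
    using that assms unfolding box_def exps_iff
    by (auto simp: lookup_add lookup_single when_def split: if_splits) metis
  moreover have "lookup u y = 0" if "u \<in> box W e" for u
    using that assms unfolding box_def exps_iff by auto
  ultimately show ?thesis unfolding slice_def by blast
qed

lemma slice_box_empty:
  assumes "\<not> enat l < e y" "D \<subseteq> box (insert y W) e"
  shows "slice y l D = {}"
  using assms unfolding slice_def box_def by (auto simp: lookup_add)

lemma slice_mono: "D \<subseteq> D' \<Longrightarrow> slice y l D \<subseteq> slice y l D'"
  by (auto simp: slice_def)

lemma slice_subset_box:
  assumes "y \<notin> W" "D \<subseteq> box (insert y W) e"
  shows "slice y l D \<subseteq> box W e"
  using slice_box[OF assms(1)] slice_box_empty[OF _ assms(2)] slice_mono[OF assms(2)] by blast

lemma slice_divisor_closed: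
  assumes "divisor_closed D" shows "divisor_closed (slice y l D)"
  unfolding divisor_closed_def
proof (intro allI impI)
  fix u v assume "u + v \<in> slice y l D"
  then have "lookup u y = 0" "(u + single y l) + v \<in> D" by (auto simp: slice_def lookup_add ac_simps)
  then show "u \<in> slice y l D" using divisor_closedD[OF assms] by (auto simp: slice_def)
qed

lemma slice_costable:
  assumes "y \<notin> W" "D \<subseteq> box (insert y W) e" "costable (insert y W) (box (insert y W) e) D"
  shows "costable W (box W e) (slice y l D)"
  unfolding costable_def
proof (intro allI impI ballI)
  fix m k h
  assume *: "k \<in> W" "h \<in> W" "k < h" "m + unitv k \<in> slice y l D" "m + unitv h \<in> box W e"
  then have "enat l < e y" using slice_box_empty[OF _ assms(2)] by blast
  then have "m + unitv h \<in> slice y l (box (insert y W) e)" using slice_box[OF assms(1)] * by simp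
  then have "(m + single y l) + unitv h \<in> box (insert y W) e" "lookup m y = 0"
    by (auto simp: slice_def ac_simps lookup_add)
  moreover have "(m + single y l) + unitv k \<in> D" using *(4) by (simp add: slice_def ac_simps)
  ultimately have "(m + single y l) + unitv h \<in> D"
    using assms(3) *(1-3) unfolding costable_def by blast
  with \<open>lookup m y = 0\<close> * assms(1) show "m + unitv h \<in> slice y l D"
    by (auto simp: slice_def ac_simps lookup_add lookup_single when_def)
qed

lemma slice_initial:
  assumes "y \<notin> W" "initial (box (insert y W) e) S"
  shows "initial (box W e) (slice y l S)"
proof (cases "enat l < e y")
  case True
  note sb = slice_box[OF assms(1), of l e, OF True]
  have "S \<subseteq> box (insert y W) e" using assms(2) by (simp add: initial_def)
  show ?thesis unfolding initial_def
  proof (intro conjI ballI impI)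
    show "slice y l S \<subseteq> box W e" using slice_subset_box assms by (auto simp: initial_def)
    fix u v assume *: "u \<in> slice y l S" "v \<in> box W e" "v \<prec> u"
    then have v: "lookup v y = 0" "v + single y l \<in> box (insert y W) e"
      using sb by (auto simp: slice_def)
    moreover have "v + single y l \<prec> u + single y l" using * by simp
    ultimately show "v \<in> slice y l S" using * assms(2) by (auto simp: slice_def initial_def)
  qed
next
  case False
  then have "slice y l S = {}" using slice_box_empty[of l e y S W] assms(2) by (simp add: initial_def)
  then show ?thesis by (simp add: initial_def)
qed

lemma finite_slice:
  assumes "finite D" shows "finite (slice y l D)"
proof -
  have "inj_on (\<lambda>u. u + single y l) (slice y l D)" by (auto intro: inj_onI)
  moreover have "(\<lambda>u. u + single y l) ` slice y l D \<subseteq> D" by (auto simp: slice_def)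
  ultimately show ?thesis using assms by (metis finite_imageD finite_subset)
qed

lemma card_eq_sum_slices:
  assumes "finite D" "\<And>u. u \<in> D \<Longrightarrow> lookup u y \<le> N"
  shows "card D = (\<Sum>l\<le>N. card (slice y l D))"
proof -
  have "D = (\<Union>l\<in>{..N}. (\<lambda>u. u + single y l) ` slice y l D)"
  proof (intro equalityI subsetI)
    fix u assume u: "u \<in> D"
    obtain v where v: "u = v + single y (lookup u y)" "lookup v y = 0"
      by (rule exponent_split_at)
    with u have "v \<in> slice y (lookup u y) D" by (simp add: slice_def)
    with v(1) assms(2)[OF u] show "u \<in> (\<Union>l\<in>{..N}. (\<lambda>u. u + single y l) ` slice y l D)" by blast
  qed (auto simp: slice_def)
  then have "card D = card (\<Union>l\<in>{..N}. (\<lambda>u. u + single y l) ` slice y l D)" by simp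
  also have "\<dots> = (\<Sum>l\<le>N. card ((\<lambda>u. u + single y l) ` slice y l D))"
  proof (rule card_UN_disjoint)
    show "\<forall>i\<in>{..N}. \<forall>j\<in>{..N}. i \<noteq> j \<longrightarrow>
       (\<lambda>u. u + single y i) ` slice y i D \<inter> (\<lambda>u. u + single y j) ` slice y j D = {}"
    proof (intro ballI impI)
      fix i j :: nat assume "i \<noteq> j"
      show "(\<lambda>u. u + single y i) ` slice y i D \<inter> (\<lambda>u. u + single y j) ` slice y j D = {}"
      proof (rule ccontr)
        assume "\<not> ?thesis"
        then obtain u v where "u \<in> slice y i D" "v \<in> slice y j D" "u + single y i = v + single y j"
          by blast
        then have "lookup u y = 0" "lookup v y = 0" "lookup (u + single y i) y = lookup (v + single y j) y"
          by (auto simp: slice_def)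
        with \<open>i \<noteq> j\<close> show False by (simp add: lookup_add)
      qed
    qed
  qed (use assms finite_slice in auto)
  also have "\<dots> = (\<Sum>l\<le>N. card (slice y l D))"
    by (intro sum.cong refl card_image) (auto intro: inj_onI)
  finally show ?thesis .
qed

lemma slice_0_envelope:
  assumes "y \<notin> W" "0 < e y"
  shows "slice y 0 (envelope (box (insert y W) e) D) = envelope (box W e) (slice y 0 D)"
proof -
  have "u \<in> box (insert y W) e \<longleftrightarrow> u \<in> box W e" if "lookup u y = 0" for u
    using that assms unfolding box_def exps_iff by (auto simp: zero_enat_def) metis
  moreover have "lookup u y = 0" if "u \<in> box W e" for u
    using that assms unfolding box_def exps_iff by auto
  ultimately show ?thesis unfolding slice_def envelope_def by (auto simp: lookup_add)
qed

text \<open>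
  Of the quotients of \<open>u x\<^sub>y^(l+1)\<close>, the one by \<open>x\<^sub>y\<close> lies in \<open>D\<close> iff \<open>u\<close> is in slice \<open>l\<close>. The quotients by
  other variables then lie in \<open>D\<close> as well, because they arise from \<open>u x\<^sub>y^l\<close> by exchanging that variable
  for \<open>x\<^sub>y\<close>.
\<close>

lemma slice_Suc_envelope:
  assumes y: "\<forall>i\<in>W. i < y" and l: "enat (Suc l) < e y"
    and D: "D \<subseteq> box (insert y W) e" "divisor_closed D" "costable (insert y W) (box (insert y W) e) D"
  shows "slice y (Suc l) (envelope (box (insert y W) e) D) = slice y l D"
proof (intro equalityI subsetI)
  fix u assume "u \<in> slice y (Suc l) (envelope (box (insert y W) e) D)"
  moreover have "u + single y (Suc l) = (u + single y l) + unitv y"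
    by (simp add: add.assoc single_add[symmetric])
  ultimately show "u \<in> slice y l D" by (auto simp: slice_def envelope_def)
next
  fix u assume u: "u \<in> slice y l D"
  have "y \<notin> W" using y by auto
  have "u \<in> box W e" using slice_subset_box[OF \<open>y \<notin> W\<close> D(1)] u by blast
  then have uB: "u \<in> slice y (Suc l) (box (insert y W) e)" using slice_box[OF \<open>y \<notin> W\<close>, of "Suc l" e, OF l] by simp
  have "v \<in> D" if v: "u + single y (Suc l) = v + unitv i" for v i
  proof (cases "i = y")
    case True
    have "u + single y l + unitv y = v + unitv y"
      using v True by (simp add: add.assoc single_add[symmetric])
    then have "u + single y l = v" by simp
    then show ?thesis using u by (auto simp: slice_def)
  next
    case False
    have "lookup u i \<noteq> 0"
      using arg_cong[OF v, of "\<lambda>m. lookup m i"] False by (auto simp: lookup_add lookup_single when_def)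
    then obtain v' where v': "u = v' + unitv i" using exponent_split_unitv in_keys_iff by metis
    have "i \<in> W" using \<open>u \<in> box W e\<close> \<open>lookup u i \<noteq> 0\<close> by (auto simp: box_def exps_iff)
    have "v' + unitv i + single y (Suc l) = v + unitv i" using v v' by simp
    then have "v = v' + single y (Suc l)" by (metis (no_types, lifting) add.assoc add.commute add_right_cancel)
    then have eq: "v = (v' + single y l) + unitv y" by (simp add: add.assoc single_add[symmetric])
    moreover have "(v' + single y l) + unitv i \<in> D"
      using u v' by (simp add: slice_def ac_simps)
    moreover have "v \<in> box (insert y W) e"
      using uB v divisor_closedD[OF divisor_closed_box, of v "unitv i"] by (simp add: slice_def)
    ultimately show ?thesis using D(3) \<open>i \<in> W\<close> y unfolding costable_def by blast
  qed
  then show "u \<in> slice y (Suc l) (envelope (box (insert y W) e) D)"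
    using uB by (auto simp: slice_def envelope_def)
qed

section \<open>Initial segments have the largest partial sums and envelopes\<close>

text \<open>
  The combinatorial form of the inequality for products, in the variables \<open>W\<close>.
\<close>

definition envelope_bound :: "nat set \<Rightarrow> (nat \<Rightarrow> enat) \<Rightarrow> bool" where
  "envelope_bound W e \<longleftrightarrow> (\<forall>D T. D \<subseteq> box W e \<longrightarrow> finite D \<longrightarrow> divisor_closed D \<longrightarrow>
     costable W (box W e) D \<longrightarrow> initial (box W e) T \<longrightarrow> finite T \<longrightarrow> card T = card D \<longrightarrow>
     card (envelope (box W e) D) \<le> card (envelope (box W e) T))"

lemma box_subset_exps: "box W e \<subseteq> exps W"
  by (auto simp: box_def)

lemma slice_subset_envelope:
  assumes y: "\<forall>i\<in>W. i < y" and l: "enat (Suc l) < e y"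
    and D: "D \<subseteq> box (insert y W) e" "divisor_closed D" "costable (insert y W) (box (insert y W) e) D"
  shows "slice y l D \<subseteq> envelope (box W e) (slice y (Suc l) D)"
proof
  fix u assume u: "u \<in> slice y l D"
  have "y \<notin> W" using y by auto
  have "u \<in> box W e" using slice_subset_box[OF \<open>y \<notin> W\<close> D(1)] u by blast
  have "u \<in> slice y (Suc l) (envelope (box (insert y W) e) D)"
    using slice_Suc_envelope[OF assms] u by simp
  then have hu: "u + single y (Suc l) \<in> envelope (box (insert y W) e) D" by (simp add: slice_def)
  have "v \<in> slice y (Suc l) D" if "u = v + unitv i" for v i
  proof -
    have "u + single y (Suc l) = (v + single y (Suc l)) + unitv i" using that by (simp add: ac_simps)
    then have "v + single y (Suc l) \<in> D" using hu by (auto simp: envelope_def)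
    moreover have "lookup v y = 0" using u that by (simp add: slice_def lookup_add)
    ultimately show ?thesis by (simp add: slice_def)
  qed
  then show "u \<in> envelope (box W e) (slice y (Suc l) D)"
    using \<open>u \<in> box W e\<close> by (auto simp: envelope_def)
qed

text \<open>
  The step from slice \<open>l + 1\<close> to slice \<open>l\<close>, with \<open>w\<close> the largest element of the initial segment \<open>S\<close>.
  Replace slice \<open>l + 1\<close> of \<open>D\<close> by the initial segment \<open>T\<close> of the same size; slice \<open>l\<close> of \<open>D\<close> has at most
  as many elements as the envelope of \<open>T\<close>. If \<open>T\<close> does not contain the trace of \<open>w\<close>, and \<open>l\<close> is smaller
  than the exponent of \<open>x\<^sub>y\<close> in \<open>w\<close>, then \<open>move_to_last_le\<close> puts the envelope of \<open>T\<close> into slice \<open>l\<close> of \<open>S\<close>.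
  If \<open>l\<close> is at least that exponent and \<open>T\<close> misses an element of slice \<open>l + 1\<close> of \<open>S\<close>, then
  \<open>large_element_above\<close> gives an element of slice \<open>l\<close> of \<open>S\<close> outside of the envelope of \<open>T\<close>; both sets
  are initial segments, so the envelope is the smaller one.
\<close>

lemma slice_card_step:
  fixes W :: "nat set" and y l :: nat and e :: "nat \<Rightarrow> enat"
  defines "B \<equiv> box W e" and "B' \<equiv> box (insert y W) e"
  assumes W: "finite W" "\<forall>i\<in>W. i < y" and bound: "envelope_bound W e"
    and D: "D \<subseteq> B'" "finite D" "divisor_closed D" "costable (insert y W) B' D"
    and S: "S = {x \<in> B'. x \<preceq> w}" "w \<in> B'" "initial B' S" "finite S"
    and l: "enat (Suc l) < e y"
  shows "lookup w y \<le> l \<Longrightarrow> card (slice y (Suc l) D) < card (slice y (Suc l) S) \<Longrightarrow>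
      card (slice y l D) < card (slice y l S)"
    and "lookup w y = Suc l \<Longrightarrow> card (slice y (Suc l) D) < card (slice y (Suc l) S) \<Longrightarrow>
      card (slice y l D) \<le> card (slice y l S)"
    and "Suc l < lookup w y \<Longrightarrow> card (slice y (Suc l) D) \<le> card (slice y (Suc l) S) \<Longrightarrow>
      card (slice y l D) \<le> card (slice y l S)"
proof -
  have yW: "y \<notin> W" using W(2) by auto
  have l': "enat l < e y" using enat_less_le_trans[OF l] by simp
  let ?D1 = "slice y (Suc l) D" and ?S1 = "slice y (Suc l) S" and ?S0 = "slice y l S"
  have D1: "?D1 \<subseteq> B" "finite ?D1" "divisor_closed ?D1" "costable W B ?D1"
    using slice_subset_box[OF yW D(1)[unfolded B'_def]] finite_slice[OF D(2)] slice_divisor_closed[OF D(3)]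
      slice_costable[OF yW D(1,4)[unfolded B'_def]] by (auto simp: B_def)
  have S1: "initial B ?S1" "finite ?S1" and S0: "initial B ?S0" "finite ?S0"
    using slice_initial[OF yW S(3)[unfolded B'_def]] finite_slice[OF S(4)] by (auto simp: B_def)
  have "finite B \<longrightarrow> card ?D1 \<le> card B" using D1(1) card_mono by blast
  then obtain T where T: "initial B T" "finite T" "card T = card ?D1"
    using initial_exists[OF W(1) box_subset_exps[of W e], folded B_def] by metis
  have TB: "T \<subseteq> B" using T(1) by (simp add: initial_def)
  have fin: "finite (envelope B X)" if "finite X" for X
    unfolding B_def by (rule finite_envelope[OF W(1) box_subset_exps that])
  have "card (slice y l D) \<le> card (envelope B ?D1)"
    using slice_subset_envelope[OF W(2) l D(1,3,4)[unfolded B'_def]] fin[OF D1(2)]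
    by (auto simp: B_def intro: card_mono)
  also have "\<dots> \<le> card (envelope B T)"
    using bound D1 T unfolding envelope_bound_def B_def by blast
  finally have le: "card (slice y l D) \<le> card (envelope B T)" .
  have sliceS: "u \<in> slice y q S \<longleftrightarrow> u \<in> B \<and> u + single y q \<preceq> w" if "enat q < e y" for u q
    using slice_box[OF yW, of q e, OF that] unfolding S(1) B_def B'_def slice_def by auto
  have sub: "envelope B T \<subseteq> ?S0" if T1: "T \<subseteq> ?S1" and a: "Suc l \<le> lookup w y"
    and ne: "\<And>v. v \<in> T \<Longrightarrow> v + single y (Suc l) \<noteq> w"
  proof
    fix u assume u: "u \<in> envelope B T"
    have "u + single y l \<preceq> w"
    proof (cases "u = 0")
      case True
      have "l < total_deg w" using a total_deg_ge_lookup[of w y] by linarith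
      then show ?thesis using True by (auto simp: deglex_le_iff)
    next
      case False
      then obtain v j where v: "u = v + unitv j" and j: "j \<in> keys u" "\<And>i. i > j \<Longrightarrow> lookup u i = 0"
        using split_last_unitv[OF False] by metis
      have vT: "v \<in> T" using u v by (auto simp: envelope_def)
      have "u \<in> exps W" using u box_subset_exps by (auto simp: envelope_def B_def)
      then have "j < y" using j(1) W(2) by (auto simp: exps_def)
      moreover have "lookup v i = 0" if "i > j" for i using j(2)[OF that] v by (simp add: lookup_add)
      moreover have "v + single y (Suc l) \<preceq> w" using vT T1 sliceS[OF l] by blast
      ultimately show ?thesis unfolding v using a ne[OF vT] by (intro move_to_last_le)
    qed
    then show "u \<in> ?S0" using u sliceS[OF l'] by (auto simp: envelope_def)
  qed
  have proper: "T \<subset> ?S1" if "card ?D1 < card ?S1"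
    using initial_card_le[OF T(1) S1(1) T(2) S1(2)] T(3) that by auto
  show "card (slice y l D) < card (slice y l S)"
    if a: "lookup w y \<le> l" and less: "card ?D1 < card ?S1"
  proof -
    obtain v where v: "v \<in> ?S1" "v \<notin> T" using proper[OF less] by blast
    then have vB: "v \<in> B" "v + single y (Suc l) \<preceq> w" using sliceS[OF l] by auto
    obtain x k where x: "x + unitv k \<in> B" "x + unitv k + single y l \<preceq> w" "v \<preceq> x"
      using large_element_above[OF W(2) vB(1)[unfolded B_def] S(2)[unfolded B'_def] vB(2) a] B_def by metis
    have "x + unitv k \<in> ?S0" using x sliceS[OF l'] by blast
    moreover have "x \<notin> T" using T(1) v(2) vB(1) x(3) by (auto simp: initial_def deglex_le_def)
    then have "x + unitv k \<notin> envelope B T" by (auto simp: envelope_def)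
    ultimately have "envelope B T \<subset> ?S0"
      using envelope_initial[OF T(1)[unfolded B_def]] S0(1)
        initial_comparable B_def by blast
    then have "card (envelope B T) < card ?S0" using S0(2) by (rule psubset_card_mono[rotated])
    with le show ?thesis by simp
  qed
  show "card (slice y l D) \<le> card (slice y l S)"
    if a: "lookup w y = Suc l" and less: "card ?D1 < card ?S1"
  proof -
    have "v + single y (Suc l) \<noteq> w" if vT: "v \<in> T" for v
    proof
      assume w: "v + single y (Suc l) = w"
      have "?S1 \<subseteq> T"
      proof
        fix u assume "u \<in> ?S1"
        then have "u \<in> B" "u + single y (Suc l) \<preceq> v + single y (Suc l)" using sliceS[OF l] w by auto
        then have "u \<in> B" "u \<preceq> v" by (auto simp: deglex_le_def)
        then show "u \<in> T" using T(1) vT by (auto simp: initial_def deglex_le_def)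
      qed
      with proper[OF less] show False by blast
    qed
    then have "envelope B T \<subseteq> ?S0" using sub proper[OF less] a by auto
    then show ?thesis using le card_mono[OF S0(2)] by (meson order_trans)
  qed
  show "card (slice y l D) \<le> card (slice y l S)"
    if a: "Suc l < lookup w y" and less: "card ?D1 \<le> card ?S1"
  proof -
    have "T \<subseteq> ?S1" using initial_card_le[OF T(1) S1(1) T(2) S1(2)] T(3) less by auto
    moreover have "v + single y (Suc l) \<noteq> w" if "v \<in> T" for v
    proof
      assume w: "v + single y (Suc l) = w"
      have "lookup v y = 0" using that TB yW by (auto simp: B_def box_def exps_iff)
      with arg_cong[OF w, of "\<lambda>m. lookup m y"] a show False by (simp add: lookup_add)
    qed
    ultimately have "envelope B T \<subseteq> ?S0" using sub a by auto
    then show ?thesis using le card_mono[OF S0(2)] by (meson order_trans)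
  qed
qed

text \<open>
  If the partial sum of \<open>D\<close> were larger, then \<open>D\<close> would have a larger slice \<open>k \<le> \<rho>\<close> and, the totals being
  equal, a smaller slice \<open>l > \<rho>\<close>. The latter forces all slices below \<open>l\<close> to be at most as large as
  those of \<open>S\<close>.
\<close>

lemma partial_sums_initial:
  fixes W :: "nat set" and y \<rho> :: nat and e :: "nat \<Rightarrow> enat"
  defines "B' \<equiv> box (insert y W) e"
  assumes W: "finite W" "\<forall>i\<in>W. i < y" and bound: "envelope_bound W e"
    and D: "D \<subseteq> B'" "finite D" "divisor_closed D" "costable (insert y W) B' D"
    and S: "initial B' S" "finite S" "card S = card D"
  shows "(\<Sum>l\<le>\<rho>. card (slice y l D)) \<le> (\<Sum>l\<le>\<rho>. card (slice y l S))"
proof (cases "S = {}")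
  case True
  with S(3) D(2) show ?thesis by simp
next
  case False
  obtain w where w: "w \<in> S" "S = {x \<in> B'. x \<preceq> w}" using initial_eq_below_Max[OF S(1,2) False] .
  then have wB: "w \<in> B'" by auto
  let ?d = "\<lambda>l. card (slice y l D)" and ?c = "\<lambda>l. card (slice y l S)"
  show ?thesis
  proof (rule ccontr)
    assume neg: "\<not> ?thesis"
    obtain N where N: "\<And>u. u \<in> D \<union> S \<Longrightarrow> lookup u y \<le> N"
      using finite_nat_set_iff_bounded_le[of "(\<lambda>u. lookup u y) ` (D \<union> S)"] D(2) S(2) by auto
    define M where "M = max N \<rho>"
    have "(\<Sum>l\<le>M. ?d l) = (\<Sum>l\<le>M. ?c l)"
      using card_eq_sum_slices[OF D(2), of y M] card_eq_sum_slices[OF S(2), of y M] N S(3)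
      by (auto simp: M_def le_max_iff_disj)
    moreover have split: "(\<Sum>l\<le>M. f l) = (\<Sum>l\<le>\<rho>. f l) + (\<Sum>l\<in>{Suc \<rho>..M}. f l)" for f :: "nat \<Rightarrow> nat"
    proof -
      have "{..M} = {..\<rho>} \<union> {Suc \<rho>..M}" by (auto simp: M_def)
      then show ?thesis by (simp add: sum.union_disjoint)
    qed
    ultimately have "(\<Sum>l\<in>{Suc \<rho>..M}. ?d l) < (\<Sum>l\<in>{Suc \<rho>..M}. ?c l)" using neg by simp
    then obtain l where l: "l > \<rho>" "?d l < ?c l"
      by (metis (no_types, lifting) atLeastAtMost_iff not_le sum_mono Suc_le_eq)
    obtain k where k: "k \<le> \<rho>" "?d k > ?c k"
      using neg by (metis (no_types, lifting) atMost_iff not_le sum_mono)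
    have ley: "enat l < e y"
    proof (rule ccontr)
      assume "\<not> enat l < e y"
      then have "slice y l S = {}" by (rule slice_box_empty) (use w in \<open>auto simp: B'_def\<close>)
      with l show False by simp
    qed
    have "k \<le> l" using k l by simp
    then have "(lookup w y \<le> k \<longrightarrow> ?d k < ?c k) \<and> (k < lookup w y \<longrightarrow> ?d k \<le> ?c k)"
    proof (induction k rule: inc_induct)
      case base
      then show ?case using l by auto
    next
      case (step q)
      have "enat (Suc q) < e y" using enat_less_le_trans[OF ley] step(2) by simp
      note * = slice_card_step[OF W bound D[unfolded B'_def] w(2)[unfolded B'_def] wB[unfolded B'_def]
          S(1)[unfolded B'_def] S(2) this]
      consider "lookup w y \<le> q" | "lookup w y = Suc q" | "Suc q < lookup w y" by linarith
      then show ?case using * step.IH by cases auto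
    qed
    with k show False by linarith
  qed
qed

lemma card_envelope_eq:
  fixes W :: "nat set" and y :: nat and e :: "nat \<Rightarrow> enat"
  defines "B' \<equiv> box (insert y W) e"
  assumes W: "finite W" "\<forall>i\<in>W. i < y"
    and D: "D \<subseteq> B'" "finite D" "divisor_closed D" "costable (insert y W) B' D"
    and N: "enat N < e y" "\<And>u. u \<in> envelope B' D \<Longrightarrow> lookup u y \<le> N"
  shows "card (envelope B' D) = card (envelope (box W e) (slice y 0 D)) + (\<Sum>l<N. card (slice y l D))"
proof -
  have "y \<notin> W" using W by auto
  have "finite (envelope B' D)"
    using finite_envelope[OF _ box_subset_exps D(2)] W(1) unfolding B'_def by blast
  then have "card (envelope B' D) = (\<Sum>l\<le>N. card (slice y l (envelope B' D)))"
    using N(2) by (rule card_eq_sum_slices)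
  also have "\<dots> = card (slice y 0 (envelope B' D)) + (\<Sum>l<N. card (slice y (Suc l) (envelope B' D)))"
    unfolding lessThan_Suc_atMost[symmetric] by (rule sum.lessThan_Suc_shift)
  also have "(\<Sum>l<N. card (slice y (Suc l) (envelope B' D))) = (\<Sum>l<N. card (slice y l D))"
  proof (rule sum.cong[OF refl])
    fix l assume "l \<in> {..<N}"
    then have "enat (Suc l) < e y" using enat_less_le_trans[OF N(1)] by simp
    then show "card (slice y (Suc l) (envelope B' D)) = card (slice y l D)"
      using slice_Suc_envelope[OF W(2) _ D(1,3,4)[unfolded B'_def]] by (simp add: B'_def)
  qed
  also have "slice y 0 (envelope B' D) = envelope (box W e) (slice y 0 D)"
    unfolding B'_def by (rule slice_0_envelope[OF \<open>y \<notin> W\<close>])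
      (use enat_less_le_trans[OF N(1)] in \<open>auto simp: zero_enat_def\<close>)
  finally show ?thesis .
qed

text \<open>
  Induction on the number of variables. Only the choice of the top exponent \<open>N\<close> of the last variable
  depends on whether \<open>e y\<close> is finite: it is \<open>e y - 1\<close>, or else any bound for the two envelopes.
\<close>

lemma envelope_bound:
  assumes "finite W" "\<forall>i\<in>W. 1 \<le> e i"
  shows "envelope_bound W e"
  using assms
proof (induction W rule: finite_linorder_max_induct)
  case empty
  have "box {} e = {0}" by (auto simp: box_def exps_iff intro: poly_mapping_eqI)
  moreover have "envelope {0} D = {0}" for D
  proof -
    have "v \<in> D" if "0 = v + unitv i" for v i
      using arg_cong[OF that, of total_deg] by simp
    then have "0 \<in> envelope {0} D" unfolding envelope_def by blast
    moreover have "envelope {0} D \<subseteq> {0}" unfolding envelope_def by blast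
    ultimately show ?thesis by auto
  qed
  ultimately show ?case by (simp add: envelope_bound_def)
next
  case (insert y W)
  let ?B' = "box (insert y W) e" and ?B = "box W e"
  have y: "y \<notin> W" and bound: "envelope_bound W e" using insert by auto
  note W = insert(1,2)
  show ?case unfolding envelope_bound_def
  proof (intro allI impI)
    fix D S
    assume D: "D \<subseteq> ?B'" "finite D" "divisor_closed D" "costable (insert y W) ?B' D"
      and S: "initial ?B' S" "finite S" "card S = card D"
    have S': "S \<subseteq> ?B'" "divisor_closed S" "costable (insert y W) ?B' S"
      using S(1) initial_divisor_closed initial_costable by (auto simp: initial_def)
    have "finite (insert y W)" using W(1) by simp
    then have fin: "finite (envelope ?B' D \<union> envelope ?B' S)"
      using finite_envelope[OF _ box_subset_exps D(2)] finite_envelope[OF _ box_subset_exps S(2)]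
      by simp
    obtain N where N: "enat N < e y" "\<And>u. u \<in> envelope ?B' D \<union> envelope ?B' S \<Longrightarrow> lookup u y \<le> N"
    proof (cases "e y")
      case (enat k)
      have "k \<noteq> 0" using insert.prems enat by (auto simp: one_enat_def)
      then have k: "enat (k - 1) < e y" using enat by simp
      have "lookup u y \<le> k - 1" if "u \<in> envelope ?B' D \<union> envelope ?B' S" for u
      proof -
        have "u \<in> ?B'" using that unfolding envelope_def by blast
        then have "enat (lookup u y) < enat k" unfolding box_def using enat by auto
        then show ?thesis by simp
      qed
      then show ?thesis using k that by blast
    next
      case infinity
      then show ?thesis
        using finite_nat_set_iff_bounded_le[of "(\<lambda>u. lookup u y) ` (envelope ?B' D \<union> envelope ?B' S)"] fin that
        by auto
    qed
    have "card (slice y 0 D) \<le> card (slice y 0 S)"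
      using partial_sums_initial[OF W bound D S, of 0] by simp
    moreover have "finite ?B \<longrightarrow> card (slice y 0 D) \<le> card ?B"
      using slice_subset_box[OF y D(1)] card_mono by blast
    then obtain T where T: "initial ?B T" "finite T" "card T = card (slice y 0 D)"
      using initial_exists[OF W(1) box_subset_exps[of W e]] by metis
    ultimately have "T \<subseteq> slice y 0 S"
      using initial_card_le[OF T(1) slice_initial[OF y S(1)] T(2) finite_slice[OF S(2)]] by simp
    then have "card (envelope ?B T) \<le> card (envelope ?B (slice y 0 S))"
      using finite_envelope[OF W(1) box_subset_exps finite_slice[OF S(2)]] envelope_mono card_mono by metis
    moreover have "card (envelope ?B (slice y 0 D)) \<le> card (envelope ?B T)"
      by (rule bound[unfolded envelope_bound_def, rule_format, OF slice_subset_box[OF y D(1)]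
            finite_slice[OF D(2)] slice_divisor_closed[OF D(3)] slice_costable[OF y D(1,4)] T])
    moreover have "(\<Sum>l<N. card (slice y l D)) \<le> (\<Sum>l<N. card (slice y l S))"
      using partial_sums_initial[OF W bound D S, of "N - 1"]
      by (cases N) (auto simp: lessThan_Suc_atMost)
    moreover have "card (envelope ?B' D) = card (envelope ?B (slice y 0 D)) + (\<Sum>l<N. card (slice y l D))"
      using card_envelope_eq[OF W D N(1)] N(2) by blast
    moreover have "card (envelope ?B' S) = card (envelope ?B (slice y 0 S)) + (\<Sum>l<N. card (slice y l S))"
      using card_envelope_eq[OF W S'(1) S(2) S'(2,3) N(1)] N(2) by blast
    ultimately show "card (envelope ?B' D) \<le> card (envelope ?B' S)" by linarith
  qed
qed

section \<open>Polynomial rings and their graded quotients\<close>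

lemma poly_sum_monomials: "p = (\<Sum>m\<in>keys p. single m (lookup p m))"
proof (rule poly_mapping_eqI)
  fix k
  have "lookup (\<Sum>m\<in>keys p. single m (lookup p m)) k = (\<Sum>m\<in>keys p. if k = m then lookup p m else 0)"
    by (simp add: lookup_sum lookup_single when_def eq_commute)
  also have "\<dots> = lookup p k" by (simp add: in_keys_iff)
  finally show "lookup p k = lookup (\<Sum>m\<in>keys p. single m (lookup p m)) k" by simp
qed

definition restr :: "'b set \<Rightarrow> ('b \<Rightarrow>\<^sub>0 'c::zero) \<Rightarrow> 'b \<Rightarrow>\<^sub>0 'c" where
  "restr G p = Poly_Mapping.mapp (\<lambda>m c. if m \<in> G then c else 0) p"

lemma lookup_restr [simp]: "lookup (restr G p) m = (if m \<in> G then lookup p m else 0)"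
  by (auto simp: restr_def lookup_mapp when_def in_keys_iff)

lemma keys_restr [simp]: "keys (restr G p) = keys p \<inter> G"
  by (auto simp: in_keys_iff split: if_splits)

lemma restr_idem [simp]: "keys p \<subseteq> G \<Longrightarrow> restr G p = p"
  by (intro poly_mapping_eqI) (auto simp: in_keys_iff)

lemma keys_add_subset: "keys p \<subseteq> G \<Longrightarrow> keys q \<subseteq> G \<Longrightarrow> keys (p + q) \<subseteq> G"
  using keys_add[of p q] by blast

lemma keys_sum_subset: "(\<And>i. i \<in> S \<Longrightarrow> keys (f i) \<subseteq> G) \<Longrightarrow> keys (\<Sum>i\<in>S. f i) \<subseteq> G"
  by (induction S rule: infinite_finite_induct) (simp_all add: keys_add_subset)

lemma keys_uminus' [simp]: "keys (- p) = keys (p :: 'b \<Rightarrow>\<^sub>0 'c::ab_group_add)"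
  by (auto simp: in_keys_iff)

lemma keys_mult_exps: "keys p \<subseteq> exps V \<Longrightarrow> keys q \<subseteq> exps V \<Longrightarrow> keys (p * q) \<subseteq> exps V"
  using keys_mult[of p q] by fastforce

text \<open>
  The sets of exponents of the monomials in a monomial ideal of the polynomial ring.
\<close>

definition upset :: "nat set \<Rightarrow> (nat \<Rightarrow>\<^sub>0 nat) set \<Rightarrow> bool" where
  "upset V G \<longleftrightarrow> G \<subseteq> exps V \<and> (\<forall>m\<in>G. \<forall>m'\<in>exps V. m + m' \<in> G)"

definition upclose :: "nat set \<Rightarrow> (nat \<Rightarrow>\<^sub>0 nat) set \<Rightarrow> (nat \<Rightarrow>\<^sub>0 nat) set" where
  "upclose V E = {m + m' | m m'. m \<in> E \<and> m' \<in> exps V}"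

lemma upset_upclose: "E \<subseteq> exps V \<Longrightarrow> upset V (upclose V E)"
  unfolding upset_def upclose_def by (auto simp: add.assoc) (metis exps_add)

lemma upclose_upset: "upset V G \<Longrightarrow> upclose V G = G"
  unfolding upset_def upclose_def by (auto, metis add.right_neutral exps_zero)

lemma upset_diff:
  assumes "divisor_closed N" shows "upset V (exps V - N)"
  using assms unfolding upset_def divisor_closed_def by auto

lemma keys_mult_upset:
  assumes "upset V G" "keys p \<subseteq> G" "keys q \<subseteq> exps V" shows "keys (p * q) \<subseteq> G"
  using keys_mult[of p q] assms unfolding upset_def by fastforce

lemma poly_alg_simps [simp]:
  "carrier (poly_alg V) = {p. keys p \<subseteq> exps V}" "monoid.mult (poly_alg V) = (*)"
  "one (poly_alg V) = 1" "zero (poly_alg V) = 0" "add (poly_alg V) = (+)"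
  "vars (poly_alg V) = V" "proj (poly_alg V) = (\<lambda>p. p)"
  by (simp_all add: poly_alg_def)

lemma cring_poly_alg: "cring (poly_alg V :: ('k::field, 'k mpoly) galg)"
proof (rule cringI)
  show "abelian_group (poly_alg V :: ('k, 'k mpoly) galg)"
  proof (rule abelian_groupI)
    fix x :: "'k mpoly" assume "x \<in> carrier (poly_alg V)"
    then show "\<exists>y\<in>carrier (poly_alg V). y \<oplus>\<^bsub>poly_alg V\<^esub> x = \<zero>\<^bsub>poly_alg V\<^esub>"
      by (intro bexI[of _ "- x"]) simp_all
  qed (simp_all add: add.assoc add.commute keys_add_subset)
  show "comm_monoid (poly_alg V :: ('k, 'k mpoly) galg)"
    by (rule comm_monoidI) (simp_all add: mult.assoc mult.commute keys_mult_exps)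
qed (simp add: distrib_right)

lemma cring_extend: "cring (ring.extend r m) \<longleftrightarrow> cring r"
  unfolding cring_def ring_def ring_axioms_def abelian_group_def abelian_group_axioms_def
    abelian_monoid_def comm_monoid_def comm_monoid_axioms_def monoid_def comm_group_def group_def
    group_axioms_def Units_def
  by (simp add: ring.defs)

text \<open>
  Both sides unfold to the same statement on the fields of the ring record.
\<close>

lemma primeideal_extend: "primeideal P (ring.extend r m) \<longleftrightarrow> primeideal P r"
  unfolding primeideal_def primeideal_axioms_def ideal_def ideal_axioms_def additive_subgroup_def
    cring_def ring_def ring_axioms_def abelian_group_def abelian_group_axioms_def subgroup_def m_inv_def
    abelian_monoid_def comm_monoid_def comm_monoid_axioms_def monoid_def comm_group_def group_def
    group_axioms_def Units_def
  by (simp add: ring.defs)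

lemma krull_dim_extend: "krull_dim (ring.extend r m) = krull_dim r"
  unfolding krull_dim_def primeideal_extend by simp

lemma krull_dim_quot_alg: "krull_dim (A Quot I) = krull_dim (quot_alg A I)"
  by (simp add: quot_alg_def krull_dim_extend)

lemma quot_alg_simps:
  "carrier (quot_alg A I) = carrier (A Quot I)" "monoid.mult (quot_alg A I) = monoid.mult (A Quot I)"
  "one (quot_alg A I) = one (A Quot I)" "zero (quot_alg A I) = zero (A Quot I)"
  "add (quot_alg A I) = add (A Quot I)" "vars (quot_alg A I) = vars A"
  "proj (quot_alg A I) = (\<lambda>p. I +>\<^bsub>A\<^esub> proj A p)"
  by (simp_all add: quot_alg_def ring.defs galg.defs)

text \<open>
  What all the algebras at hand share, whether or not they are quotients by monomial ideals: they
  are images of a polynomial ring in finitely many variables.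
\<close>

locale presentation = cring A for A :: "('k::field, 'a) galg" (structure) +
  assumes finite_vars: "finite (vars A)"
    and proj_hom: "proj A \<in> ring_hom (poly_alg (vars A)) A"
    and proj_surj: "carrier A = proj A ` carrier (poly_alg (vars A))"
begin

abbreviation "V \<equiv> vars A"

lemma proj_add: "keys p \<subseteq> exps V \<Longrightarrow> keys q \<subseteq> exps V \<Longrightarrow> proj A (p + q) = proj A p \<oplus> proj A q"
  using ring_hom_add[OF proj_hom, of p q] by simp

lemma proj_mult: "keys p \<subseteq> exps V \<Longrightarrow> keys q \<subseteq> exps V \<Longrightarrow> proj A (p * q) = proj A p \<otimes> proj A q"
  using ring_hom_mult[OF proj_hom, of p q] by simp

lemma proj_one [simp]: "proj A 1 = \<one>"
  using ring_hom_one[OF proj_hom] by simp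

lemma proj_closed: "keys p \<subseteq> exps V \<Longrightarrow> proj A p \<in> carrier A"
  using ring_hom_closed[OF proj_hom, of p] by simp

lemma proj_zero [simp]: "proj A 0 = \<zero>"
proof -
  have "proj A 0 \<oplus> proj A 0 = proj A 0" using proj_add[of 0 0] by simp
  then show ?thesis using proj_closed[of 0] by (simp add: add.r_cancel_one)
qed

lemma proj_uminus: assumes "keys p \<subseteq> exps V" shows "proj A (- p) = \<ominus> proj A p"
proof -
  have "proj A (- p) \<oplus> proj A p = \<zero>" using proj_add[of "- p" p] assms by simp
  then show ?thesis using proj_closed assms by (intro sum_zero_eq_neg) auto
qed

lemma carrierE: assumes "f \<in> carrier A" obtains p where "f = proj A p" "keys p \<subseteq> exps V"
  using assms proj_surj by auto

lemma proj_finsum: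
  assumes "finite S" "\<And>i. i \<in> S \<Longrightarrow> keys (q i) \<subseteq> exps V"
  shows "finsum A (\<lambda>i. proj A (q i)) S = proj A (\<Sum>i\<in>S. q i)"
  using assms
proof (induction S rule: finite_induct)
  case (insert x F)
  then have "finsum A (\<lambda>i. proj A (q i)) (insert x F) = proj A (q x) \<oplus> finsum A (\<lambda>i. proj A (q i)) F"
    by (intro finsum_insert) (auto intro: proj_closed)
  also have "\<dots> = proj A (q x + (\<Sum>i\<in>F. q i))"
    using insert by (subst proj_add) (auto intro!: keys_sum_subset)
  finally show ?case using insert by simp
qed simp

lemma amon_closed: "m \<in> exps V \<Longrightarrow> amon A m \<in> carrier A"
  unfolding amon_def monom_of_def by (rule proj_closed) simp

lemma amon_add: "m \<in> exps V \<Longrightarrow> m' \<in> exps V \<Longrightarrow> amon A (m + m') = amon A m \<otimes> amon A m'"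
  unfolding amon_def monom_of_def by (subst proj_mult[symmetric]) (auto simp: mult_single)

lemma proj_single_eq: "m \<in> exps V \<Longrightarrow> proj A (single m c) = proj A (single 0 c) \<otimes> amon A m"
  unfolding amon_def monom_of_def by (subst proj_mult[symmetric]) (auto simp: mult_single)

lemma mspan_mono: "G \<subseteq> H \<Longrightarrow> mspan A G \<subseteq> mspan A H"
  by (auto simp: mspan_def)

lemma mspan_subset_carrier: "G \<subseteq> exps V \<Longrightarrow> mspan A G \<subseteq> carrier A"
  by (auto simp: mspan_def intro!: proj_closed)

lemma amon_in_mspan: "m \<in> G \<Longrightarrow> amon A m \<in> mspan A G"
  by (auto simp: mspan_def amon_def monom_of_def)

text \<open>
  Monomials generate additively, once all their scalar multiples are included.
\<close>

lemma mspan_induct: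
  assumes G: "G \<subseteq> exps V" and zero: "\<zero> \<in> H"
    and add: "\<And>f g. f \<in> H \<Longrightarrow> g \<in> H \<Longrightarrow> f \<oplus> g \<in> H"
    and single: "\<And>m c. m \<in> G \<Longrightarrow> proj A (single m c) \<in> H"
  shows "mspan A G \<subseteq> H"
proof
  fix f assume "f \<in> mspan A G"
  then obtain p where p: "f = proj A p" "keys p \<subseteq> G" by (auto simp: mspan_def)
  have "finite S \<Longrightarrow> S \<subseteq> G \<Longrightarrow> proj A (\<Sum>m\<in>S. single m (lookup p m)) \<in> H" for S
  proof (induction S rule: finite_induct)
    case empty
    show ?case using zero by simp
  next
    case (insert m S)
    have "keys (\<Sum>m\<in>S. single m (lookup p m)) \<subseteq> exps V"
      using insert.prems G by (intro keys_sum_subset) auto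
    then have "proj A (\<Sum>m\<in>insert m S. single m (lookup p m))
        = proj A (single m (lookup p m)) \<oplus> proj A (\<Sum>m\<in>S. single m (lookup p m))"
      using insert G by (simp add: proj_add subset_iff)
    then show ?case using insert add single by simp
  qed
  from this[of "keys p"] p show "f \<in> H" using poly_sum_monomials[of p] by simp
qed

lemma ideal_mspan:
  assumes "upset V G" shows "ideal (mspan A G) A"
proof (rule idealI)
  have GV: "G \<subseteq> exps V" using assms by (simp add: upset_def)
  show "ring A" by (rule ring_axioms)
  show "subgroup (mspan A G) (add_monoid A)"
  proof (rule add.subgroupI)
    show "mspan A G \<subseteq> carrier A" using GV by (rule mspan_subset_carrier)
    have "proj A 0 \<in> mspan A G" unfolding mspan_def by (rule imageI) simp
    then show "mspan A G \<noteq> {}" by blast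
    fix f assume "f \<in> mspan A G"
    then obtain p where p: "f = proj A p" "keys p \<subseteq> G" by (auto simp: mspan_def)
    then have "\<ominus> f = proj A (- p)" using proj_uminus[of p] GV by auto
    then show "\<ominus> f \<in> mspan A G" using p by (auto simp: mspan_def)
    fix g assume "g \<in> mspan A G"
    then obtain q where q: "g = proj A q" "keys q \<subseteq> G" by (auto simp: mspan_def)
    then have "f \<oplus> g = proj A (p + q)" using p proj_add[of p q] GV by auto
    then show "f \<oplus> g \<in> mspan A G" using p q keys_add_subset[of p G q] by (auto simp: mspan_def)
  qed
  fix f x assume f: "f \<in> mspan A G" and x: "x \<in> carrier A"
  from f obtain p where p: "f = proj A p" "keys p \<subseteq> G" by (auto simp: mspan_def)
  from x obtain q where q: "x = proj A q" "keys q \<subseteq> exps V" by (rule carrierE)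
  have "f \<otimes> x = proj A (p * q)" using p q proj_mult[of p q] GV by auto
  then show "f \<otimes> x \<in> mspan A G" using keys_mult_upset[OF assms p(2) q(2)] by (auto simp: mspan_def)
  moreover have "x \<otimes> f = f \<otimes> x" using f x mspan_subset_carrier[OF GV] by (intro m_comm) auto
  ultimately show "x \<otimes> f \<in> mspan A G" by simp
qed

lemma mspan_upclose_subset:
  assumes E: "E \<subseteq> exps V" and J: "ideal J A" and sub: "amon A ` E \<subseteq> J"
  shows "mspan A (upclose V E) \<subseteq> J"
proof (rule mspan_induct)
  interpret J: ideal J A by (rule J)
  show "upclose V E \<subseteq> exps V" using upset_upclose[OF E] by (simp add: upset_def)
  show "\<zero> \<in> J" by simp
  show "f \<oplus> g \<in> J" if "f \<in> J" "g \<in> J" for f g using that by simp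
  fix m c assume "m \<in> upclose V E"
  then obtain u v where uv: "m = u + v" "u \<in> E" "v \<in> exps V" by (auto simp: upclose_def)
  have "proj A (single m c) = proj A (single 0 1 * single u 1 * single v c)"
    by (simp add: mult_single uv)
  also have "\<dots> = amon A u \<otimes> proj A (single v c)"
    using uv E unfolding amon_def monom_of_def by (subst proj_mult[symmetric]) (auto simp: mult_single)
  also have "\<dots> \<in> J"
    using uv E sub by (intro J.I_r_closed proj_closed) auto
  finally show "proj A (single m c) \<in> J" .
qed

text \<open>
  Zero is admitted as an additional generator since \<open>x^\<infinity> = 0\<close> occurs among the generators that define
  a truncated polynomial ring.
\<close>

lemma genideal_monomials:
  assumes E: "E \<subseteq> exps V" and S: "amon A ` E \<subseteq> S" "S \<subseteq> insert \<zero> (amon A ` E)"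
  shows "Idl S = mspan A (upclose V E)"
proof
  have "amon A ` E \<subseteq> carrier A" using E amon_closed by auto
  then have Sc: "S \<subseteq> carrier A" using S(2) zero_closed by blast
  have id: "ideal (mspan A (upclose V E)) A" using upset_upclose[OF E] by (rule ideal_mspan)
  have "E \<subseteq> upclose V E" unfolding upclose_def by (auto, metis add.right_neutral exps_zero)
  then have "amon A ` E \<subseteq> mspan A (upclose V E)" using amon_in_mspan by blast
  moreover have "\<zero> \<in> mspan A (upclose V E)"
    using id by (simp add: ideal.axioms(1) additive_subgroup.zero_closed)
  ultimately show "Idl S \<subseteq> mspan A (upclose V E)" using S by (intro genideal_minimal[OF id]) blast
  show "mspan A (upclose V E) \<subseteq> Idl S"
    using mspan_upclose_subset[OF E genideal_ideal[OF Sc]] genideal_self[OF Sc] S by blast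
qed

lemma ideal_prod_mspan:
  assumes G: "upset V G" and H: "upset V H"
  shows "mspan A G \<cdot> mspan A H = mspan A {g + h | g h. g \<in> G \<and> h \<in> H}" (is "_ = mspan A ?GH")
proof
  have GV: "G \<subseteq> exps V" "H \<subseteq> exps V" using G H by (auto simp: upset_def)
  have GH: "upset V ?GH"
    using G H unfolding upset_def by (auto simp: add.assoc) blast
  interpret I: ideal "mspan A ?GH" A using GH by (rule ideal_mspan)
  show "mspan A G \<cdot> mspan A H \<subseteq> mspan A ?GH"
  proof
    fix f assume "f \<in> mspan A G \<cdot> mspan A H"
    then show "f \<in> mspan A ?GH"
    proof induction
      case (prod i j)
      then obtain p q where pq: "i = proj A p" "keys p \<subseteq> G" "j = proj A q" "keys q \<subseteq> H"
        by (auto simp: mspan_def)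
      then have "i \<otimes> j = proj A (p * q)" using proj_mult[of p q] GV by auto
      moreover have "keys (p * q) \<subseteq> ?GH" using keys_mult[of p q] pq by fastforce
      ultimately show ?case by (auto simp: mspan_def)
    qed simp
  qed
  have "?GH = upclose V ?GH" using upclose_upset[OF GH] by simp
  moreover have "mspan A (upclose V ?GH) \<subseteq> mspan A G \<cdot> mspan A H"
  proof (rule mspan_upclose_subset)
    show "?GH \<subseteq> exps V" using GH by (simp add: upset_def)
    show "ideal (mspan A G \<cdot> mspan A H) A"
      using ideal_prod_is_ideal ideal_mspan G H by blast
    show "amon A ` ?GH \<subseteq> mspan A G \<cdot> mspan A H"
    proof
      fix f assume "f \<in> amon A ` ?GH"
      then obtain g h where "g \<in> G" "h \<in> H" "f = amon A (g + h)" by blast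
      then show "f \<in> mspan A G \<cdot> mspan A H"
        using amon_add[of g h] GV ideal_prod.prod[OF amon_in_mspan amon_in_mspan, of g G h H A]
        by (simp add: subset_iff)
    qed
  qed
  ultimately show "mspan A ?GH \<subseteq> mspan A G \<cdot> mspan A H" by simp
qed

lemma presentation_quot:
  assumes "ideal I A" shows "presentation (quot_alg A I)"
proof -
  interpret I: ideal I A by (rule assms)
  interpret Q: cring "A Quot I" by (rule I.quotient_is_cring[OF cring_axioms])
  have "cring (quot_alg A I)" unfolding quot_alg_def by (simp only: cring_extend) (rule Q.cring_axioms)
  then show ?thesis
  proof (rule presentation.intro, unfold_locales)
    show "finite (vars (quot_alg A I))" using finite_vars by (simp add: quot_alg_simps)
    have hom: "(+>) I \<in> ring_hom A (A Quot I)" by (rule I.rcos_ring_hom)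
    show "proj (quot_alg A I) \<in> ring_hom (poly_alg (vars (quot_alg A I))) (quot_alg A I)"
      using ring_hom_closed[OF hom] ring_hom_mult[OF hom] ring_hom_add[OF hom] ring_hom_one[OF hom]
        proj_closed
      by (intro ring_hom_memI) (simp_all add: quot_alg_simps proj_mult proj_add)
    show "carrier (quot_alg A I) = proj (quot_alg A I) ` carrier (poly_alg (vars (quot_alg A I)))"
      using proj_surj by (auto simp: quot_alg_simps FactRing_def A_RCOSETS_def')
  qed
qed

lemma proj_quot_eq_zero_iff:
  assumes "ideal I A" "keys p \<subseteq> exps V"
  shows "proj (quot_alg A I) p = \<zero>\<^bsub>quot_alg A I\<^esub> \<longleftrightarrow> proj A p \<in> I"
  using a_rcos_zero[OF assms(1)] ideal.rcos_const_imp_mem[OF assms(1) proj_closed[OF assms(2)]]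
  by (auto simp: quot_alg_simps FactRing_def)

end

lemma presentation_poly_alg:
  assumes "finite V" shows "presentation (poly_alg V :: ('k::field, 'k mpoly) galg)"
  by (rule presentation.intro[OF cring_poly_alg], unfold_locales) (use assms in \<open>auto intro: ring_hom_memI\<close>)

lemma mspan_poly_alg [simp]: "mspan (poly_alg V) G = {p. keys p \<subseteq> G}"
  by (simp add: mspan_def)

lemma (in presentation) monomial_ideal_iff:
  "monomial_ideal A I \<longleftrightarrow> (\<exists>G. upset V G \<and> I = mspan A G)"
proof -
  interpret P: presentation "poly_alg V :: ('k, 'k mpoly) galg"
    by (rule presentation_poly_alg[OF finite_vars])
  have *: "Idl\<^bsub>poly_alg V\<^esub> (monom_of ` E) = {p :: 'k mpoly. keys p \<subseteq> upclose V E}" if "E \<subseteq> exps V" for E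
    using P.genideal_monomials[of E "monom_of ` E"] that by (auto simp: amon_def)
  show ?thesis
  proof
    assume "monomial_ideal A I"
    then obtain E where E: "E \<subseteq> exps V" "I = proj A ` (Idl\<^bsub>poly_alg V\<^esub> (monom_of ` E))"
      unfolding monomial_ideal_def by blast
    then show "\<exists>G. upset V G \<and> I = mspan A G"
      using upset_upclose *[OF E(1)] by (auto simp: mspan_def)
  next
    assume "\<exists>G. upset V G \<and> I = mspan A G"
    then obtain G where G: "upset V G" "I = mspan A G" by blast
    then have "G \<subseteq> exps V" by (simp add: upset_def)
    then show "monomial_ideal A I"
      unfolding monomial_ideal_def using G *[of G] upclose_upset[OF G(1)] by (auto simp: mspan_def)
  qed
qed

section \<open>Quotients by monomial ideals\<close>

text \<open>
  A quotient of a polynomial ring by a monomial ideal, \<open>N\<close> being the set of the exponents of the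
  monomials outside of that ideal. An element is given by the coefficients of any representing
  polynomial at \<open>N\<close>, which reduces all questions on spans of monomials to sets of exponents.
\<close>

locale monomial_algebra = presentation A for A :: "('k::field, 'a) galg" (structure) +
  fixes N :: "(nat \<Rightarrow>\<^sub>0 nat) set"
  assumes N_subset: "N \<subseteq> exps (vars A)"
    and N_divisor_closed: "divisor_closed N"
    and proj_eq_zero_iff: "keys p \<subseteq> exps (vars A) \<Longrightarrow> proj A p = \<zero> \<longleftrightarrow> keys p \<inter> N = {}"
begin

lemma proj_eq_iff:
  assumes "keys p \<subseteq> exps V" "keys q \<subseteq> exps V"
  shows "proj A p = proj A q \<longleftrightarrow> (\<forall>m\<in>N. lookup p m = lookup q m)"
proof -
  have "proj A p = proj A q \<longleftrightarrow> proj A p \<ominus> proj A q = \<zero>"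
    using assms proj_closed by (auto simp: r_right_minus_eq)
  also have "proj A p \<ominus> proj A q = proj A (p + (- q))"
    using assms by (simp only: proj_add proj_uminus keys_uminus' a_minus_def)
  also have "proj A (p + (- q)) = \<zero> \<longleftrightarrow> keys (p + (- q)) \<inter> N = {}"
    using assms by (intro proj_eq_zero_iff keys_add_subset) auto
  also have "\<dots> \<longleftrightarrow> (\<forall>m\<in>N. lookup p m = lookup q m)"
    by (auto simp: in_keys_iff lookup_minus disjoint_iff)
  finally show ?thesis .
qed

lemma proj_in_mspan_iff:
  assumes "keys p \<subseteq> exps V" "G \<subseteq> exps V"
  shows "proj A p \<in> mspan A G \<longleftrightarrow> keys p \<inter> N \<subseteq> G"
proof
  assume "proj A p \<in> mspan A G"
  then obtain q where q: "proj A p = proj A q" "keys q \<subseteq> G" by (auto simp: mspan_def)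
  then have "\<forall>m\<in>N. lookup p m = lookup q m" using proj_eq_iff assms by blast
  then show "keys p \<inter> N \<subseteq> G" using q(2) by (auto simp: in_keys_iff)
next
  assume *: "keys p \<inter> N \<subseteq> G"
  have "\<forall>m\<in>N. lookup p m = lookup (restr G p) m" using * by (auto simp: in_keys_iff)
  then have "proj A p = proj A (restr G p)" using assms by (subst proj_eq_iff) auto
  then show "proj A p \<in> mspan A G" by (auto simp: mspan_def)
qed

lemma amon_in_mspan_iff: "m \<in> exps V \<Longrightarrow> G \<subseteq> exps V \<Longrightarrow> amon A m \<in> mspan A G \<longleftrightarrow> m \<in> G \<or> m \<notin> N"
  unfolding amon_def monom_of_def by (subst proj_in_mspan_iff) auto

lemma amon_eq_zero_iff: "m \<in> exps V \<Longrightarrow> amon A m = \<zero> \<longleftrightarrow> m \<notin> N"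
  unfolding amon_def monom_of_def by (subst proj_eq_zero_iff) auto

lemma mspan_subset_iff:
  assumes "G \<subseteq> exps V" "H \<subseteq> exps V"
  shows "mspan A G \<subseteq> mspan A H \<longleftrightarrow> G \<inter> N \<subseteq> H"
proof
  assume "mspan A G \<subseteq> mspan A H"
  then have "amon A m \<in> mspan A H" if "m \<in> G" for m using amon_in_mspan[OF that] by blast
  then show "G \<inter> N \<subseteq> H" using amon_in_mspan_iff assms by blast
next
  assume *: "G \<inter> N \<subseteq> H"
  show "mspan A G \<subseteq> mspan A H"
  proof
    fix f assume "f \<in> mspan A G"
    then obtain p where p: "f = proj A p" "keys p \<subseteq> G" by (auto simp: mspan_def)
    then have "keys p \<subseteq> exps V" "keys p \<inter> N \<subseteq> H" using assms * by auto
    then show "f \<in> mspan A H" using p proj_in_mspan_iff[OF _ assms(2)] by simp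
  qed
qed

lemma mspan_eq_iff:
  assumes "G \<subseteq> exps V" "H \<subseteq> exps V"
  shows "mspan A G = mspan A H \<longleftrightarrow> G \<inter> N = H \<inter> N"
  using mspan_subset_iff[OF assms] mspan_subset_iff[OF assms(2,1)] by blast

lemma mspan_Int:
  assumes "G \<subseteq> exps V" "H \<subseteq> exps V"
  shows "mspan A G \<inter> mspan A H = mspan A (G \<inter> H)"
proof
  show "mspan A (G \<inter> H) \<subseteq> mspan A G \<inter> mspan A H" using mspan_mono by blast
  show "mspan A G \<inter> mspan A H \<subseteq> mspan A (G \<inter> H)"
  proof
    fix f assume f: "f \<in> mspan A G \<inter> mspan A H"
    then obtain p where p: "f = proj A p" "keys p \<subseteq> exps V" using assms by (auto simp: mspan_def)
    then show "f \<in> mspan A (G \<inter> H)"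
      using f proj_in_mspan_iff[OF p(2)] assms by (auto simp: inf.coboundedI1)
  qed
qed

lemma carrier_eq_mspan: "carrier A = mspan A (exps V)"
  using proj_surj by (simp add: mspan_def)

lemma monomial_algebra_quot:
  assumes G: "upset V G"
  shows "monomial_algebra (quot_alg A (mspan A G)) (N - G)"
proof (rule monomial_algebra.intro)
  have id: "ideal (mspan A G) A" using G by (rule ideal_mspan)
  have GV: "G \<subseteq> exps V" using G by (simp add: upset_def)
  show "presentation (quot_alg A (mspan A G))" using id by (rule presentation_quot)
  have "divisor_closed (N - G)"
    unfolding divisor_closed_def
  proof (intro allI impI)
    fix u v assume uv: "u + v \<in> N - G"
    then have "v \<in> exps V" using N_subset by auto
    then show "u \<in> N - G"
      using uv G divisor_closedD[OF N_divisor_closed, of u v] unfolding upset_def by blast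
  qed
  then show "monomial_algebra_axioms (quot_alg A (mspan A G)) (N - G)"
    using N_subset proj_in_mspan_iff[OF _ GV] proj_quot_eq_zero_iff[OF id]
    by unfold_locales (auto simp: quot_alg_simps(6))
qed

lemma nz_exps_eq: "nz_exps A t = {m \<in> N. total_deg m = t}"
  using amon_eq_zero_iff N_subset by (auto simp: nz_exps_def)

end

lemma mspan_quot_alg: "mspan (quot_alg A I) H = (\<lambda>f. I +>\<^bsub>A\<^esub> f) ` mspan A H"
  by (auto simp: mspan_def quot_alg_simps)

lemma monomial_algebra_poly_alg:
  assumes "finite V"
  shows "monomial_algebra (poly_alg V :: ('k::field, 'k mpoly) galg) (exps V)"
proof (rule monomial_algebra.intro[OF presentation_poly_alg[OF assms]])
  show "monomial_algebra_axioms (poly_alg V :: ('k, 'k mpoly) galg) (exps V)"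
    by unfold_locales (auto simp: divisor_closed_def Int_absorb2)
qed

text \<open>
  A monomial lies outside of the ideal generated by the \<open>x\<^sub>i^(e i)\<close> iff all its exponents are small.
\<close>

lemma monomial_algebra_trunc_alg:
  assumes V: "finite V" and W: "W \<subseteq> V"
  shows "monomial_algebra (trunc_alg V W e :: ('k::field, 'k mpoly set) galg)
    {m \<in> exps V. \<forall>i\<in>W. enat (lookup m i) < e i}"
proof -
  let ?P = "poly_alg V :: ('k, 'k mpoly) galg"
  interpret P: monomial_algebra ?P "exps V" by (rule monomial_algebra_poly_alg[OF V])
  define E where "E = {single i k | i k. i \<in> W \<and> e i = enat k}"
  have E: "E \<subseteq> exps V" using W by (auto simp: E_def)
  have pow: "X i [^]\<^bsub>?P\<^esub> (k::nat) = monom_of (single i k)" for i k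
    by (induction k) (simp_all add: X_def monom_of_def mult_single single_add[symmetric])
  have "Idl\<^bsub>?P\<^esub> ((\<lambda>i. pow_enat ?P (X i) (e i)) ` W) = mspan ?P (upclose V E)"
  proof (subst P.genideal_monomials[of E])
    show "E \<subseteq> exps (vars ?P)" using E by simp
    show "amon ?P ` E \<subseteq> (\<lambda>i. pow_enat ?P (X i) (e i)) ` W"
    proof
      fix f assume "f \<in> amon ?P ` E"
      then obtain i k where "i \<in> W" "e i = enat k" "f = monom_of (single i k)"
        by (auto simp: E_def amon_def)
      then show "f \<in> (\<lambda>i. pow_enat ?P (X i) (e i)) ` W"
        by (intro image_eqI[of _ _ i]) (simp_all add: pow_enat_def pow)
    qed
    show "(\<lambda>i. pow_enat ?P (X i) (e i)) ` W \<subseteq> insert \<zero>\<^bsub>?P\<^esub> (amon ?P ` E)"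
    proof
      fix f assume "f \<in> (\<lambda>i. pow_enat ?P (X i) (e i)) ` W"
      then obtain i where i: "i \<in> W" "f = pow_enat ?P (X i) (e i)" by blast
      show "f \<in> insert \<zero>\<^bsub>?P\<^esub> (amon ?P ` E)"
      proof (cases "e i")
        case (enat k)
        then have "single i k \<in> E" "f = amon ?P (single i k)" using i by (auto simp: E_def pow_enat_def pow amon_def)
        then show ?thesis by blast
      next
        case infinity
        then show ?thesis using i by (simp add: pow_enat_def)
      qed
    qed
  qed simp
  then have eq: "trunc_alg V W e = quot_alg ?P (mspan ?P (upclose V E))"
    by (simp add: trunc_alg_def Let_def)
  have "{m \<in> exps V. \<forall>i\<in>W. enat (lookup m i) < e i} = exps V - upclose V E"
  proof (intro equalityI subsetI)
    fix m assume m: "m \<in> {m \<in> exps V. \<forall>i\<in>W. enat (lookup m i) < e i}"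
    have "m \<notin> upclose V E"
    proof
      assume "m \<in> upclose V E"
      then obtain i k m' where "m = single i k + m'" "i \<in> W" "e i = enat k" by (auto simp: upclose_def E_def)
      then show False using m by (auto simp: lookup_add)
    qed
    then show "m \<in> exps V - upclose V E" using m by simp
  next
    fix m assume m: "m \<in> exps V - upclose V E"
    have "enat (lookup m i) < e i" if i: "i \<in> W" for i
    proof (rule ccontr)
      assume "\<not> enat (lookup m i) < e i"
      then obtain k where k: "e i = enat k" "k \<le> lookup m i" by (cases "e i") auto
      have "lookup (single i k) j \<le> lookup m j" for j
        using k(2) by (auto simp: lookup_single when_def)
      then obtain r where r: "m = single i k + r" by (rule pointwise_le_imp_add)
      then have "r \<in> exps V" using m by simp
      moreover have "single i k \<in> E" using i k by (auto simp: E_def)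
      ultimately show False using m r by (auto simp: upclose_def)
    qed
    then show "m \<in> {m \<in> exps V. \<forall>i\<in>W. enat (lookup m i) < e i}" using m by simp
  qed
  moreover have "monomial_algebra (quot_alg ?P (mspan ?P (upclose V E))) (exps V - upclose V E)"
    using P.monomial_algebra_quot upset_upclose[OF E] by simp
  ultimately show ?thesis by (simp only: eq)
qed

section \<open>Hilbert functions\<close>

lemma subfield_constants:
  "subfield (range (single 0)) (poly_alg V :: ('k::field, 'k mpoly) galg)"
proof -
  interpret cring "poly_alg V :: ('k, 'k mpoly) galg" by (rule cring_poly_alg)
  let ?P = "poly_alg V :: ('k, 'k mpoly) galg"
  have neg: "\<ominus>\<^bsub>?P\<^esub> (single 0 c) = single 0 (- c)" for c :: 'k
    by (rule sum_zero_eq_neg[symmetric]) (auto simp: single_add[symmetric])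
  have "subring (range (single 0)) ?P"
    by (rule subringI) (auto simp: neg single_add[symmetric] mult_single simp flip: single_one split: if_splits)
  then have "subcring (range (single 0)) ?P" by (rule subcringI')
  moreover have "Units (?P \<lparr>carrier := range (single 0)\<rparr>) = range (single 0) - {\<zero>\<^bsub>?P\<^esub>}"
  proof (intro equalityI subsetI)
    fix x assume "x \<in> Units (?P \<lparr>carrier := range (single 0)\<rparr>)"
    then show "x \<in> range (single 0) - {\<zero>\<^bsub>?P\<^esub>}" by (auto simp: Units_def)
  next
    fix x assume "x \<in> range (single 0) - {\<zero>\<^bsub>?P\<^esub>}"
    then obtain c where c: "x = single 0 c" "x \<noteq> 0" by auto
    then have "c \<noteq> 0" by auto
    note c = c(1) this
    then show "x \<in> Units (?P \<lparr>carrier := range (single 0)\<rparr>)"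
      unfolding Units_def by (auto intro!: exI[of _ "inverse c"] simp: mult_single)
  qed
  ultimately show ?thesis by (rule subfieldI)
qed

context presentation
begin

lemma subfield_base_field:
  assumes "\<one> \<noteq> \<zero>" shows "subfield (base_field A) A"
proof -
  interpret P: presentation "poly_alg V :: ('k, 'k mpoly) galg"
    by (rule presentation_poly_alg[OF finite_vars])
  have hom: "ring_hom_ring (poly_alg V :: ('k, 'k mpoly) galg) A (proj A)"
    by (intro ring_hom_ringI2 P.ring_axioms ring_axioms proj_hom)
  have "base_field A = proj A ` range (single 0)" by (auto simp: base_field_def)
  then show ?thesis using ring_hom_ring.img_is_subfield(2)[OF hom subfield_constants assms] by simp
qed

lemma line_extension_mspan:
  assumes "G \<subseteq> exps V" "m \<in> exps V"
  shows "line_extension (base_field A) (amon A m) (mspan A G) = mspan A (insert m G)"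
proof (intro equalityI subsetI)
  fix f assume "f \<in> line_extension (base_field A) (amon A m) (mspan A G)"
  then obtain c p where f: "f = proj A (single 0 c) \<otimes> amon A m \<oplus> proj A p" "keys p \<subseteq> G"
    by (auto simp: line_extension_mem_iff base_field_def mspan_def)
  then have "f = proj A (single m c + p)"
    using assms proj_single_eq[of m c] proj_add[of "single m c" p] by auto
  moreover have "keys (single m c + p) \<subseteq> insert m G" using f(2) by (intro keys_add_subset) auto
  ultimately show "f \<in> mspan A (insert m G)" by (auto simp: mspan_def)
next
  fix f assume "f \<in> mspan A (insert m G)"
  then obtain p where p: "f = proj A p" "keys p \<subseteq> insert m G" by (auto simp: mspan_def)
  let ?c = "if m \<in> G then 0 else lookup p m"
  have pe: "p = single m ?c + restr G p"
    using p(2) by (intro poly_mapping_eqI) (auto simp: lookup_add lookup_single when_def in_keys_iff)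
  have "f = proj A (single m ?c + restr G p)"
    using p(1) arg_cong[OF pe, of "proj A"] by (rule trans)
  also have "\<dots> = proj A (single 0 ?c) \<otimes> amon A m \<oplus> proj A (restr G p)"
    using assms p(2) proj_single_eq[OF assms(2), of ?c] by (subst proj_add) auto
  finally show "f \<in> line_extension (base_field A) (amon A m) (mspan A G)"
  proof -
    assume "f = proj A (single 0 ?c) \<otimes> amon A m \<oplus> proj A (restr G p)"
    moreover have "proj A (single 0 ?c) \<in> base_field A" unfolding base_field_def by blast
    moreover have "proj A (restr G p) \<in> mspan A G" unfolding mspan_def by (rule imageI) simp
    ultimately show ?thesis unfolding line_extension_mem_iff by blast
  qed
qed

lemma mspan_empty: "mspan A {} = {\<zero>}"
  by (auto simp: mspan_def)

lemma line_extension_absorb: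
  assumes "\<one> \<noteq> \<zero>" "dimension n (base_field A) E" "v \<in> E"
  shows "line_extension (base_field A) v E = E"
proof -
  note K = subfield_base_field[OF assms(1)]
  note props = space_subgroup_props[OF K assms(2)]
  have "\<zero> \<in> base_field A" using subfieldE(1)[OF K] subringE(2) by metis
  moreover have "u = \<zero> \<otimes> v \<oplus> u" if "u \<in> E" for u
  proof -
    have "u \<in> carrier A" "v \<in> carrier A" using props(1) that assms(3) by auto
    then show ?thesis by simp
  qed
  ultimately show ?thesis
    using props assms(3) by (auto simp: line_extension_mem_iff) blast
qed

text \<open>
  In general the monomials in \<open>G\<close> are linearly dependent; each of them raises the dimension by at most
  one.
\<close>

lemma dimension_mspan_le:
  assumes one: "\<one> \<noteq> \<zero>" and "finite G" "G \<subseteq> exps V"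
  obtains n where "n \<le> card G" "dimension n (base_field A) (mspan A G)"
  using assms(2,3)
proof (induction G arbitrary: thesis rule: finite_induct)
  case empty
  show ?case by (rule empty(1)[of 0]) (simp_all add: mspan_empty)
next
  case (insert m G)
  then obtain n where n: "n \<le> card G" "dimension n (base_field A) (mspan A G)" by auto
  have eq: "line_extension (base_field A) (amon A m) (mspan A G) = mspan A (insert m G)"
    using insert.prems by (intro line_extension_mspan) auto
  show ?case
  proof (cases "amon A m \<in> mspan A G")
    case True
    then have "mspan A (insert m G) = mspan A G" using eq line_extension_absorb[OF one n(2)] by simp
    then show ?thesis using insert n by (intro insert.prems(1)[of n]) auto
  next
    case False
    have "dimension (Suc n) (base_field A) (mspan A (insert m G))"
      unfolding eq[symmetric] using False n insert.prems amon_closed by (intro Suc_dim) auto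
    then show ?thesis using insert n by (intro insert.prems(1)[of "Suc n"]) auto
  qed
qed

lemma base_field_closed: "base_field A \<subseteq> carrier A"
  by (auto simp: base_field_def intro!: proj_closed split: if_splits)

lemma dimension_mult_le:
  assumes one: "\<one> \<noteq> \<zero>" and x: "x \<in> carrier A" and "dimension n (base_field A) E"
  shows "\<exists>n'\<le>n. dimension n' (base_field A) ((\<lambda>f. x \<otimes> f) ` E)"
  using assms(3)
proof (induction n "base_field A" E rule: dimension.induct)
  case zero_dim
  then show ?case using x by (intro exI[of _ 0]) simp
next
  case (Suc_dim v E n)
  then obtain n' where n': "n' \<le> n" "dimension n' (base_field A) ((\<lambda>f. x \<otimes> f) ` E)" by blast
  have E: "E \<subseteq> carrier A"
    using space_subgroup_props(1)[OF subfield_base_field[OF one] Suc_dim(3)] .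
  have dist: "x \<otimes> (k \<otimes> v \<oplus> w) = k \<otimes> (x \<otimes> v) \<oplus> x \<otimes> w" if "k \<in> base_field A" "w \<in> E" for k w
  proof -
    have "k \<in> carrier A" "w \<in> carrier A" using that E base_field_closed by auto
    then show ?thesis using x Suc_dim(1) by (simp add: r_distr m_lcomm)
  qed
  have eq: "(\<lambda>f. x \<otimes> f) ` line_extension (base_field A) v E
      = line_extension (base_field A) (x \<otimes> v) ((\<lambda>f. x \<otimes> f) ` E)"
  proof (intro equalityI subsetI)
    fix f assume "f \<in> (\<lambda>f. x \<otimes> f) ` line_extension (base_field A) v E"
    then obtain k w where "k \<in> base_field A" "w \<in> E" "f = x \<otimes> (k \<otimes> v \<oplus> w)"
      by (auto simp: line_extension_mem_iff)
    then show "f \<in> line_extension (base_field A) (x \<otimes> v) ((\<lambda>f. x \<otimes> f) ` E)"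
      unfolding line_extension_mem_iff using dist by blast
  next
    fix f assume "f \<in> line_extension (base_field A) (x \<otimes> v) ((\<lambda>f. x \<otimes> f) ` E)"
    then obtain k w where kw: "k \<in> base_field A" "w \<in> E" "f = k \<otimes> (x \<otimes> v) \<oplus> x \<otimes> w"
      by (auto simp: line_extension_mem_iff)
    then have "k \<otimes> v \<oplus> w \<in> line_extension (base_field A) v E"
      unfolding line_extension_mem_iff by blast
    then show "f \<in> (\<lambda>f. x \<otimes> f) ` line_extension (base_field A) v E"
      using kw(3) dist[OF kw(1,2)] by (intro image_eqI[of _ _ "k \<otimes> v \<oplus> w"]) simp_all
  qed
  show ?case
  proof (cases "x \<otimes> v \<in> (\<lambda>f. x \<otimes> f) ` E")
    case True
    then show ?thesis using eq n' line_extension_absorb[OF one n'(2) True] by (intro exI[of _ n']) simp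
  next
    case False
    then have "dimension (Suc n') (base_field A) ((\<lambda>f. x \<otimes> f) ` line_extension (base_field A) v E)"
      unfolding eq using n' x Suc_dim(1) by (intro dimension.Suc_dim) auto
    then show ?thesis using n' by (intro exI[of _ "Suc n'"]) simp
  qed
qed

lemma mspan_nonzero:
  assumes "G \<subseteq> exps V" shows "mspan A G = mspan A {m \<in> G. amon A m \<noteq> \<zero>}"
proof
  show "mspan A {m \<in> G. amon A m \<noteq> \<zero>} \<subseteq> mspan A G" by (rule mspan_mono) auto
  show "mspan A G \<subseteq> mspan A {m \<in> G. amon A m \<noteq> \<zero>}" (is "_ \<subseteq> mspan A ?G")
  proof (rule mspan_induct[OF assms])
    show z: "\<zero> \<in> mspan A ?G" unfolding mspan_def by (rule image_eqI[of _ _ 0]) auto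
    show "f \<oplus> g \<in> mspan A ?G" if fg: "f \<in> mspan A ?G" "g \<in> mspan A ?G" for f g
    proof -
      obtain p q where pq: "f = proj A p" "keys p \<subseteq> ?G" "g = proj A q" "keys q \<subseteq> ?G"
        using fg by (auto simp: mspan_def)
      then have "keys p \<subseteq> exps V" "keys q \<subseteq> exps V" using assms by auto
      then have "f \<oplus> g = proj A (p + q)" using pq proj_add[of p q] by simp
      moreover have "keys (p + q) \<subseteq> ?G" using pq by (intro keys_add_subset)
      ultimately show ?thesis unfolding mspan_def by blast
    qed
    show "proj A (single m c) \<in> mspan A ?G" if m: "m \<in> G" for m c
    proof (cases "amon A m = \<zero>")
      case True
      then have "proj A (single m c) = \<zero>"
        using m assms proj_single_eq[of m c] proj_closed[of "single 0 c"] by auto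
      then show ?thesis using z by simp
    next
      case False
      then show ?thesis using m unfolding mspan_def by (intro imageI) auto
    qed
  qed
qed

lemma finite_deg: "finite {m \<in> exps V. total_deg m = t}"
  by (rule finite_subset[OF _ finite_exps_deg[OF finite_vars, of t]]) auto

text \<open>
  The image of the base field in the zero ring is not a field, so this case is separate.
\<close>

lemma hilbert_fun_zero_ring:
  assumes "\<one> = \<zero>" shows "hilbert_fun A t = 0"
proof -
  have c: "carrier A = {\<zero>}"
  proof (intro equalityI subsetI)
    fix f assume "f \<in> carrier A"
    then have "f = \<one> \<otimes> f" "\<zero> \<otimes> f = \<zero>" by simp_all
    then show "f \<in> {\<zero>}" using assms by simp
  qed simp
  have "E = {\<zero>} \<and> n = 0" if "dimension n K E" for n K E
    using that by induction (auto simp: c)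
  moreover have "gcomp A t = {\<zero>}"
  proof -
    have "gcomp A t \<subseteq> carrier A" unfolding gcomp_def by (rule mspan_subset_carrier) auto
    moreover have "proj A 0 \<in> gcomp A t" unfolding gcomp_def mspan_def by (rule imageI) simp
    ultimately show ?thesis using c by auto
  qed
  ultimately show ?thesis unfolding hilbert_fun_def dim_def by (auto intro!: the_equality)
qed

lemma hilbert_fun_eqI:
  assumes "\<one> \<noteq> \<zero>" "dimension n (base_field A) (gcomp A t)"
  shows "hilbert_fun A t = n"
  using dimI[OF subfield_base_field[OF assms(1)] assms(2)] by (simp add: hilbert_fun_def over_def)

lemma hilbert_fun_le_card: "hilbert_fun A t \<le> card {m \<in> exps V. total_deg m = t \<and> amon A m \<noteq> \<zero>}"
proof (cases "\<one> = \<zero>")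
  case False
  let ?G = "{m \<in> exps V. total_deg m = t \<and> amon A m \<noteq> \<zero>}"
  have "gcomp A t = mspan A ?G"
    unfolding gcomp_def by (subst mspan_nonzero) (auto intro!: arg_cong[of _ _ "mspan A"])
  moreover obtain n where "n \<le> card ?G" "dimension n (base_field A) (mspan A ?G)"
    by (rule dimension_mspan_le[OF False, of ?G]) (auto intro: finite_subset[OF _ finite_deg])
  ultimately show ?thesis using hilbert_fun_eqI[OF False, of n t] by simp
qed (simp add: hilbert_fun_zero_ring)

text \<open>
  If all nonzero monomials of degree \<open>t + 1\<close> are divisible by \<open>x\<^sub>z\<close>, then multiplication by \<open>x\<^sub>z\<close> maps
  the component of degree \<open>t\<close> onto that of degree \<open>t + 1\<close>.
\<close>

lemma hilbert_fun_Suc_le: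
  assumes z: "z \<in> V"
    and div: "\<And>m. m \<in> exps V \<Longrightarrow> total_deg m = Suc t \<Longrightarrow> amon A m \<noteq> \<zero> \<Longrightarrow> z \<in> keys m"
  shows "hilbert_fun A (Suc t) \<le> hilbert_fun A t"
proof (cases "\<one> = \<zero>")
  case False
  let ?x = "amon A (unitv z)"
  have x: "?x \<in> carrier A" using z by (intro amon_closed) simp
  have gc: "gcomp A t \<subseteq> carrier A" for t unfolding gcomp_def by (rule mspan_subset_carrier) auto
  have xp: "?x \<otimes> proj A p = proj A (monom_of (unitv z) * p)" if "keys p \<subseteq> exps V" for p
    using z that unfolding amon_def monom_of_def by (subst proj_mult) auto
  obtain n where n: "dimension n (base_field A) (gcomp A t)"
    using dimension_mspan_le[OF False finite_deg[of t]] unfolding gcomp_def by blast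
  have zero: "\<zero> \<in> gcomp A t" and add: "\<And>f g. f \<in> gcomp A t \<Longrightarrow> g \<in> gcomp A t \<Longrightarrow> f \<oplus> g \<in> gcomp A t"
    using space_subgroup_props[OF subfield_base_field[OF False] n] by auto
  have "gcomp A (Suc t) = (\<lambda>f. ?x \<otimes> f) ` gcomp A t"
  proof
    show "gcomp A (Suc t) \<subseteq> (\<lambda>f. ?x \<otimes> f) ` gcomp A t"
      unfolding gcomp_def[of A "Suc t"]
    proof (subst mspan_nonzero, blast, rule mspan_induct)
      show "\<zero> \<in> (\<lambda>f. ?x \<otimes> f) ` gcomp A t" using zero x by (intro image_eqI[of _ _ \<zero>]) auto
      fix f g assume "f \<in> (\<lambda>f. ?x \<otimes> f) ` gcomp A t" "g \<in> (\<lambda>f. ?x \<otimes> f) ` gcomp A t"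
      then obtain f' g' where fg: "f = ?x \<otimes> f'" "g = ?x \<otimes> g'" "f' \<in> gcomp A t" "g' \<in> gcomp A t" by blast
      then have "f \<oplus> g = ?x \<otimes> (f' \<oplus> g')" using x gc[of t] by (simp add: r_distr subset_iff)
      then show "f \<oplus> g \<in> (\<lambda>f. ?x \<otimes> f) ` gcomp A t" using add fg by blast
    next
      fix m c assume m: "m \<in> {m \<in> {m \<in> exps V. total_deg m = Suc t}. amon A m \<noteq> \<zero>}"
      then obtain m' where m': "m = m' + unitv z" using div exponent_split_unitv by blast
      then have "m' \<in> exps V" "total_deg m' = t" using m by auto
      moreover have "proj A (single m c) = ?x \<otimes> proj A (single m' c)"
        using m m' xp[of "single m' c"] by (simp add: monom_of_def mult_single add.commute)
      ultimately show "proj A (single m c) \<in> (\<lambda>f. ?x \<otimes> f) ` gcomp A t"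
        unfolding gcomp_def mspan_def by auto
    qed auto
    show "(\<lambda>f. ?x \<otimes> f) ` gcomp A t \<subseteq> gcomp A (Suc t)"
    proof
      fix f assume "f \<in> (\<lambda>f. ?x \<otimes> f) ` gcomp A t"
      then obtain p where p: "f = ?x \<otimes> proj A p" "keys p \<subseteq> {m \<in> exps V. total_deg m = t}"
        by (auto simp: gcomp_def mspan_def)
      then have "f = proj A (monom_of (unitv z) * p)" using xp[of p] by auto
      moreover have "keys (monom_of (unitv z) * p :: 'k mpoly) \<subseteq> {m \<in> exps V. total_deg m = Suc t}"
        using keys_mult[of "monom_of (unitv z)" p] p(2) z by (fastforce simp: monom_of_def)
      ultimately show "f \<in> gcomp A (Suc t)" unfolding gcomp_def mspan_def by blast
    qed
  qed
  then obtain n' where "n' \<le> n" "dimension n' (base_field A) (gcomp A (Suc t))"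
    using dimension_mult_le[OF False x n] by auto
  then show ?thesis using hilbert_fun_eqI[OF False] n by metis
qed (simp add: hilbert_fun_zero_ring)

end

lemma (in monomial_algebra) hilbert_fun_eq_card: "hilbert_fun A t = card {m \<in> N. total_deg m = t}"
proof (cases "\<one> = \<zero>")
  case True
  have "N = {}"
  proof (rule ccontr)
    assume "N \<noteq> {}"
    then obtain m where "m \<in> N" by blast
    then have "0 \<in> N" using divisor_closedD[OF N_divisor_closed, of 0 m] by simp
    then have "amon A 0 \<noteq> \<zero>" using amon_eq_zero_iff by simp
    then show False using True by (simp add: amon_def monom_of_def)
  qed
  then show ?thesis using True hilbert_fun_zero_ring by simp
next
  case False
  have "finite G \<Longrightarrow> G \<subseteq> N \<Longrightarrow> dimension (card G) (base_field A) (mspan A G)" for G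
  proof (induction G rule: finite_induct)
    case empty
    then show ?case by (simp add: mspan_empty)
  next
    case (insert m G)
    have sub: "G \<subseteq> exps V" "m \<in> exps V" using insert N_subset by auto
    have "amon A m \<notin> mspan A G" using sub insert by (subst amon_in_mspan_iff) auto
    then have "dimension (Suc (card G)) (base_field A) (line_extension (base_field A) (amon A m) (mspan A G))"
      using insert sub amon_closed by (intro Suc_dim) auto
    then show ?case using insert line_extension_mspan[OF sub] by simp
  qed
  moreover have "gcomp A t = mspan A {m \<in> N. total_deg m = t}"
    unfolding gcomp_def using N_subset by (subst mspan_eq_iff) auto
  moreover have "finite {m \<in> N. total_deg m = t}"
    by (rule finite_subset[OF _ finite_deg[of t]]) (use N_subset in auto)
  ultimately show ?thesis by (intro hilbert_fun_eqI[OF False]) auto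
qed

text \<open>
  A polynomial that is eventually equal to a constant on the natural numbers is that constant.
\<close>

lemma multiplicity_ofI:
  assumes "\<forall>\<^sub>F t in sequentially. hilbert_fun (quot_alg A I) t = c"
  shows "multiplicity_of A I = c"
proof -
  have "hilbert_poly (quot_alg A I) = [:of_nat c:]"
    unfolding hilbert_poly_def
  proof (rule the_equality)
    show "\<forall>\<^sub>F t in sequentially. poly [:of_nat c:] (of_nat t) = (of_nat (hilbert_fun (quot_alg A I) t) :: rat)"
      using assms by eventually_elim simp
    fix p :: "rat poly"
    assume "\<forall>\<^sub>F t in sequentially. poly p (of_nat t) = of_nat (hilbert_fun (quot_alg A I) t)"
    with assms have "\<forall>\<^sub>F t in sequentially. poly (p - [:of_nat c:]) (of_nat t) = 0"
      by eventually_elim simp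
    then obtain T where T: "\<And>t. t \<ge> T \<Longrightarrow> poly (p - [:of_nat c:]) (of_nat t) = 0"
      by (auto simp: eventually_sequentially)
    have "infinite (of_nat ` {T..} :: rat set)"
      by (subst finite_image_iff) (auto simp: infinite_Ici intro: inj_onI)
    moreover have "of_nat ` {T..} \<subseteq> {x. poly (p - [:of_nat c:]) x = 0}" using T by auto
    ultimately have "infinite {x. poly (p - [:of_nat c:]) x = 0}" using finite_subset by blast
    then have "p - [:of_nat c:] = 0" using poly_roots_finite by blast
    then show "p = [:of_nat c:]" by simp
  qed
  then show ?thesis unfolding multiplicity_of_def by (auto intro!: the_equality)
qed

section \<open>Krull dimension\<close>

context monomial_algebra
begin

text \<open>
  The quotient by the variables outside of \<open>T\<close> is a polynomial ring in the variables \<open>T\<close>, because no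
  monomial in these variables vanishes. Instead of the quotient, the proof uses the part of a
  polynomial that involves only the variables \<open>T\<close>; this part is multiplicative.
\<close>

lemma primeideal_coordinates:
  assumes T: "T \<subseteq> V" and TN: "exps T \<subseteq> N"
  shows "primeideal (mspan A (exps V - exps T)) A"
proof (rule primeidealI)
  let ?G = "exps V - exps T"
  have dc: "divisor_closed (exps T)" by (simp add: divisor_closed_def)
  then have up: "upset V ?G" by (rule upset_diff)
  have sub: "exps T \<subseteq> exps V" using T by (auto simp: exps_def)
  show "ideal (mspan A ?G) A" using up by (rule ideal_mspan)
  show "cring A" by (rule is_cring)
  have "0 \<in> N" using TN by auto
  then have "amon A 0 \<notin> mspan A ?G" by (subst amon_in_mspan_iff) auto
  moreover have "amon A 0 \<in> carrier A" by (rule amon_closed) simp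
  ultimately show "carrier A \<noteq> mspan A ?G" by blast
  fix a b assume ab: "a \<in> carrier A" "b \<in> carrier A" "a \<otimes> b \<in> mspan A ?G"
  obtain p where p: "a = proj A p" "keys p \<subseteq> exps V" using ab(1) by (rule carrierE)
  obtain q where q: "b = proj A q" "keys q \<subseteq> exps V" using ab(2) by (rule carrierE)
  have "a \<otimes> b = proj A (p * q)" using p q by (simp add: proj_mult)
  then have pq: "keys (p * q) \<inter> N \<subseteq> ?G"
    using ab(3) proj_in_mspan_iff[OF keys_mult_exps[OF p(2) q(2)], of ?G] by auto
  define p1 q1 where "p1 = restr (exps T) p" and "q1 = restr (exps T) q"
  have "keys (p1 * q1) = {}"
  proof (rule ccontr)
    assume "keys (p1 * q1) \<noteq> {}"
    then obtain m where m: "m \<in> keys (p1 * q1)" by blast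
    have mT: "m \<in> exps T" using m keys_mult_exps[of p1 T q1] by (auto simp: p1_def q1_def)
    have "keys (p - p1) \<subseteq> ?G" "keys (q - q1) \<subseteq> ?G"
      using p(2) q(2) by (auto simp: p1_def q1_def in_keys_iff lookup_minus split: if_splits)
    moreover have "keys p1 \<subseteq> exps V" using sub by (auto simp: p1_def)
    ultimately have "keys ((p - p1) * q + (q - q1) * p1) \<subseteq> ?G"
      using keys_mult_upset[OF up] q(2) by (intro keys_add_subset) blast+
    then have "lookup ((p - p1) * q + (q - q1) * p1) m = 0" using mT by (auto simp: in_keys_iff)
    moreover have "p * q = p1 * q1 + ((p - p1) * q + (q - q1) * p1)" by (simp add: algebra_simps)
    ultimately have "lookup (p * q) m = lookup (p1 * q1) m" by (simp add: lookup_add)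
    then have "m \<in> keys (p * q)" using m by (simp add: in_keys_iff)
    then show False using pq mT TN by auto
  qed
  then have "p1 = 0 \<or> q1 = 0" by simp
  then have "keys p \<inter> exps T = {} \<or> keys q \<inter> exps T = {}"
    unfolding p1_def q1_def by (metis keys_restr keys_zero)
  then show "a \<in> mspan A ?G \<or> b \<in> mspan A ?G"
    using p q by (auto simp: mspan_def)
qed

lemma krull_dim_ge_coordinates:
  assumes T0: "T 0 \<subseteq> V" "exps (T 0) \<subseteq> N" and chain: "\<And>i. i < k \<Longrightarrow> T (Suc i) \<subset> T i"
  shows "enat k \<le> krull_dim A"
proof -
  let ?P = "\<lambda>i. mspan A (exps V - exps (T i))"
  have T: "T i \<subseteq> T 0" if "i \<le> k" for i
    using that
  proof (induction i)
    case (Suc i)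
    then show ?case using chain[of i] by force
  qed simp
  have Tsub: "exps (T i) \<subseteq> exps (T 0)" if "i \<le> k" for i using T[OF that] by (auto simp: exps_def)
  have "primeideal (?P i) A" if "i \<le> k" for i
    using T[OF that] Tsub[OF that] T0 by (intro primeideal_coordinates) auto
  moreover have "?P i \<subset> ?P (Suc i)" if i: "i < k" for i
  proof -
    have "exps (T (Suc i)) \<subseteq> exps (T i)" using chain[OF i] by (auto simp: exps_def)
    then have "?P i \<subseteq> ?P (Suc i)" by (intro mspan_mono) auto
    obtain x where x: "x \<in> T i" "x \<notin> T (Suc i)" using chain[OF i] by blast
    have "unitv x \<in> exps (T i)" "unitv x \<notin> exps (T (Suc i))" using x by auto
    moreover from this have "unitv x \<in> N" using Tsub[OF less_imp_le[OF i]] T0(2) by blast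
    moreover from this have "unitv x \<in> exps V" using N_subset by auto
    moreover have "?P (Suc i) \<subseteq> ?P i \<longleftrightarrow> (exps V - exps (T (Suc i))) \<inter> N \<subseteq> exps V - exps (T i)"
      by (rule mspan_subset_iff) auto
    ultimately have "\<not> ?P (Suc i) \<subseteq> ?P i" by blast
    with \<open>?P i \<subseteq> ?P (Suc i)\<close> show ?thesis by blast
  qed
  ultimately have "(\<forall>i\<le>k. primeideal (?P i) A) \<and> (\<forall>i<k. ?P i \<subset> ?P (Suc i))" by simp
  then have "\<exists>P. (\<forall>i\<le>k. primeideal (P i) A) \<and> (\<forall>i<k. P i \<subset> P (Suc i))" by (rule exI[of _ ?P])
  then show ?thesis unfolding krull_dim_def by (intro Sup_upper CollectI exI[of _ k] conjI refl)
qed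

end

text \<open>
  The embedding of the univariate polynomials, a Euclidean ring, as the polynomials in \<open>x\<^sub>z\<close>.
\<close>

definition univariate :: "nat \<Rightarrow> 'k::field poly \<Rightarrow> 'k mpoly" where
  "univariate z f = poly (map_poly (single 0) f) (X z)"

lemma univariate_0 [simp]: "univariate z 0 = 0"
  by (simp add: univariate_def)

lemma univariate_pCons [simp]: "univariate z (pCons c f) = single 0 c + X z * univariate z f"
  by (simp add: univariate_def map_poly_pCons)

lemma univariate_add: "univariate z (f + g) = univariate z f + univariate z g"
  by (induction f g rule: poly_induct2) (simp_all add: algebra_simps single_add)

lemma univariate_smult: "univariate z (smult c f) = single 0 c * univariate z f"
  by (induction f) (simp_all add: algebra_simps mult_single)

lemma univariate_mult: "univariate z (f * g) = univariate z f * univariate z g"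
  by (induction f) (simp_all add: mult_pCons_left univariate_add univariate_smult algebra_simps)

lemma univariate_monom: "univariate z (monom c j) = single (single z j) c"
  by (induction j)
    (simp_all add: monom_0 monom_Suc X_def monom_of_def mult_single single_add[symmetric])

lemma univariate_sum: "univariate z (\<Sum>i\<in>S. f i) = (\<Sum>i\<in>S. univariate z (f i))"
  by (induction S rule: infinite_finite_induct) (simp_all add: univariate_add)

lemma keys_univariate: "z \<in> T \<Longrightarrow> keys (univariate z f) \<subseteq> exps T"
proof (induction f)
  case (pCons c f)
  have "keys (X z :: 'a mpoly) \<subseteq> exps T" using pCons.prems by (simp add: X_def monom_of_def)
  then have "keys (X z * univariate z f) \<subseteq> exps T" using pCons by (intro keys_mult_exps) auto
  then show ?case unfolding univariate_pCons by (intro keys_add_subset) auto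
qed simp

lemma univariate_surj:
  assumes "keys q \<subseteq> exps {z}" obtains f where "q = univariate z f"
proof
  have "single (single z (lookup m z)) c = single m c" if "m \<in> keys q" for m and c :: 'a
  proof -
    have "m = single z (lookup m z)"
      using that assms by (intro poly_mapping_eqI) (auto simp: exps_iff lookup_single when_def)
    then show ?thesis by simp
  qed
  then show "q = univariate z (\<Sum>m\<in>keys q. monom (lookup q m) (lookup m z))"
    by (subst poly_sum_monomials) (simp add: univariate_sum univariate_monom)
qed

text \<open>
  All variables except \<open>x\<^sub>z\<close> are nilpotent and hence lie in all prime ideals, so a prime ideal is determined by
  its preimage in \<open>\<bbbk>[x\<^sub>z]\<close>. In that principal ideal domain nonzero prime ideals are maximal.
\<close>

lemma (in presentation) krull_dim_le_1:
  assumes z: "z \<in> V" and nil: "\<And>i. i \<in> V - {z} \<Longrightarrow> \<exists>j. amon A (single i j) = \<zero>"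
  shows "krull_dim A \<le> 1"
proof -
  have no_chain: False
    if P0: "primeideal P0 A" and P1: "primeideal P1 A" and P2: "primeideal P2 A"
      and P01: "P0 \<subset> P1" and P12: "P1 \<subset> P2" for P0 P1 P2
  proof -
    have var: "amon A (unitv i) \<in> P" if P: "primeideal P A" and i: "i \<in> V - {z}" for P i
    proof -
      interpret P: primeideal P A by (rule P)
      have "amon A (single i j) \<in> P \<Longrightarrow> amon A (unitv i) \<in> P" for j
      proof (induction j)
        case 0
        then have "\<one> \<in> P" by (simp add: amon_def monom_of_def)
        then show ?case using P.one_imp_carrier P.I_notcarr by simp
      next
        case (Suc j)
        have "single i (Suc j) = single i j + unitv i" by (simp add: single_add[symmetric])
        then have "amon A (single i (Suc j)) = amon A (single i j) \<otimes> amon A (unitv i)"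
          using i by (simp add: amon_add)
        then show ?case using Suc i P.I_prime[of "amon A (single i j)" "amon A (unitv i)"] amon_closed by auto
      qed
      moreover obtain j where "amon A (single i j) = \<zero>" using nil[OF i] by blast
      ultimately show ?thesis by (metis P.zero_closed)
    qed
    define E where "E = unitv ` (V - {z})"
    have E: "E \<subseteq> exps V" by (auto simp: E_def)
    have ups: "exps V - exps {z} \<subseteq> upclose V E"
    proof
      fix m assume m: "m \<in> exps V - exps {z}"
      then obtain i where i: "i \<in> keys m" "i \<noteq> z" by (auto simp: exps_def)
      then obtain v where v: "m = v + unitv i" using exponent_split_unitv by blast
      have "unitv i \<in> E" using i m by (auto simp: exps_def E_def)
      moreover have "m = unitv i + v" "v \<in> exps V" using v m by (auto simp: add.commute)
      ultimately show "m \<in> upclose V E" unfolding upclose_def by blast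
    qed
    have rep: "\<exists>f b. a = proj A (univariate z f) \<oplus> b \<and> b \<in> carrier A \<and> (\<forall>P. primeideal P A \<longrightarrow> b \<in> P)"
      if a: "a \<in> carrier A" for a
    proof -
      obtain p where p: "a = proj A p" "keys p \<subseteq> exps V" using a by (rule carrierE)
      obtain f where f: "restr (exps {z}) p = univariate z f"
        using univariate_surj[of "restr (exps {z}) p" z] by auto
      let ?r = "restr (exps V - exps {z}) p"
      have "p = univariate z f + ?r"
        unfolding f[symmetric] using p(2) by (intro poly_mapping_eqI) (auto simp: lookup_add in_keys_iff)
      then have "a = proj A (univariate z f + ?r)" using p(1) by (rule trans[OF _ arg_cong, rotated])
      also have "\<dots> = proj A (univariate z f) \<oplus> proj A ?r"
        using keys_univariate[OF z] by (intro proj_add) auto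
      finally have "a = proj A (univariate z f) \<oplus> proj A ?r" .
      moreover have "proj A ?r \<in> P" if P: "primeideal P A" for P
      proof -
        have "mspan A (upclose V E) \<subseteq> P"
          using var[OF P] E P by (intro mspan_upclose_subset) (auto simp: E_def primeideal.axioms(1))
        moreover have "proj A ?r \<in> mspan A (upclose V E)"
          unfolding mspan_def by (rule imageI) (use ups in auto)
        ultimately show ?thesis by blast
      qed
      moreover have "proj A ?r \<in> carrier A" by (rule proj_closed) auto
      ultimately show ?thesis by blast
    qed
    define Q where "Q P = {f. proj A (univariate z f) \<in> P}" for P
    have Q0: "0 \<in> Q P" and Qadd: "f \<in> Q P \<Longrightarrow> g \<in> Q P \<Longrightarrow> f + g \<in> Q P"
      and Qmult: "f \<in> Q P \<Longrightarrow> h * f \<in> Q P"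
      and Qprime: "h * h' \<in> Q P \<Longrightarrow> h \<in> Q P \<or> h' \<in> Q P" and Q1: "1 \<notin> Q P"
      if P: "primeideal P A" for P f g h h'
    proof -
      interpret P: primeideal P A by (rule P)
      note ku = keys_univariate[OF z]
      note uc = proj_closed[OF ku]
      show "0 \<in> Q P" by (simp add: Q_def)
      show "f + g \<in> Q P" if "f \<in> Q P" "g \<in> Q P"
        using that by (simp add: Q_def univariate_add proj_add ku)
      show "h * f \<in> Q P" if "f \<in> Q P"
        using that uc P.I_l_closed by (simp add: Q_def univariate_mult proj_mult ku)
      show "h \<in> Q P \<or> h' \<in> Q P" if "h * h' \<in> Q P"
        using that uc P.I_prime by (simp add: Q_def univariate_mult proj_mult ku)
      show "1 \<notin> Q P"
      proof
        assume "1 \<in> Q P"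
        then have "\<one> \<in> P" by (simp add: Q_def one_pCons)
        then show False using P.one_imp_carrier P.I_notcarr by simp
      qed
    qed
    have Qstrict: "\<exists>f. f \<in> Q P' \<and> f \<notin> Q P"
      if P: "primeideal P A" and P': "primeideal P' A" and less: "P \<subset> P'" for P P'
    proof -
      interpret P: primeideal P A by (rule P)
      interpret P': primeideal P' A by (rule P')
      obtain a where a: "a \<in> P'" "a \<notin> P" using less by blast
      then have "a \<in> carrier A" using P'.Icarr by blast
      then obtain f b where fb: "a = proj A (univariate z f) \<oplus> b" "b \<in> carrier A" "b \<in> P" "b \<in> P'"
        using rep P P' by blast
      have u: "proj A (univariate z f) \<in> carrier A" by (rule proj_closed[OF keys_univariate[OF z]])
      have "proj A (univariate z f) = a \<oplus> \<ominus> b" using fb u by (simp add: a_assoc r_neg)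
      then have "proj A (univariate z f) \<in> P'" using a fb(4) by simp
      moreover have "proj A (univariate z f) \<notin> P" using a fb by auto
      ultimately show ?thesis by (auto simp: Q_def)
    qed
    have gen: "\<exists>f. f \<in> Q P \<and> f \<noteq> 0 \<and> (\<forall>h\<in>Q P. f dvd h) \<and> (\<forall>h\<in>Q P. h \<noteq> 0 \<longrightarrow> degree f \<le> degree h)"
      if P: "primeideal P A" and h0: "h0 \<in> Q P" "h0 \<noteq> 0" for P h0
    proof -
      obtain f where f: "f \<in> Q P" "f \<noteq> 0" "\<And>h. h \<in> Q P \<Longrightarrow> h \<noteq> 0 \<Longrightarrow> degree f \<le> degree h"
        using ex_has_least_nat[of "\<lambda>h. h \<in> Q P \<and> h \<noteq> 0" h0 degree] h0 by blast
      have "f dvd h" if h: "h \<in> Q P" for h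
      proof (rule ccontr)
        assume "\<not> f dvd h"
        then have nz: "h mod f \<noteq> 0" by (simp add: dvd_eq_mod_eq_0)
        have "h mod f = h + (- (h div f)) * f" by (simp add: minus_mult_div_eq_mod[symmetric] algebra_simps)
        then have "h mod f \<in> Q P" using Qadd[OF P h Qmult[OF P f(1)]] by metis
        then have "degree f \<le> degree (h mod f)" using f(3) nz by blast
        then show False using degree_mod_less'[OF f(2) nz] by simp
      qed
      then show ?thesis using f by blast
    qed
    \<comment> \<open>The generator f of Q P1 is divisible by the generator g of Q P2, and it is prime.\<close>
    obtain h1 where h1: "h1 \<in> Q P1" "h1 \<notin> Q P0" using Qstrict[OF P0 P1 P01] by blast
    then have "h1 \<noteq> 0" using Q0[OF P0] by auto
    obtain f where f: "f \<in> Q P1" "f \<noteq> 0" "\<And>h. h \<in> Q P1 \<Longrightarrow> h \<noteq> 0 \<Longrightarrow> degree f \<le> degree h"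
      using gen[OF P1 h1(1) \<open>h1 \<noteq> 0\<close>] by blast
    obtain h2 where h2: "h2 \<in> Q P2" "h2 \<notin> Q P1" using Qstrict[OF P1 P2 P12] by blast
    then have "h2 \<noteq> 0" using Q0[OF P1] by auto
    obtain g where g: "g \<in> Q P2" "g \<noteq> 0" "\<And>h. h \<in> Q P2 \<Longrightarrow> g dvd h"
      using gen[OF P2 h2(1) \<open>h2 \<noteq> 0\<close>] by blast
    have "f \<in> Q P2" using f(1) P12 by (auto simp: Q_def)
    then obtain q where q: "f = q * g" using g(3) by (metis dvd_def mult.commute)
    have "g \<notin> Q P1" using g(3)[OF h2(1)] h2(2) Qmult[OF P1] by (metis dvd_def mult.commute)
    then have "q \<in> Q P1" using Qprime[OF P1] f(1) q by blast
    moreover have "q \<noteq> 0" using q f(2) by auto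
    ultimately have "degree f \<le> degree q" using f(3) by blast
    then have "degree g = 0" using q f(2) \<open>q \<noteq> 0\<close> g(2) by (simp add: degree_mult_eq)
    then have "g dvd 1" using g(2) by (simp add: is_unit_iff_degree)
    then show False using Qmult[OF P2 g(1)] Q1[OF P2] by (metis dvd_def mult.commute)
  qed
  show ?thesis unfolding krull_dim_def
  proof (rule Sup_least)
    fix x assume "x \<in> {enat k | k. \<exists>P. (\<forall>i\<le>k. primeideal (P i) A) \<and> (\<forall>i<k. P i \<subset> P (Suc i))}"
    then obtain k P where x: "x = enat k" and P: "\<forall>i\<le>k. primeideal (P i) A" "\<forall>i<k. P i \<subset> P (Suc i)" by blast
    have "\<not> 2 \<le> k"
    proof
      assume k: "2 \<le> k"
      have "primeideal (P 0) A" "primeideal (P (Suc 0)) A" "primeideal (P (Suc (Suc 0))) A"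
        "P 0 \<subset> P (Suc 0)" "P (Suc 0) \<subset> P (Suc (Suc 0))"
        using P k by (auto simp del: One_nat_def)
      then show False by (rule no_chain)
    qed
    then show "x \<le> 1" using x by (simp add: one_enat_def)
  qed
qed

section \<open>Cones over finite order ideals\<close>

definition cyl :: "nat \<Rightarrow> (nat \<Rightarrow>\<^sub>0 nat) set \<Rightarrow> (nat \<Rightarrow>\<^sub>0 nat) set" where
  "cyl z D = {u + single z j | u j. u \<in> D}"

lemma mult_single_eq_sum:
  fixes p :: "'k::field mpoly"
  shows "p * single k c = (\<Sum>m\<in>keys p. single (m + k) (lookup p m * c))"
  using arg_cong[OF poly_sum_monomials[of p], of "\<lambda>q. q * single k c"]
  by (simp add: sum_distrib_right mult_single)

lemma lookup_mult_single:
  fixes p :: "'k::field mpoly"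
  shows "lookup (p * single k c) (m + k) = lookup p m * c"
proof -
  have "lookup (p * single k c) (m + k) = (\<Sum>m'\<in>keys p. if m = m' then lookup p m' * c else 0)"
    unfolding mult_single_eq_sum by (simp add: lookup_sum lookup_single when_def eq_commute)
  also have "\<dots> = lookup p m * c" by (simp add: in_keys_iff)
  finally show ?thesis .
qed

lemma exps_lookup_zero: "u \<in> exps W \<Longrightarrow> z \<notin> W \<Longrightarrow> lookup u z = 0"
  by (simp add: exps_iff)

lemma add_single_in_cyl_iff:
  assumes "D \<subseteq> exps W" "z \<notin> W" "lookup v z = 0"
  shows "v + single z j \<in> cyl z D \<longleftrightarrow> v \<in> D"
proof
  assume "v + single z j \<in> cyl z D"
  then obtain u i where u: "v + single z j = u + single z i" "u \<in> D" by (auto simp: cyl_def)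
  have "lookup u z = 0" using u(2) assms by (auto intro: exps_lookup_zero)
  then have "j = i" using arg_cong[OF u(1), of "\<lambda>m. lookup m z"] assms(3) by (simp add: lookup_add)
  then show "v \<in> D" using u by simp
qed (auto simp: cyl_def)

lemma in_cyl_iff:
  assumes "D \<subseteq> exps W" "z \<notin> W" "lookup v z = 0"
  shows "v \<in> cyl z D \<longleftrightarrow> v \<in> D"
  using add_single_in_cyl_iff[OF assms, of 0] by simp

lemma exps_insert_split:
  assumes "m \<in> exps (insert z W)" "z \<notin> W"
  obtains v j where "m = v + single z j" "v \<in> exps W" "lookup v z = 0"
proof -
  obtain v where v: "m = v + single z (lookup m z)" "lookup v z = 0" by (rule exponent_split_at)
  have "v \<in> exps (insert z W)" using assms(1) v(1) by (metis exps_add)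
  then have "v \<in> exps W" using v(2) by (auto simp: exps_iff) metis
  then show ?thesis using that v by blast
qed

lemma cyl_subset_exps: "D \<subseteq> exps W \<Longrightarrow> cyl z D \<subseteq> exps (insert z W)"
  by (auto simp: cyl_def exps_iff lookup_add lookup_single when_def subset_iff)

lemma cyl_mono: "D \<subseteq> D' \<Longrightarrow> cyl z D \<subseteq> cyl z D'"
  by (auto simp: cyl_def)

lemma cyl_subset_iff:
  assumes "D \<subseteq> exps W" "D' \<subseteq> exps W" "z \<notin> W"
  shows "cyl z D \<subseteq> cyl z D' \<longleftrightarrow> D \<subseteq> D'"
proof
  assume *: "cyl z D \<subseteq> cyl z D'"
  show "D \<subseteq> D'"
  proof
    fix v assume "v \<in> D"
    moreover from this have "lookup v z = 0" using assms by (auto intro: exps_lookup_zero)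
    ultimately show "v \<in> D'" using * in_cyl_iff assms by blast
  qed
qed (rule cyl_mono)

lemma divisor_closed_cyl:
  assumes "D \<subseteq> exps W" "z \<notin> W" "divisor_closed D"
  shows "divisor_closed (cyl z D)"
  unfolding divisor_closed_def
proof (intro allI impI)
  fix u v assume uv: "u + v \<in> cyl z D"
  obtain u' where u': "u = u' + single z (lookup u z)" "lookup u' z = 0" by (rule exponent_split_at)
  obtain v' where v': "v = v' + single z (lookup v z)" "lookup v' z = 0" by (rule exponent_split_at)
  have "u + v = (u' + v') + single z (lookup u z + lookup v z)"
    using u'(1) v'(1) by (metis (no_types, lifting) add.assoc add.left_commute single_add)
  then have "u' + v' \<in> D"
    using uv u'(2) v'(2) add_single_in_cyl_iff[OF assms(1,2), of "u' + v'"] by (simp add: lookup_add)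
  then have "u' \<in> D" by (rule divisor_closedD[OF assms(3)])
  then show "u \<in> cyl z D" using u'(1) unfolding cyl_def by blast
qed

text \<open>
  Each \<open>u\<close> of degree at most \<open>t\<close> is completed by exactly one power of \<open>x\<^sub>z\<close> to a monomial of degree \<open>t\<close>.
\<close>

lemma card_cyl_deg:
  assumes "D \<subseteq> exps W" "z \<notin> W"
  shows "card {m \<in> cyl z D. total_deg m = t} = card {u \<in> D. total_deg u \<le> t}"
proof -
  have "bij_betw (\<lambda>u. u + single z (t - total_deg u)) {u \<in> D. total_deg u \<le> t} {m \<in> cyl z D. total_deg m = t}"
  proof (rule bij_betwI')
    fix u v assume "u \<in> {u \<in> D. total_deg u \<le> t}" "v \<in> {u \<in> D. total_deg u \<le> t}"
    then have "lookup u z = 0" "lookup v z = 0" using assms by (auto intro: exps_lookup_zero)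
    show "(u + single z (t - total_deg u) = v + single z (t - total_deg v)) = (u = v)"
    proof
      assume eq: "u + single z (t - total_deg u) = v + single z (t - total_deg v)"
      have "t - total_deg u = t - total_deg v"
        using arg_cong[OF eq, of "\<lambda>m. lookup m z"] \<open>lookup u z = 0\<close> \<open>lookup v z = 0\<close> by (simp add: lookup_add)
      with eq show "u = v" by simp
    qed simp
  next
    fix u assume "u \<in> {u \<in> D. total_deg u \<le> t}"
    then show "u + single z (t - total_deg u) \<in> {m \<in> cyl z D. total_deg m = t}"
      by (auto simp: cyl_def)
  next
    fix m assume "m \<in> {m \<in> cyl z D. total_deg m = t}"
    then obtain u j where "u \<in> D" "m = u + single z j" "t = total_deg u + j" by (auto simp: cyl_def)
    then show "\<exists>u\<in>{u \<in> D. total_deg u \<le> t}. m = u + single z (t - total_deg u)" by (intro bexI[of _ u]) auto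
  qed
  from bij_betw_same_card[OF this] show ?thesis by (rule sym)
qed

text \<open>
  The monomials are homogeneous generators.
\<close>

lemma (in presentation) graded_ideal_mspan:
  assumes G: "upset V G" shows "graded_ideal A (mspan A G)"
proof -
  have id: "ideal (mspan A G) A" using G by (rule ideal_mspan)
  have GV: "G \<subseteq> exps V" using G by (simp add: upset_def)
  let ?S = "\<Union>t. mspan A G \<inter> gcomp A t"
  have Sc: "?S \<subseteq> carrier A" using mspan_subset_carrier[OF GV] by blast
  have "Idl ?S \<subseteq> mspan A G" by (rule genideal_minimal[OF id]) blast
  moreover have "mspan A (upclose V G) \<subseteq> Idl ?S"
  proof (rule mspan_upclose_subset[OF GV genideal_ideal[OF Sc]])
    have "amon A m \<in> ?S" if "m \<in> G" for m
    proof -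
      have "m \<in> {m' \<in> exps V. total_deg m' = total_deg m}" using that GV by auto
      then have "amon A m \<in> gcomp A (total_deg m)" unfolding gcomp_def by (rule amon_in_mspan)
      then show ?thesis using amon_in_mspan[OF that] by blast
    qed
    then show "amon A ` G \<subseteq> Idl ?S" using genideal_self[OF Sc] by blast
  qed
  ultimately show ?thesis unfolding graded_ideal_def using id upclose_upset[OF G] by auto
qed

text \<open>
  Both rings of the theorem have this shape, with the same last variable \<open>x\<^sub>z\<close>, which is the only one
  that is not truncated.
\<close>

locale truncated_algebra =
  fixes W :: "nat set" and z :: nat and e :: "nat \<Rightarrow> enat"
    and R :: "('k::field, 'k mpoly set) galg"
  assumes finite_W: "finite W" and W_less: "\<forall>i\<in>W. i < z" and e_ge_1: "\<forall>i\<in>W. 1 \<le> e i"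
    and R_def: "R = trunc_alg (insert z W) W e"
begin

abbreviation "M \<equiv> box W e"

lemma z_notin: "z \<notin> W"
  using W_less by auto

lemma vars_R [simp]: "vars R = insert z W"
  by (simp add: R_def trunc_alg_def Let_def quot_alg_simps)

lemma M_subset: "M \<subseteq> exps W"
  by (rule box_subset_exps)

end

sublocale truncated_algebra \<subseteq> monomial_algebra R "cyl z M"
proof -
  have "{m \<in> exps (insert z W). \<forall>i\<in>W. enat (lookup m i) < e i} = cyl z M"
  proof (intro equalityI subsetI)
    fix m assume m: "m \<in> {m \<in> exps (insert z W). \<forall>i\<in>W. enat (lookup m i) < e i}"
    then obtain v j where v: "m = v + single z j" "v \<in> exps W"
      using exps_insert_split[of m z W] z_notin by blast
    have "enat (lookup v i) < e i" if i: "i \<in> W" for i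
    proof -
      have "i \<noteq> z" using i z_notin by auto
      then have "lookup m i = lookup v i" using v(1) by (simp add: lookup_add lookup_single when_def)
      then show ?thesis using m i by auto
    qed
    then have "v \<in> M" using v(2) by (auto simp: box_def)
    then show "m \<in> cyl z M" using v by (auto simp: cyl_def)
  next
    fix m assume "m \<in> cyl z M"
    then obtain v j where v: "m = v + single z j" "v \<in> M" by (auto simp: cyl_def)
    then show "m \<in> {m \<in> exps (insert z W). \<forall>i\<in>W. enat (lookup m i) < e i}"
      using z_notin by (auto simp: box_def lookup_add lookup_single when_def exps_iff)
  qed
  then show "monomial_algebra R (cyl z M)"
    using monomial_algebra_trunc_alg[of "insert z W" W e, where ?'k = 'k] finite_W
    by (simp add: R_def subset_insertI)
qed

context truncated_algebra
begin

definition cone_ideal :: "(nat \<Rightarrow>\<^sub>0 nat) set \<Rightarrow> 'k mpoly set set" where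
  "cone_ideal D = mspan R (exps (insert z W) - cyl z D)"

definition order_ideal :: "(nat \<Rightarrow>\<^sub>0 nat) set \<Rightarrow> bool" where
  "order_ideal D \<longleftrightarrow> D \<subseteq> M \<and> divisor_closed D"

lemma order_ideal_exps: "order_ideal D \<Longrightarrow> D \<subseteq> exps W"
  using M_subset by (auto simp: order_ideal_def)

lemma cyl_subset_V: "order_ideal D \<Longrightarrow> cyl z D \<subseteq> exps (insert z W)"
  using cyl_subset_exps order_ideal_exps by blast

lemma upset_cone: "order_ideal D \<Longrightarrow> upset (insert z W) (exps (insert z W) - cyl z D)"
  using order_ideal_exps[of D] divisor_closed_cyl[OF _ z_notin, of D] by (intro upset_diff) (auto simp: order_ideal_def)

lemma ideal_cone: "order_ideal D \<Longrightarrow> ideal (cone_ideal D) R"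
  unfolding cone_ideal_def using upset_cone ideal_mspan by simp

lemma cyl_M_diff: "order_ideal D \<Longrightarrow> cyl z M - (exps (insert z W) - cyl z D) = cyl z D"
  using cyl_subset_exps[OF M_subset] cyl_mono[of D M z] by (auto simp: order_ideal_def)

lemma cone_subset_iff:
  assumes "order_ideal D" "order_ideal D'"
  shows "cone_ideal D \<subseteq> cone_ideal D' \<longleftrightarrow> D' \<subseteq> D"
proof -
  have "cone_ideal D \<subseteq> cone_ideal D' \<longleftrightarrow> cyl z D' \<subseteq> cyl z D"
    using cyl_subset_V[OF assms(2)] cyl_mono[of D' M z] assms(2)
    unfolding cone_ideal_def order_ideal_def by (subst mspan_subset_iff) auto
  then show ?thesis using cyl_subset_iff[OF order_ideal_exps order_ideal_exps z_notin] assms by simp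
qed

lemma cone_eq_iff:
  assumes "order_ideal D" "order_ideal D'" shows "cone_ideal D = cone_ideal D' \<longleftrightarrow> D = D'"
  using cone_subset_iff[OF assms] cone_subset_iff[OF assms(2,1)] by blast

lemma monomial_algebra_quot_cone:
  assumes "order_ideal D"
  shows "monomial_algebra (quot_alg R (cone_ideal D)) (cyl z D)"
proof -
  have "monomial_algebra (quot_alg R (cone_ideal D)) (cyl z M - (exps (insert z W) - cyl z D))"
    unfolding cone_ideal_def by (rule monomial_algebra_quot) (simp add: upset_cone assms)
  then show ?thesis by (simp only: cyl_M_diff[OF assms])
qed

lemma multiplicity_cone:
  assumes D: "order_ideal D" "finite D" shows "multiplicity_of R (cone_ideal D) = card D"
proof (rule multiplicity_ofI)
  interpret Q: monomial_algebra "quot_alg R (cone_ideal D)" "cyl z D"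
    using D(1) by (rule monomial_algebra_quot_cone)
  obtain b where b: "\<And>u. u \<in> D \<Longrightarrow> total_deg u \<le> b"
    using finite_nat_set_iff_bounded_le[of "total_deg ` D"] D(2) by auto
  have "hilbert_fun (quot_alg R (cone_ideal D)) t = card D" if "t \<ge> b" for t
  proof -
    have "{u \<in> D. total_deg u \<le> t} = D" using b that order_trans by blast
    then show ?thesis
      using card_cyl_deg[OF order_ideal_exps[OF D(1)] z_notin] by (simp add: Q.hilbert_fun_eq_card)
  qed
  then show "\<forall>\<^sub>F t in sequentially. hilbert_fun (quot_alg R (cone_ideal D)) t = card D"
    unfolding eventually_sequentially by blast
qed

lemma order_ideal_empty: "order_ideal {}"
  by (simp add: order_ideal_def divisor_closed_def)

lemma cone_empty: "cone_ideal {} = carrier R"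
  unfolding carrier_eq_mspan cone_ideal_def by (simp add: cyl_def)

lemma avar_closed: "i \<in> insert z W \<Longrightarrow> avar R i \<in> carrier R"
  using amon_closed[of "unitv i"] by (simp add: avar_def amon_def X_def)

text \<open>
  Membership in the ideal does not depend on the exponent of \<open>x\<^sub>z\<close>.
\<close>

lemma cone_cancel_last_var:
  assumes D: "order_ideal D" and f: "f \<in> carrier R" "f \<otimes>\<^bsub>R\<^esub> avar R z \<in> cone_ideal D"
  shows "f \<in> cone_ideal D"
proof -
  obtain p where p: "f = proj R p" "keys p \<subseteq> exps (insert z W)"
    using carrierE[OF f(1)] by auto
  have "f \<otimes>\<^bsub>R\<^esub> avar R z = proj R (p * X z)"
    using p by (simp add: avar_def X_def monom_of_def proj_mult)
  moreover have kX: "keys (p * X z) \<subseteq> exps (insert z W)"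
    using p(2) by (intro keys_mult_exps) (auto simp: X_def monom_of_def)
  ultimately have sub: "keys (p * X z) \<inter> cyl z M \<subseteq> exps (insert z W) - cyl z D"
    using f(2) proj_in_mspan_iff[of "p * X z"] by (auto simp: cone_ideal_def)
  have "m \<notin> cyl z D" if "m \<in> keys p" for m
  proof
    assume "m \<in> cyl z D"
    then obtain u j where u: "m = u + single z j" "u \<in> D" by (auto simp: cyl_def)
    then have "m + unitv z = u + single z (j + 1)" by (simp add: add.assoc single_add[symmetric])
    then have "m + unitv z \<in> cyl z D" using u(2) unfolding cyl_def by blast
    moreover have "m + unitv z \<in> keys (p * X z)"
    proof -
      have "lookup (p * X z) (m + unitv z) = lookup p m"
        by (simp add: X_def monom_of_def lookup_mult_single)
      then show ?thesis using that by (simp add: in_keys_iff)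
    qed
    ultimately show False using sub cyl_mono[of D M z] D by (auto simp: order_ideal_def)
  qed
  then have "keys p \<subseteq> exps (insert z W) - cyl z D" using p(2) by auto
  then show "f \<in> cone_ideal D" using p(1) by (auto simp: cone_ideal_def mspan_def)
qed

lemma saturated_cone:
  assumes D: "order_ideal D" shows "saturated R (cone_ideal D)"
  unfolding saturated_def
proof
  interpret I: ideal "cone_ideal D" R using D by (rule ideal_cone)
  have av: "avar R ` vars R \<subseteq> carrier R" using avar_closed by auto
  show "cone_ideal D \<subseteq> ideal_colon R (cone_ideal D) (max_ideal R)"
    using genideal_ideal[OF av, THEN ideal.Icarr] I.Icarr I.I_r_closed
    by (auto simp: ideal_colon_def max_ideal_def)
  have "avar R z \<in> max_ideal R"
    unfolding max_ideal_def using genideal_self[OF av] by auto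
  then show "ideal_colon R (cone_ideal D) (max_ideal R) \<subseteq> cone_ideal D"
    using cone_cancel_last_var[OF D] by (auto simp: ideal_colon_def)
qed

text \<open>
  The chain of length one consists of the ideals generated by the variables \<open>W\<close> and by all
  variables. Since \<open>D\<close> is finite, the variables \<open>W\<close> are nilpotent modulo the ideal.
\<close>

lemma krull_dim_cone:
  assumes D: "order_ideal D" "finite D" "D \<noteq> {}"
  shows "krull_dim (R Quot cone_ideal D) = 1"
proof -
  interpret Q: monomial_algebra "quot_alg R (cone_ideal D)" "cyl z D"
    using D(1) by (rule monomial_algebra_quot_cone)
  have V: "vars (quot_alg R (cone_ideal D)) = insert z W" by (simp add: quot_alg_simps)
  have 0: "0 \<in> D" using D by (metis add_0 divisor_closedD equals0I order_ideal_def)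
  have "exps {z} \<subseteq> cyl z D"
  proof
    fix m assume m: "m \<in> exps {z}"
    then have "m = 0 + single z (lookup m z)"
      by (intro poly_mapping_eqI) (auto simp: exps_iff lookup_single when_def)
    then show "m \<in> cyl z D" using 0 unfolding cyl_def by blast
  qed
  then have "enat 1 \<le> krull_dim (quot_alg R (cone_ideal D))"
    by (intro Q.krull_dim_ge_coordinates[of "\<lambda>i. if i = 0 then {z} else {}"]) (auto simp: V)
  moreover have "krull_dim (quot_alg R (cone_ideal D)) \<le> 1"
  proof (rule Q.krull_dim_le_1[of z])
    show "z \<in> vars (quot_alg R (cone_ideal D))" by (simp add: V)
    fix i assume "i \<in> vars (quot_alg R (cone_ideal D)) - {z}"
    then have i: "i \<in> W" "i \<noteq> z" by (auto simp: V)
    have "\<not> range (single i) \<subseteq> D"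
      using D(2) by (metis finite_imageD finite_subset infinite_UNIV_nat injI inj_on_def lookup_single_eq)
    then obtain j where j: "single i j \<notin> D" by blast
    then have "single i j \<notin> cyl z D"
      using in_cyl_iff[OF order_ideal_exps[OF D(1)] z_notin] i by (simp add: lookup_single when_def)
    then have "amon (quot_alg R (cone_ideal D)) (single i j) = \<zero>\<^bsub>quot_alg R (cone_ideal D)\<^esub>"
      using i by (subst Q.amon_eq_zero_iff) (auto simp: V)
    then show "\<exists>j. amon (quot_alg R (cone_ideal D)) (single i j) = \<zero>\<^bsub>quot_alg R (cone_ideal D)\<^esub>" by blast
  qed
  ultimately show ?thesis unfolding krull_dim_quot_alg by (simp add: one_enat_def)
qed

lemma cone_in_Hilb:
  assumes D: "order_ideal D" "finite D" shows "cone_ideal D \<in> Hilb (card D) R"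
proof (cases "D = {}")
  case True
  then show ?thesis by (simp add: Hilb_def cone_empty)
next
  case False
  then have "card D \<noteq> 0" using D by simp
  moreover have "graded_ideal R (cone_ideal D)"
    unfolding cone_ideal_def using upset_cone[OF D(1)] graded_ideal_mspan by simp
  ultimately show ?thesis
    using saturated_cone[OF D(1)] krull_dim_cone[OF D False] multiplicity_cone[OF D]
    by (simp add: Hilb_def)
qed

text \<open>
  If \<open>D\<close> is infinite, then it contains all powers of some variable \<open>x\<^sub>i\<close>. So the ideal is contained in
  the prime ideal generated by the variables other than \<open>x\<^sub>i\<close> and \<open>x\<^sub>z\<close>, which starts a chain of length
  two.
\<close>

lemma krull_dim_cone_infinite:
  assumes D: "order_ideal D" "infinite D"
  shows "krull_dim (R Quot cone_ideal D) \<noteq> 1"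
proof -
  interpret Q: monomial_algebra "quot_alg R (cone_ideal D)" "cyl z D"
    using D(1) by (rule monomial_algebra_quot_cone)
  have V: "vars (quot_alg R (cone_ideal D)) = insert z W" by (simp add: quot_alg_simps)
  have "\<exists>i\<in>W. \<forall>j. single i j \<in> D"
  proof (rule ccontr)
    assume "\<not> ?thesis"
    then obtain b where b: "\<And>i. i \<in> W \<Longrightarrow> single i (b i) \<notin> D" by metis
    have "D \<subseteq> {m \<in> exps W. \<forall>i\<in>W. lookup m i \<le> b i}"
    proof
      fix m assume m: "m \<in> D"
      have "lookup m i \<le> b i" if i: "i \<in> W" for i
      proof (rule ccontr)
        assume "\<not> lookup m i \<le> b i"
        then have "lookup (single i (b i)) k \<le> lookup m k" for k by (auto simp: lookup_single when_def)
        then obtain r where "m = single i (b i) + r" by (rule pointwise_le_imp_add)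
        then show False using m b[OF i] D(1) divisor_closedD by (auto simp: order_ideal_def)
      qed
      then show "m \<in> {m \<in> exps W. \<forall>i\<in>W. lookup m i \<le> b i}" using m order_ideal_exps[OF D(1)] by auto
    qed
    then show False using finite_exps_bounded[OF finite_W] D(2) finite_subset by blast
  qed
  then obtain i where i: "i \<in> W" "\<And>j. single i j \<in> D" by blast
  have "exps {i, z} \<subseteq> cyl z D"
  proof
    fix m assume m: "m \<in> exps {i, z}"
    then have "m = single i (lookup m i) + single z (lookup m z)"
      using i z_notin by (intro poly_mapping_eqI) (auto simp: exps_iff lookup_add lookup_single when_def)
    then show "m \<in> cyl z D" using i(2) unfolding cyl_def by blast
  qed
  then have "enat 2 \<le> krull_dim (quot_alg R (cone_ideal D))"
    using i z_notin
    by (intro Q.krull_dim_ge_coordinates[of "\<lambda>j. if j = 0 then {i, z} else if j = 1 then {z} else {}"])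
      (auto simp: V less_2_cases_iff)
  then show ?thesis unfolding krull_dim_quot_alg by (auto simp: one_enat_def)
qed

lemma last_var_R: "last_var R = z"
  unfolding last_var_def by (rule Max_eqI) (use finite_W W_less in \<open>auto intro: less_imp_le\<close>)

text \<open>
  The exponents of the monomials of degree at least \<open>p\<close> in the variables \<open>W\<close>, stated by means of the
  total degree.
\<close>

definition power_exps :: "nat \<Rightarrow> (nat \<Rightarrow>\<^sub>0 nat) set" where
  "power_exps p = {m \<in> exps (insert z W). p + lookup m z \<le> total_deg m}"

lemma upset_power_exps: "upset (insert z W) (power_exps p)"
proof -
  have "p + lookup (m + m') z \<le> total_deg (m + m')" if "p + lookup m z \<le> total_deg m" for m m'
    using that total_deg_ge_lookup[of m' z] by (simp add: lookup_add)
  then show ?thesis unfolding upset_def power_exps_def by simp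
qed

lemma nonlast_ideal_eq: "nonlast_ideal R = mspan R (power_exps 1)"
proof -
  have E: "unitv ` W \<subseteq> exps (insert z W)" by auto
  have "avar R ` (vars R - {last_var R}) = amon R ` unitv ` W"
    using z_notin by (auto simp: last_var_R avar_def amon_def X_def)
  then have "nonlast_ideal R = mspan R (upclose (insert z W) (unitv ` W))"
    unfolding nonlast_ideal_def using genideal_monomials[of "unitv ` W" "amon R ` unitv ` W"] E
    by (simp add: subset_insertI)
  also have "upclose (insert z W) (unitv ` W) = power_exps 1"
  proof (intro equalityI subsetI)
    fix m assume "m \<in> upclose (insert z W) (unitv ` W)"
    then obtain i m' where "i \<in> W" "m = unitv i + m'" "m' \<in> exps (insert z W)" by (auto simp: upclose_def)
    then show "m \<in> power_exps 1"
      using z_notin total_deg_ge_lookup[of m' z] by (auto simp: power_exps_def lookup_add lookup_single when_def)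
  next
    fix m assume m: "m \<in> power_exps 1"
    then obtain v j where v: "m = v + single z j" "v \<in> exps W" "lookup v z = 0"
      using exps_insert_split z_notin unfolding power_exps_def by blast
    with m have "v \<noteq> 0" by (auto simp: power_exps_def lookup_add)
    then obtain i where i: "i \<in> keys v" by (metis all_not_in_conv keys_eq_empty)
    then obtain v' where v': "v = v' + unitv i" by (rule exponent_split_unitv)
    have "i \<in> W" using i v(2) by (auto simp: exps_def)
    moreover have "m = unitv i + (v' + single z j)" using v v' by (simp add: ac_simps)
    moreover have "v' + single z j \<in> exps (insert z W)"
      using v(2) v' by (auto simp: exps_iff lookup_add lookup_single when_def)
    ultimately show "m \<in> upclose (insert z W) (unitv ` W)" unfolding upclose_def by blast
  qed
  finally show ?thesis .
qed

lemma power_exps_Suc: "{g + h | g h. g \<in> power_exps p \<and> h \<in> power_exps 1} = power_exps (Suc p)"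
proof (intro equalityI subsetI)
  fix m assume "m \<in> {g + h | g h. g \<in> power_exps p \<and> h \<in> power_exps 1}"
  then show "m \<in> power_exps (Suc p)" by (auto simp: power_exps_def lookup_add)
next
  fix m assume m: "m \<in> power_exps (Suc p)"
  then obtain v j where v: "m = v + single z j" "v \<in> exps W" "lookup v z = 0"
    using exps_insert_split z_notin unfolding power_exps_def by blast
  with m have "Suc p \<le> total_deg v" by (auto simp: power_exps_def lookup_add)
  then have "v \<noteq> 0" by auto
  then obtain i where i: "i \<in> keys v" by (metis all_not_in_conv keys_eq_empty)
  then obtain v' where v': "v = v' + unitv i" by (rule exponent_split_unitv)
  have iW: "i \<in> W" using i v(2) by (auto simp: exps_def)
  have "m = (v' + single z j) + unitv i" using v v' by (simp add: ac_simps)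
  moreover have "lookup v' z = 0" "v' \<in> exps (insert z W)" using v v' by (auto simp: exps_iff lookup_add)
  then have "v' + single z j \<in> power_exps p"
    using \<open>Suc p \<le> total_deg v\<close> v' by (auto simp: power_exps_def lookup_add)
  moreover have "unitv i \<in> power_exps 1" using iW z_notin by (auto simp: power_exps_def lookup_single when_def)
  ultimately show "m \<in> {g + h | g h. g \<in> power_exps p \<and> h \<in> power_exps 1}" by blast
qed

lemma nonlast_ideal_power: "nonlast_ideal R [^]\<^bsub>ideals_set R\<^esub> (p::nat) = mspan R (power_exps p)"
proof (induction p)
  case 0
  have "power_exps 0 = exps (insert z W)" using total_deg_ge_lookup by (auto simp: power_exps_def)
  then show ?case by (simp add: ideals_set_def carrier_eq_mspan)
next
  case (Suc p)
  have "nonlast_ideal R [^]\<^bsub>ideals_set R\<^esub> Suc p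
      = (nonlast_ideal R [^]\<^bsub>ideals_set R\<^esub> p) \<cdot>\<^bsub>R\<^esub> nonlast_ideal R"
    by (simp add: ideals_set_def)
  also have "\<dots> = mspan R {g + h | g h. g \<in> power_exps p \<and> h \<in> power_exps 1}"
    unfolding Suc.IH unfolding nonlast_ideal_eq using upset_power_exps by (intro ideal_prod_mspan) auto
  finally show ?case unfolding power_exps_Suc .
qed

end

section \<open>Almost lex ideals\<close>

context truncated_algebra
begin

lemma quot_mult_eq_zero_iff:
  assumes I: "ideal I R" and f: "f \<in> carrier R" and g: "g \<in> carrier R"
  shows "(I +>\<^bsub>R\<^esub> g) \<otimes>\<^bsub>R Quot I\<^esub> (I +>\<^bsub>R\<^esub> f) = \<zero>\<^bsub>R Quot I\<^esub> \<longleftrightarrow> f \<otimes>\<^bsub>R\<^esub> g \<in> I"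
proof -
  interpret I: ideal I R by (rule I)
  have "(I +>\<^bsub>R\<^esub> g) \<otimes>\<^bsub>R Quot I\<^esub> (I +>\<^bsub>R\<^esub> f) = I +>\<^bsub>R\<^esub> (f \<otimes>\<^bsub>R\<^esub> g)"
    using I.rcoset_mult_add[OF g f] m_comm[OF f g] by (simp add: FactRing_def)
  moreover have "f \<otimes>\<^bsub>R\<^esub> g \<in> carrier R" using f g by simp
  ultimately show ?thesis
    using I.rcos_const_imp_mem[of "f \<otimes>\<^bsub>R\<^esub> g"] a_rcos_zero[OF I] by (auto simp: FactRing_def)
qed

lemma nonzerodivisor_mod_iff:
  assumes I: "ideal I R" and x: "x \<in> carrier R"
  shows "nonzerodivisor_mod R I x \<longleftrightarrow> (\<forall>f\<in>carrier R. f \<otimes>\<^bsub>R\<^esub> x \<in> I \<longrightarrow> f \<in> I)"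
proof -
  interpret I: ideal I R by (rule I)
  have "carrier (R Quot I) = (\<lambda>f. I +>\<^bsub>R\<^esub> f) ` carrier R"
    by (auto simp: FactRing_def A_RCOSETS_def')
  moreover have "I +>\<^bsub>R\<^esub> f = \<zero>\<^bsub>R Quot I\<^esub> \<longleftrightarrow> f \<in> I" if "f \<in> carrier R" for f
    using I.rcos_const_imp_mem[OF that] a_rcos_zero[OF I] by (auto simp: FactRing_def)
  ultimately show ?thesis
    unfolding nonzerodivisor_mod_def using quot_mult_eq_zero_iff[OF I _ x] by auto
qed

text \<open>
  If \<open>x\<^sub>z\<close> can be cancelled, then membership of \<open>x^u x\<^sub>z^j\<close> depends on \<open>u\<close> only.
\<close>

lemma mspan_eq_cone_ideal:
  assumes G: "upset (insert z W) G"
    and cancel: "\<And>m. m \<in> cyl z M \<Longrightarrow> m + unitv z \<in> G \<Longrightarrow> m \<in> G"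
  shows "order_ideal (M - G)" "mspan R G = cone_ideal (M - G)"
proof -
  have GV: "G \<subseteq> exps (insert z W)" using G by (simp add: upset_def)
  show D: "order_ideal (M - G)"
    unfolding order_ideal_def divisor_closed_def
  proof (intro conjI allI impI)
    fix u v assume uv: "u + v \<in> M - G"
    then have uvM: "u + v \<in> M" by simp
    have "u \<in> M" using divisor_closedD[OF divisor_closed_box uvM] .
    have "v \<in> M" using divisor_closedD2[OF divisor_closed_box uvM] .
    then have "v \<in> exps W" using M_subset by blast
    then have "v \<in> exps (insert z W)" by (simp add: exps_iff)
    then have "u \<notin> G" using uv G unfolding upset_def by blast
    with \<open>u \<in> M\<close> show "u \<in> M - G" by blast
  qed auto
  have *: "u + single z j \<in> G \<longleftrightarrow> u \<in> G" if u: "u \<in> M" for u j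
  proof
    show "u \<in> G \<Longrightarrow> u + single z j \<in> G" using G by (simp add: upset_def)
    show "u + single z j \<in> G \<Longrightarrow> u \<in> G"
    proof (induction j)
      case (Suc j)
      have "u + single z (Suc j) = (u + single z j) + unitv z" by (simp add: add.assoc single_add[symmetric])
      moreover have "u + single z j \<in> cyl z M" using u by (auto simp: cyl_def)
      ultimately show ?case using Suc cancel by metis
    qed simp
  qed
  have "G \<inter> cyl z M = (exps (insert z W) - cyl z (M - G)) \<inter> cyl z M"
  proof (rule Set.set_eqI)
    fix m
    show "m \<in> G \<inter> cyl z M \<longleftrightarrow> m \<in> (exps (insert z W) - cyl z (M - G)) \<inter> cyl z M"
    proof (cases "m \<in> cyl z M")
      case True
      then obtain u j where u: "m = u + single z j" "u \<in> M" by (auto simp: cyl_def)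
      have "lookup u z = 0" using u(2) M_subset z_notin by (auto intro: exps_lookup_zero)
      then have "m \<in> cyl z (M - G) \<longleftrightarrow> u \<in> M - G"
        using add_single_in_cyl_iff[of "M - G" W z u j] M_subset z_notin u(1) by auto
      moreover have "m \<in> exps (insert z W)" using True cyl_subset_exps[OF M_subset] by auto
      ultimately show ?thesis using True u *[OF u(2), of j] by auto
    qed simp
  qed
  then show "mspan R G = cone_ideal (M - G)"
    unfolding cone_ideal_def using GV by (subst mspan_eq_iff) auto
qed

text \<open>
  The set of monomials in the variables \<open>W\<close> outside of \<open>D\<close> is in each degree an initial segment in the sense of
  lex ideals.
\<close>

definition lex_lower :: "(nat \<Rightarrow>\<^sub>0 nat) set \<Rightarrow> bool" where
  "lex_lower D \<longleftrightarrow> (\<forall>u\<in>D. \<forall>v\<in>M. total_deg v = total_deg u \<longrightarrow> v < u \<longrightarrow> v \<in> D)"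

lemma principal_last_var:
  "PIdl\<^bsub>R\<^esub> (avar R z) = mspan R {m \<in> exps (insert z W). z \<in> keys m}"
proof -
  have "PIdl\<^bsub>R\<^esub> (avar R z) = Idl\<^bsub>R\<^esub> {avar R z}"
    using avar_closed[of z] by (intro cgenideal_eq_genideal) simp
  also have "\<dots> = mspan R (upclose (insert z W) {unitv z})"
    using genideal_monomials[of "{unitv z}" "{avar R z}"] by (auto simp: avar_def amon_def X_def)
  also have "upclose (insert z W) {unitv z} = {m \<in> exps (insert z W). z \<in> keys m}"
  proof (intro equalityI subsetI)
    fix m assume "m \<in> {m \<in> exps (insert z W). z \<in> keys m}"
    moreover from this obtain v where v: "m = v + unitv z" using exponent_split_unitv by blast
    ultimately have "m = unitv z + v" "v \<in> exps (insert z W)" by (auto simp: add.commute)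
    then show "m \<in> upclose (insert z W) {unitv z}" unfolding upclose_def by blast
  qed (auto simp: upclose_def in_keys_iff lookup_add)
  finally show ?thesis .
qed

lemma monomial_algebra_mod_last_var:
  "monomial_algebra (quot_alg R (PIdl\<^bsub>R\<^esub> (avar R z))) M"
proof -
  let ?G = "{m \<in> exps (insert z W). z \<in> keys m}"
  have "upset (insert z W) ?G" by (auto simp: upset_def in_keys_iff lookup_add)
  then have "monomial_algebra (quot_alg R (PIdl\<^bsub>R\<^esub> (avar R z))) (cyl z M - ?G)"
    unfolding principal_last_var by (intro monomial_algebra_quot) simp
  moreover have "cyl z M - ?G = M"
  proof (intro equalityI subsetI)
    fix m assume m: "m \<in> cyl z M - ?G"
    then have "lookup m z = 0" using cyl_subset_exps[OF M_subset] by (auto simp: in_keys_iff)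
    then show "m \<in> M" using m in_cyl_iff[OF M_subset z_notin] by auto
  next
    fix m assume m: "m \<in> M"
    then have "lookup m z = 0" using M_subset z_notin by (auto intro: exps_lookup_zero)
    then show "m \<in> cyl z M - ?G" using m in_cyl_iff[OF M_subset z_notin] by (auto simp: in_keys_iff)
  qed
  ultimately show ?thesis by simp
qed

text \<open>
  Modulo \<open>x\<^sub>z\<close> the nonzero monomials are those in \<open>M\<close>, and the ideal becomes the span of \<open>M - D\<close>.
\<close>

lemma lex_ideal_cone_iff:
  assumes D: "order_ideal D"
  defines "J \<equiv> PIdl\<^bsub>R\<^esub> (avar R z)"
  shows "lex_ideal (quot_alg R J) ((\<lambda>f. J +>\<^bsub>R\<^esub> f) ` cone_ideal D) \<longleftrightarrow> lex_lower D"
proof -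
  interpret Q: monomial_algebra "quot_alg R J" M
    unfolding J_def by (rule monomial_algebra_mod_last_var)
  have V: "vars (quot_alg R J) = insert z W" by (simp add: quot_alg_simps)
  let ?G = "exps (insert z W) - cyl z D"
  let ?E = "\<lambda>t. {m \<in> M - D. total_deg m = t}"
  have MV: "M \<subseteq> exps (insert z W)" using M_subset by (auto simp: exps_def)
  have im: "(\<lambda>f. J +>\<^bsub>R\<^esub> f) ` cone_ideal D = mspan (quot_alg R J) ?G"
    by (simp add: cone_ideal_def mspan_quot_alg)
  have mon: "monomial_ideal (quot_alg R J) (mspan (quot_alg R J) ?G)"
    using upset_cone[OF D] Q.monomial_ideal_iff V by auto
  have MD: "m \<in> cyl z D \<longleftrightarrow> m \<in> D" if "m \<in> M" for m
    using that M_subset by (intro in_cyl_iff[OF order_ideal_exps[OF D] z_notin] exps_lookup_zero[OF _ z_notin]) auto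
  have deg: "mspan (quot_alg R J) ?G \<inter> gcomp (quot_alg R J) t = mspan (quot_alg R J) E \<longleftrightarrow> E = ?E t"
    if E: "E \<subseteq> M" for E t
  proof -
    have "mspan (quot_alg R J) ?G \<inter> gcomp (quot_alg R J) t
        = mspan (quot_alg R J) (?G \<inter> {m \<in> exps (insert z W). total_deg m = t})"
      unfolding gcomp_def V by (rule Q.mspan_Int) (auto simp: V)
    moreover have "(?G \<inter> {m \<in> exps (insert z W). total_deg m = t}) \<inter> M = ?E t"
      using MD MV by auto
    moreover have "E \<inter> M = E" using E by blast
    moreover have "mspan (quot_alg R J) (?G \<inter> {m \<in> exps (insert z W). total_deg m = t}) = mspan (quot_alg R J) E
        \<longleftrightarrow> (?G \<inter> {m \<in> exps (insert z W). total_deg m = t}) \<inter> M = E \<inter> M"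
      by (rule Q.mspan_eq_iff) (use E MV in \<open>auto simp: V\<close>)
    ultimately show ?thesis by (simp only: eq_commute[of E])
  qed
  show ?thesis
  proof
    assume lex: "lex_ideal (quot_alg R J) ((\<lambda>f. J +>\<^bsub>R\<^esub> f) ` cone_ideal D)"
    show "lex_lower D" unfolding lex_lower_def
    proof (intro ballI impI)
      fix u v assume uv: "u \<in> D" "v \<in> M" "total_deg v = total_deg u" "v < u"
      obtain E where E: "E \<subseteq> nz_exps (quot_alg R J) (total_deg u)"
        "\<forall>m\<in>E. \<forall>m'\<in>nz_exps (quot_alg R J) (total_deg u). m < m' \<longrightarrow> m' \<in> E"
        "mspan (quot_alg R J) ?G \<inter> gcomp (quot_alg R J) (total_deg u) = mspan (quot_alg R J) E"
        using lex unfolding im lex_ideal_def by blast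
      have "E \<subseteq> M" using E(1) unfolding Q.nz_exps_eq by blast
      then have "E = ?E (total_deg u)" using E(3) deg by blast
      moreover have "u \<in> M" using uv(1) D by (auto simp: order_ideal_def)
      ultimately show "v \<in> D" using E(2) uv unfolding Q.nz_exps_eq by blast
    qed
  next
    assume low: "lex_lower D"
    have "\<exists>E\<subseteq>nz_exps (quot_alg R J) t. (\<forall>m\<in>E. \<forall>m'\<in>nz_exps (quot_alg R J) t. m < m' \<longrightarrow> m' \<in> E) \<and>
        mspan (quot_alg R J) ?G \<inter> gcomp (quot_alg R J) t = mspan (quot_alg R J) E" for t
      using low deg[of "?E t" t] unfolding Q.nz_exps_eq lex_lower_def by (intro exI[of _ "?E t"]) auto
    then show "lex_ideal (quot_alg R J) ((\<lambda>f. J +>\<^bsub>R\<^esub> f) ` cone_ideal D)"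
      unfolding im lex_ideal_def using mon by blast
  qed
qed

text \<open>
  That \<open>x\<^sub>z\<close> is a nonzerodivisor gives the cone form of the ideal.
\<close>

lemma almost_lex_iff: "almost_lex R I \<longleftrightarrow> (\<exists>D. order_ideal D \<and> lex_lower D \<and> I = cone_ideal D)"
proof
  assume "almost_lex R I"
  then have mon: "monomial_ideal R I" and nzd: "nonzerodivisor_mod R I (avar R z)"
    and lex: "lex_ideal (quot_alg R (PIdl\<^bsub>R\<^esub> (avar R z))) ((\<lambda>f. (PIdl\<^bsub>R\<^esub> (avar R z)) +>\<^bsub>R\<^esub> f) ` I)"
    by (auto simp: almost_lex_def last_var_R Let_def)
  obtain G where G: "upset (insert z W) G" "I = mspan R G" using mon monomial_ideal_iff by auto
  have GV: "G \<subseteq> exps (insert z W)" using G(1) by (simp add: upset_def)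
  have id: "ideal I R" using G ideal_mspan by simp
  have "m \<in> G" if m: "m \<in> cyl z M" "m + unitv z \<in> G" for m
  proof -
    have mV: "m \<in> exps (insert z W)" using m(1) cyl_subset_exps[OF M_subset] by auto
    have "amon R m \<otimes>\<^bsub>R\<^esub> avar R z = amon R (m + unitv z)"
      using mV by (simp add: amon_add) (simp add: amon_def avar_def X_def)
    then have "amon R m \<otimes>\<^bsub>R\<^esub> avar R z \<in> I" using amon_in_mspan[OF m(2)] G(2) by simp
    then have "amon R m \<in> I"
      using nzd nonzerodivisor_mod_iff[OF id avar_closed[of z]] amon_closed[of m] mV by simp
    then show ?thesis using amon_in_mspan_iff[of m G] mV GV G(2) m(1) by simp
  qed
  note cone = mspan_eq_cone_ideal[OF G(1) this]
  show "\<exists>D. order_ideal D \<and> lex_lower D \<and> I = cone_ideal D"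
    using cone lex G(2) lex_ideal_cone_iff[OF cone(1)] by auto
next
  assume "\<exists>D. order_ideal D \<and> lex_lower D \<and> I = cone_ideal D"
  then obtain D where D: "order_ideal D" "lex_lower D" "I = cone_ideal D" by blast
  have "monomial_ideal R I"
    unfolding monomial_ideal_iff D(3) cone_ideal_def using upset_cone[OF D(1)] by auto
  moreover have "nonzerodivisor_mod R I (avar R z)"
    using D cone_cancel_last_var[OF D(1)] nonzerodivisor_mod_iff[OF ideal_cone[OF D(1)] avar_closed[of z]]
    by simp
  ultimately show "almost_lex R I"
    using lex_ideal_cone_iff[OF D(1)] D by (simp add: almost_lex_def last_var_R Let_def)
qed

lemma initial_order_ideal: "initial M S \<Longrightarrow> order_ideal S"
  using initial_divisor_closed by (auto simp: order_ideal_def initial_def)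

lemma power_subset_cone_iff:
  assumes D: "order_ideal D"
  shows "mspan R (power_exps (Suc p)) \<subseteq> cone_ideal D \<longleftrightarrow> (\<forall>u\<in>D. total_deg u \<le> p)"
proof -
  have zero: "lookup u z = 0" if "u \<in> D" for u
    using that order_ideal_exps[OF D] z_notin by (auto intro: exps_lookup_zero)
  have "mspan R (power_exps (Suc p)) \<subseteq> cone_ideal D \<longleftrightarrow> power_exps (Suc p) \<inter> cyl z D = {}"
    using cyl_subset_V[OF D] cyl_mono[of D M z] D
    unfolding cone_ideal_def order_ideal_def
    by (subst mspan_subset_iff) (auto simp: power_exps_def)
  also have "\<dots> \<longleftrightarrow> (\<forall>u\<in>D. total_deg u \<le> p)"
  proof (intro iffI ballI)
    fix u assume "power_exps (Suc p) \<inter> cyl z D = {}" "u \<in> D"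
    moreover have "u \<in> cyl z D" using \<open>u \<in> D\<close> zero in_cyl_iff[OF order_ideal_exps[OF D] z_notin] by auto
    ultimately show "total_deg u \<le> p" using zero cyl_subset_V[OF D] by (fastforce simp: power_exps_def)
  next
    assume *: "\<forall>u\<in>D. total_deg u \<le> p"
    show "power_exps (Suc p) \<inter> cyl z D = {}"
    proof (rule ccontr)
      assume "\<not> ?thesis"
      then obtain u j where "u \<in> D" "u + single z j \<in> power_exps (Suc p)" by (auto simp: cyl_def)
      then show False using * zero by (fastforce simp: power_exps_def lookup_add)
    qed
  qed
  finally show ?thesis .
qed

lemma cone_subset_power_iff:
  assumes D: "order_ideal D"
  shows "cone_ideal D \<subseteq> mspan R (power_exps p) \<longleftrightarrow> (\<forall>u\<in>M - D. p \<le> total_deg u)"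
proof -
  have zero: "lookup u z = 0" if "u \<in> M" for u
    using that M_subset z_notin by (auto intro: exps_lookup_zero)
  have "cone_ideal D \<subseteq> mspan R (power_exps p) \<longleftrightarrow> cyl z M - cyl z D \<subseteq> power_exps p"
    using cyl_subset_exps[OF M_subset, of z]
    unfolding cone_ideal_def by (subst mspan_subset_iff) (auto simp: power_exps_def)
  also have "\<dots> \<longleftrightarrow> (\<forall>u\<in>M - D. p \<le> total_deg u)"
  proof (intro iffI ballI subsetI)
    fix u assume *: "cyl z M - cyl z D \<subseteq> power_exps p" "u \<in> M - D"
    then have "u \<in> cyl z M - cyl z D"
      using zero in_cyl_iff[OF order_ideal_exps[OF D] z_notin] in_cyl_iff[OF M_subset z_notin] by auto
    then show "p \<le> total_deg u" using * zero by (auto simp: power_exps_def)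
  next
    fix m assume *: "\<forall>u\<in>M - D. p \<le> total_deg u" "m \<in> cyl z M - cyl z D"
    then obtain u j where u: "m = u + single z j" "u \<in> M" by (auto simp: cyl_def)
    then have "u \<notin> D" using *(2) by (auto simp: cyl_def)
    then have "p \<le> total_deg u" using * u by auto
    moreover have "m \<in> exps (insert z W)" using *(2) cyl_subset_exps[OF M_subset] by auto
    ultimately show "m \<in> power_exps p" using u zero[OF u(2)] by (auto simp: power_exps_def lookup_add)
  qed
  finally show ?thesis .
qed

text \<open>
  The two inclusions mean that \<open>D\<close> contains all monomials of degree less than \<open>p\<close> and none of degree greater
  than \<open>p\<close>. Together with the lex condition in degree \<open>p\<close> this makes \<open>D\<close> an initial segment in the
  degree-lexicographic order, and such a segment is determined by its size.
\<close>

lemma C_ideal_eq_cone: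
  assumes S: "initial M S" "finite S" "card S = d"
  shows "C_ideal d R = cone_ideal S"
  unfolding C_ideal_def nonlast_ideal_power
proof (rule the_equality)
  have oS: "order_ideal S" using S(1) by (rule initial_order_ideal)
  have "lex_lower S" using S(1) unfolding lex_lower_def initial_def deglex_less_def by metis
  moreover have "\<exists>p. mspan R (power_exps (Suc p)) \<subseteq> cone_ideal S \<and> cone_ideal S \<subseteq> mspan R (power_exps p)"
  proof (cases "S = {}")
    case True
    then show ?thesis
      using power_subset_cone_iff[OF oS, of 0] cone_subset_power_iff[OF oS, of 0] by auto
  next
    case False
    \<comment> \<open>The exponent p is the degree of the largest element of S.\<close>
    obtain w where w: "w \<in> S" "S = {x \<in> M. x \<preceq> w}" using initial_eq_below_Max[OF S(1,2) False] .
    have "\<forall>u\<in>S. total_deg u \<le> total_deg w" using w(2) by (auto simp: deglex_le_iff)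
    moreover have "\<forall>u\<in>M - S. total_deg w \<le> total_deg u"
      using w(2) by (auto simp: deglex_le_iff)
    ultimately show ?thesis using power_subset_cone_iff[OF oS] cone_subset_power_iff[OF oS] by blast
  qed
  ultimately show "cone_ideal S \<in> Hilb d R \<and> almost_lex R (cone_ideal S) \<and>
      (\<exists>p. mspan R (power_exps (Suc p)) \<subseteq> cone_ideal S \<and> cone_ideal S \<subseteq> mspan R (power_exps p))"
    using cone_in_Hilb[OF oS S(2)] S(3) oS almost_lex_iff by blast
  fix C assume C: "C \<in> Hilb d R \<and> almost_lex R C \<and>
      (\<exists>p. mspan R (power_exps (Suc p)) \<subseteq> C \<and> C \<subseteq> mspan R (power_exps p))"
  then obtain D where D: "order_ideal D" "lex_lower D" "C = cone_ideal D" using almost_lex_iff by blast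
  obtain p where "mspan R (power_exps (Suc p)) \<subseteq> C" "C \<subseteq> mspan R (power_exps p)" using C by blast
  then have p: "\<forall>u\<in>D. total_deg u \<le> p" "\<forall>u\<in>M - D. p \<le> total_deg u"
    using power_subset_cone_iff[OF D(1)] cone_subset_power_iff[OF D(1)] D(3) by auto
  have fin: "finite D"
    by (rule finite_subset[OF _ finite_exps_deg[OF finite_W, of p]]) (use p order_ideal_exps[OF D(1)] in auto)
  have iD: "initial M D" unfolding initial_def
  proof (intro conjI ballI impI)
    show "D \<subseteq> M" using D(1) by (simp add: order_ideal_def)
    fix u v assume uv: "u \<in> D" "v \<in> M" "v \<prec> u"
    show "v \<in> D"
    proof (cases "total_deg v < total_deg u")
      case True
      then have "total_deg v < p" using p(1) uv(1) by fastforce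
      then show ?thesis using p(2) uv(2) by (meson DiffI leD)
    next
      case False
      then show ?thesis using uv D(2) by (auto simp: deglex_less_def lex_lower_def)
    qed
  qed
  have "card D = d"
  proof (cases "d = 0")
    case True
    then have "cone_ideal D = cone_ideal {}" using C D(3) by (simp add: Hilb_def cone_empty)
    then show ?thesis using True cone_eq_iff[OF D(1) order_ideal_empty] by simp
  next
    case False
    then show ?thesis using C D(3) multiplicity_cone[OF D(1) fin] by (simp add: Hilb_def)
  qed
  then have "D = S"
    using initial_card_le[OF iD S(1) fin S(2)] initial_card_le[OF S(1) iD S(2) fin] S(3) by auto
  then show "C = cone_ideal S" using D(3) by simp
qed

section \<open>Which lengths occur\<close>

text \<open>
  Let \<open>b\<close> bound the degrees of the monomials in \<open>M\<close>. Above degree \<open>b\<close>, every monomial that is not zero in \<open>R/I\<close> is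
  divisible by \<open>x\<^sub>z\<close>, so the Hilbert function of \<open>R/I\<close> does not increase any more and becomes constant;
  it is bounded by that of \<open>R\<close>, whose eventual value is the size of \<open>M\<close>.
\<close>

lemma Hilb_le_card:
  assumes M: "finite M" and I: "I \<in> Hilb d R" shows "d \<le> card M"
proof (cases "d = 0")
  case False
  then have id: "ideal I R" and d: "multiplicity_of R I = d" using I by (auto simp: Hilb_def graded_ideal_def)
  interpret A: presentation "quot_alg R I" using id by (rule presentation_quot)
  let ?A = "quot_alg R I" and ?h = "hilbert_fun (quot_alg R I)"
  have V: "vars ?A = insert z W" by (simp add: quot_alg_simps)
  have nz: "m \<in> cyl z M" if "m \<in> exps (insert z W)" "amon ?A m \<noteq> \<zero>\<^bsub>?A\<^esub>" for m
  proof (rule ccontr)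
    assume "m \<notin> cyl z M"
    then have "amon R m = \<zero>\<^bsub>R\<^esub>" using that(1) amon_eq_zero_iff by simp
    then have "proj R (monom_of m) \<in> I"
      using ideal.axioms(1)[OF id] by (simp add: amon_def additive_subgroup.zero_closed)
    then show False
      using that proj_quot_eq_zero_iff[OF id, of "monom_of m"] by (simp add: amon_def monom_of_def)
  qed
  obtain b where b: "\<And>u. u \<in> M \<Longrightarrow> total_deg u \<le> b"
    using finite_nat_set_iff_bounded_le[of "total_deg ` M"] M by auto
  have dec: "?h (Suc t) \<le> ?h t" if "t \<ge> b" for t
  proof (rule A.hilbert_fun_Suc_le[of z])
    show "z \<in> vars ?A" by (simp add: V)
    fix m assume m: "m \<in> exps (vars ?A)" "total_deg m = Suc t" "amon ?A m \<noteq> \<zero>\<^bsub>?A\<^esub>"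
    then have "m \<in> cyl z M" using nz by (simp add: V)
    then obtain u j where u: "m = u + single z j" "u \<in> M" by (auto simp: cyl_def)
    then have "j \<noteq> 0" using b[OF u(2)] m(2) that by auto
    then show "z \<in> keys m" using u(1) by (simp add: in_keys_iff lookup_add)
  qed
  obtain T where T: "T \<ge> b" "\<And>t. t \<ge> b \<Longrightarrow> ?h T \<le> ?h t"
    using ex_has_least_nat[of "\<lambda>t. t \<ge> b" b ?h] by blast
  have "?h t = ?h T" if "t \<ge> T" for t
    using that
  proof (induction t rule: dec_induct)
    case (step t)
    then show ?case using dec[of t] T(1) T(2)[of "Suc t"] by simp
  qed simp
  then have "\<forall>\<^sub>F t in sequentially. ?h t = ?h T"
    unfolding eventually_sequentially by blast
  then have "multiplicity_of R I = ?h T" by (rule multiplicity_ofI)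
  also have "\<dots> \<le> card {m \<in> exps (insert z W). total_deg m = T \<and> amon ?A m \<noteq> \<zero>\<^bsub>?A\<^esub>}"
    using A.hilbert_fun_le_card[of T] by (simp add: V)
  also have "\<dots> \<le> card {m \<in> cyl z M. total_deg m = T}"
  proof (rule card_mono)
    show "finite {m \<in> cyl z M. total_deg m = T}"
      by (rule finite_subset[OF _ finite_deg[of T]]) (use N_subset in auto)
  qed (use nz in auto)
  also have "\<dots> = card {u \<in> M. total_deg u \<le> T}" by (rule card_cyl_deg[OF M_subset z_notin])
  also have "\<dots> \<le> card M" using M by (intro card_mono) auto
  finally show ?thesis using d by simp
qed simp

lemma initial_of_Hilb:
  assumes "Hilb d R \<noteq> {}"
  obtains S where "initial M S" "finite S" "card S = d" "C_ideal d R = cone_ideal S"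
proof -
  have "finite M \<longrightarrow> d \<le> card M" using Hilb_le_card assms by blast
  then obtain S where "initial M S" "finite S" "card S = d"
    using initial_exists[OF finite_W M_subset] by blast
  then show ?thesis using that C_ideal_eq_cone by blast
qed

section \<open>Strongly stable ideals\<close>

text \<open>
  If \<open>x^m x\<^sub>z\<close> is in the ideal, then by strong stability so is \<open>x^m x\<^sub>k\<close> for every variable \<open>x\<^sub>k\<close>, and saturation
  yields \<open>x^m\<close>. This gives the cone form, and \<open>D\<close> is finite because the dimension is one.
\<close>

lemma strongly_stable_Hilb:
  assumes I: "I \<in> Hilb d R" and st: "strongly_stable R I"
  obtains D where "order_ideal D" "finite D" "card D = d" "costable W M D" "I = cone_ideal D"
proof (cases "d = 0")
  case True
  then have "I = cone_ideal {}" using I by (simp add: Hilb_def cone_empty)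
  then show ?thesis using that[of "{}"] True order_ideal_empty by (simp add: costable_def)
next
  case False
  then have sat: "saturated R I" and dim: "krull_dim (R Quot I) = 1" and mult: "multiplicity_of R I = d"
    using I by (auto simp: Hilb_def)
  obtain G where G: "upset (insert z W) G" "I = mspan R G"
    using st monomial_ideal_iff by (auto simp: strongly_stable_def)
  have GV: "G \<subseteq> exps (insert z W)" using G(1) by (simp add: upset_def)
  have inI: "amon R m \<in> I \<longleftrightarrow> m \<in> G \<or> m \<notin> cyl z M" if "m \<in> exps (insert z W)" for m
    using amon_in_mspan_iff[of m G] that GV G(2) by simp
  have id: "ideal I R" using G ideal_mspan by simp
  interpret I: ideal I R by (rule id)
  have stab: "m + unitv k \<in> G"
    if "m \<in> exps (insert z W)" "h \<in> insert z W" "k \<in> insert z W" "k < h"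
      "m + unitv h \<in> G" "m + unitv h \<in> cyl z M" "m + unitv k \<in> cyl z M" for m h k
  proof -
    have "amon R (m + unitv h) \<noteq> \<zero>\<^bsub>R\<^esub>" using amon_eq_zero_iff that by simp
    moreover have "amon R (m + unitv h) \<in> I" using inI that by simp
    moreover have "\<forall>m\<in>exps (vars R). \<forall>h\<in>vars R. \<forall>k\<in>vars R. k < h \<longrightarrow> amon R (m + unitv h) \<in> I \<longrightarrow>
        amon R (m + unitv h) \<noteq> \<zero>\<^bsub>R\<^esub> \<longrightarrow> amon R (m + unitv k) \<in> I"
      using st unfolding strongly_stable_def by (rule conjunct2)
    ultimately have "amon R (m + unitv k) \<in> I" using that(1-4) unfolding vars_R by blast
    then show ?thesis using inI that by simp
  qed
  have cancel: "m \<in> G" if m: "m \<in> cyl z M" "m + unitv z \<in> G" for m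
  proof -
    have mV: "m \<in> exps (insert z W)" using m(1) cyl_subset_exps[OF M_subset] by auto
    obtain u j where u: "m = u + single z j" "u \<in> M" using m(1) by (auto simp: cyl_def)
    have "m + unitv z = u + single z (Suc j)" using u by (simp add: add.assoc single_add[symmetric])
    then have mz: "m + unitv z \<in> cyl z M" using u(2) by (auto simp: cyl_def)
    have av: "avar R ` vars R \<subseteq> carrier R" using avar_closed by auto
    have am: "amon R m \<in> carrier R" using amon_closed mV by simp
    have gen: "amon R m \<otimes>\<^bsub>R\<^esub> avar R k \<in> I" if k: "k \<in> vars R" for k
    proof -
      have "amon R m \<otimes>\<^bsub>R\<^esub> avar R k = amon R (m + unitv k)"
        using mV k by (simp add: amon_add) (simp add: amon_def avar_def X_def)
      moreover have "m + unitv k \<in> G \<or> m + unitv k \<notin> cyl z M"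
      proof (cases "k = z")
        case True then show ?thesis using m(2) by simp
      next
        case False
        then have "k < z" using k W_less by auto
        then show ?thesis using stab[of m z k] mV k m(2) mz by auto
      qed
      ultimately show ?thesis using inI mV k by simp
    qed
    \<comment> \<open>It suffices to test the condition of the colon ideal on the variables, which generate.\<close>
    have "ideal {g \<in> carrier R. amon R m \<otimes>\<^bsub>R\<^esub> g \<in> I} R"
    proof (rule idealI)
      show "ring R" by (rule ring_axioms)
      show "subgroup {g \<in> carrier R. amon R m \<otimes>\<^bsub>R\<^esub> g \<in> I} (add_monoid R)"
        using am by (intro add.subgroupI) (auto simp: r_distr r_minus intro: exI[of _ "\<zero>\<^bsub>R\<^esub>"])
      fix a x assume a: "a \<in> {g \<in> carrier R. amon R m \<otimes>\<^bsub>R\<^esub> g \<in> I}" and x: "x \<in> carrier R"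
      then have "(amon R m \<otimes>\<^bsub>R\<^esub> a) \<otimes>\<^bsub>R\<^esub> x \<in> I" by (blast intro: I.I_r_closed)
      moreover have "(amon R m \<otimes>\<^bsub>R\<^esub> a) \<otimes>\<^bsub>R\<^esub> x = amon R m \<otimes>\<^bsub>R\<^esub> (a \<otimes>\<^bsub>R\<^esub> x)"
        using a x am by (intro m_assoc) auto
      moreover have "a \<otimes>\<^bsub>R\<^esub> x \<in> carrier R" using a x by simp
      ultimately show "a \<otimes>\<^bsub>R\<^esub> x \<in> {g \<in> carrier R. amon R m \<otimes>\<^bsub>R\<^esub> g \<in> I}"
        by (simp only: mem_Collect_eq)
      then show "x \<otimes>\<^bsub>R\<^esub> a \<in> {g \<in> carrier R. amon R m \<otimes>\<^bsub>R\<^esub> g \<in> I}"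
        using a x by (simp add: m_comm)
    qed
    then have "max_ideal R \<subseteq> {g \<in> carrier R. amon R m \<otimes>\<^bsub>R\<^esub> g \<in> I}"
      unfolding max_ideal_def using gen av by (intro genideal_minimal) auto
    then have "amon R m \<in> ideal_colon R I (max_ideal R)" using am by (auto simp: ideal_colon_def)
    then have "amon R m \<in> I" using sat by (simp add: saturated_def)
    then show ?thesis using inI mV m(1) by simp
  qed
  note cone = mspan_eq_cone_ideal[OF G(1) cancel]
  let ?D = "M - G"
  have ID: "I = cone_ideal ?D" using cone G(2) by simp
  have fin: "finite ?D" using krull_dim_cone_infinite[OF cone(1)] dim ID by auto
  have card: "card ?D = d" using multiplicity_cone[OF cone(1) fin] mult ID by simp
  have "costable W M ?D" unfolding costable_def
  proof (intro allI impI ballI)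
    fix m k h assume *: "k \<in> W" "h \<in> W" "k < h" "m + unitv k \<in> ?D" "m + unitv h \<in> M"
    have inM: "u \<in> cyl z M" if "u \<in> M" for u
    proof -
      have "u \<in> exps W" using that M_subset by blast
      then show ?thesis using that in_cyl_iff[OF M_subset z_notin exps_lookup_zero[OF _ z_notin]] by blast
    qed
    have "m \<in> M" using *(5) divisor_closedD[OF divisor_closed_box] by blast
    then have "m \<in> exps (insert z W)" using M_subset by (auto simp: exps_iff)
    then show "m + unitv h \<in> ?D" using stab[of m h k] * inM by auto
  qed
  then show ?thesis using that[OF cone(1) fin card _ ID] by blast
qed

section \<open>Multiplication by the variables\<close>

lemma order_ideal_envelope:
  assumes D: "order_ideal D" shows "order_ideal (envelope M D)"
  unfolding order_ideal_def divisor_closed_def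
proof (intro conjI allI impI)
  show "envelope M D \<subseteq> M" by (auto simp: envelope_def)
  fix x y assume xy: "x + y \<in> envelope M D"
  have "v \<in> D" if "x = v + unitv i" for v i
  proof -
    have "x + y = (v + y) + unitv i" using that by (simp add: ac_simps)
    then have "v + y \<in> D" using xy by (auto simp: envelope_def)
    then show ?thesis using D divisor_closedD by (auto simp: order_ideal_def)
  qed
  moreover have "x \<in> M" using xy divisor_closedD[OF divisor_closed_box] by (auto simp: envelope_def)
  ultimately show "x \<in> envelope M D" by (auto simp: envelope_def)
qed

text \<open>
  A monomial in the product is a variable of \<open>W\<close> times a monomial of the ideal, so its part in the
  variables \<open>W\<close> has a quotient by one of them that is not in \<open>D\<close>.
\<close>

lemma nonlast_ideal_mult_cone:
  assumes D: "order_ideal D"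
  shows "nonlast_ideal R \<cdot>\<^bsub>R\<^esub> cone_ideal D = cone_ideal (envelope M D)"
proof -
  let ?H = "exps (insert z W) - cyl z D"
  let ?P = "{g + h | g h. g \<in> power_exps 1 \<and> h \<in> ?H}"
  have oe: "order_ideal (envelope M D)" using D by (rule order_ideal_envelope)
  have zero: "lookup u z = 0" if "u \<in> M" for u
    using that M_subset z_notin by (auto intro: exps_lookup_zero)
  have key: "u + single z j \<in> ?P \<longleftrightarrow> u \<notin> envelope M D" if u: "u \<in> M" for u j
  proof
    assume "u + single z j \<in> ?P"
    then obtain g h where gh: "u + single z j = g + h" "g \<in> power_exps 1" "h \<in> ?H" by blast
    obtain g' a where g': "g = g' + single z a" "g' \<in> exps W" "lookup g' z = 0"
      using exps_insert_split[of g z W] gh(2) z_notin by (auto simp: power_exps_def)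
    obtain h' c where h': "h = h' + single z c" "h' \<in> exps W" "lookup h' z = 0"
      using exps_insert_split[of h z W] gh(3) z_notin by auto
    have "j = a + c" using arg_cong[OF gh(1), of "\<lambda>m. lookup m z"] g' h' zero[OF u] by (simp add: lookup_add)
    then have "u + single z j = (g' + h') + single z j"
      using gh(1) g'(1) h'(1) by (simp add: single_add ac_simps)
    then have ugh: "u = g' + h'" by simp
    have "g' \<noteq> 0" using gh(2) g' by (auto simp: power_exps_def lookup_add)
    then obtain i where "i \<in> keys g'" by (metis all_not_in_conv keys_eq_empty)
    then obtain g'' where g'': "g' = g'' + unitv i" by (rule exponent_split_unitv)
    show "u \<notin> envelope M D"
    proof
      assume "u \<in> envelope M D"
      moreover have "u = (g'' + h') + unitv i" using ugh g'' by (simp add: ac_simps)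
      ultimately have "g'' + h' \<in> D" by (auto simp: envelope_def)
      then have "h' \<in> D" using D divisor_closedD2 by (auto simp: order_ideal_def)
      then show False using gh(3) h'(1) by (auto simp: cyl_def)
    qed
  next
    assume "u \<notin> envelope M D"
    then obtain v i where v: "u = v + unitv i" "v \<notin> D" using u by (auto simp: envelope_def)
    have uW: "u \<in> exps W" using u M_subset by auto
    then have iW: "i \<in> W" "v \<in> exps W" using v(1) by auto
    have "u + single z j = unitv i + (v + single z j)" using v by (simp add: ac_simps)
    moreover have "unitv i \<in> power_exps 1"
      using iW z_notin by (auto simp: power_exps_def lookup_single when_def)
    moreover have "v + single z j \<notin> cyl z D"
      using add_single_in_cyl_iff[OF order_ideal_exps[OF D] z_notin exps_lookup_zero[OF iW(2) z_notin]] v(2) by simp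
    moreover have "v + single z j \<in> exps (insert z W)" using iW(2) by (auto simp: exps_iff lookup_add lookup_single when_def)
    ultimately show "u + single z j \<in> ?P" by blast
  qed
  have "nonlast_ideal R \<cdot>\<^bsub>R\<^esub> cone_ideal D = mspan R ?P"
    unfolding nonlast_ideal_eq cone_ideal_def
    using upset_power_exps upset_cone[OF D] by (intro ideal_prod_mspan) auto
  also have "\<dots> = cone_ideal (envelope M D)"
    unfolding cone_ideal_def
  proof (subst mspan_eq_iff)
    show "?P \<inter> cyl z M = (exps (insert z W) - cyl z (envelope M D)) \<inter> cyl z M"
    proof (rule Set.set_eqI)
      fix m
      show "m \<in> ?P \<inter> cyl z M \<longleftrightarrow> m \<in> (exps (insert z W) - cyl z (envelope M D)) \<inter> cyl z M"
      proof (cases "m \<in> cyl z M")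
        case True
        then obtain u j where u: "m = u + single z j" "u \<in> M" by (auto simp: cyl_def)
        have "m \<in> cyl z (envelope M D) \<longleftrightarrow> u \<in> envelope M D"
          using add_single_in_cyl_iff[OF order_ideal_exps[OF oe] z_notin zero[OF u(2)]] u(1) by simp
        moreover have "m \<in> exps (insert z W)" using True cyl_subset_exps[OF M_subset] by auto
        ultimately show ?thesis using True u key[OF u(2), of j] by simp
      qed simp
    qed
  qed (auto simp: power_exps_def)
  finally show ?thesis .
qed

end

section \<open>Components\<close>

lemma X_power: "X y ^ l = (single (single y l) 1 :: 'k::field mpoly)"
  by (induction l) (simp_all add: X_def monom_of_def mult_single single_add[symmetric])

lemma lookup_mult_X_power:
  fixes q :: "'k::field mpoly"
  assumes "keys q \<subseteq> exps V" "y \<notin> V" "lookup u y = 0"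
  shows "lookup (q * X y ^ l) (u + single y l') = (if l = l' then lookup q u else 0)"
proof (cases "l = l'")
  case True
  then show ?thesis by (simp add: X_power lookup_mult_single)
next
  case False
  have "u + single y l' \<notin> keys (q * X y ^ l)"
  proof
    assume "u + single y l' \<in> keys (q * X y ^ l)"
    then obtain m where m: "m \<in> keys q" "u + single y l' = m + single y l"
      using keys_mult[of q "X y ^ l"] by (auto simp: X_power)
    have "lookup m y = 0" using m(1) assms by (auto intro: exps_lookup_zero)
    then show False using arg_cong[OF m(2), of "\<lambda>m. lookup m y"] assms(3) False by (simp add: lookup_add)
  qed
  then show ?thesis using False by (simp add: in_keys_iff)
qed

text \<open>
  The polynomials \<open>q l\<close> do not involve \<open>x\<^sub>y\<close>, so they are the coefficients of a polynomial in \<open>x\<^sub>y\<close>.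
\<close>

lemma lookup_sum_X_powers:
  fixes q :: "nat \<Rightarrow> 'k::field mpoly"
  assumes "finite S" "\<And>l. l \<in> S \<Longrightarrow> keys (q l) \<subseteq> exps V" "y \<notin> V" "lookup u y = 0"
  shows "lookup (\<Sum>l\<in>S. q l * X y ^ l) (u + single y l) = (if l \<in> S then lookup (q l) u else 0)"
proof -
  have "lookup (\<Sum>l\<in>S. q l * X y ^ l) (u + single y l) = (\<Sum>l'\<in>S. if l' = l then lookup (q l') u else 0)"
    unfolding lookup_sum using lookup_mult_X_power[OF assms(2) assms(3,4)] by (intro sum.cong) auto
  then show ?thesis using assms(1) by simp
qed

lemma divide_by_X_power:
  fixes r :: "'k::field mpoly"
  assumes "\<And>m. m \<in> keys r \<Longrightarrow> lookup m y = l"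
  obtains q where "r = q * X y ^ l"
proof
  have "m - single y l + single y l = m" if "m \<in> keys r" for m
    using assms[OF that] by (intro poly_mapping_eqI) (auto simp: lookup_add lookup_minus lookup_single when_def)
  then show "r = (\<Sum>m\<in>keys r. single (m - single y l) (lookup r m)) * X y ^ l"
    by (subst poly_sum_monomials) (simp add: X_power sum_distrib_right mult_single)
qed

text \<open>
  The algebra \<open>A\<close> has the additional variable \<open>x\<^sub>y\<close>, truncated at the exponent \<open>b\<close>, so that \<open>A\<close> is the
  direct sum of the \<open>B x\<^sub>y^l\<close> with \<open>l < b\<close>.
\<close>

locale component_algebras = A: monomial_algebra A NA + B: monomial_algebra B NB
  for A :: "('k::field, 'a) galg" and NA and B :: "('k, 'b) galg" and NB +
  fixes y :: nat and b :: enat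
  assumes vars_A: "vars A = insert y (vars B)" and y_notin: "y \<notin> vars B"
    and NA_iff: "\<And>u l. u \<in> exps (vars B) \<Longrightarrow> u + single y l \<in> NA \<longleftrightarrow> u \<in> NB \<and> enat l < b"
begin

lemma exps_mono: "u \<in> exps (vars B) \<Longrightarrow> u \<in> exps (vars A)"
  by (simp add: vars_A exps_iff)

lemma keys_mult_X_power:
  assumes "keys q \<subseteq> exps (vars B)" shows "keys (q * X y ^ l) \<subseteq> exps (vars A)"
  using assms exps_mono by (intro keys_mult_exps) (auto simp: X_power vars_A)

lemma shifted_finsum:
  assumes "finite S" "g \<in> Pi S (\<lambda>l. shifted A B y (F l) l)"
  obtains q where "\<forall>l\<in>S. keys (q l) \<subseteq> exps (vars B)" "\<forall>l\<in>S. proj B (q l) \<in> F l"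
    "\<forall>l\<in>S. g l = proj A (q l * X y ^ l)" "finsum A g S = proj A (\<Sum>l\<in>S. q l * X y ^ l)"
proof -
  have "\<forall>l\<in>S. \<exists>p. keys p \<subseteq> exps (vars B) \<and> proj B p \<in> F l \<and> g l = proj A (p * X y ^ l)"
    using assms(2) by (auto simp: shifted_def Pi_iff)
  from bchoice[OF this] obtain q where q: "\<And>l. l \<in> S \<Longrightarrow>
      keys (q l) \<subseteq> exps (vars B) \<and> proj B (q l) \<in> F l \<and> g l = proj A (q l * X y ^ l)" by blast
  have "finsum A g S = finsum A (\<lambda>l. proj A (q l * X y ^ l)) S"
    using q A.proj_closed[OF keys_mult_X_power] by (intro A.finsum_cong') auto
  also have "\<dots> = proj A (\<Sum>l\<in>S. q l * X y ^ l)"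
    using q by (intro A.proj_finsum[OF assms(1)] keys_mult_X_power) blast
  finally show ?thesis using that[of q] q by blast
qed

lemma keys_sum_X_powers:
  assumes "finite S" "\<And>l. l \<in> S \<Longrightarrow> keys (q l) \<subseteq> exps (vars B)"
  shows "keys (\<Sum>l\<in>S. q l * X y ^ l) \<subseteq> exps (vars A)"
  by (intro keys_sum_subset keys_mult_X_power assms(2))

text \<open>
  A representing polynomial is split by the exponents of \<open>x\<^sub>y\<close>; the parts have no monomials in common.
\<close>

lemma internal_direct_sum_components:
  assumes G: "upset (vars A) G"
  shows "internal_direct_sum A {l. enat l < b}
    (\<lambda>l. shifted A B y (mspan B {u \<in> exps (vars B). u + single y l \<in> G}) l) (mspan A G)"
    (is "internal_direct_sum A ?L (\<lambda>l. shifted A B y (?F l) l) _")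
  unfolding internal_direct_sum_def
proof (intro conjI equalityI subsetI allI impI)
  have GV: "G \<subseteq> exps (vars A)" using G by (simp add: upset_def)
  have inF: "proj B p \<in> ?F l \<longleftrightarrow> (\<forall>u\<in>keys p \<inter> NB. u + single y l \<in> G)" if "keys p \<subseteq> exps (vars B)" for p l
    using that by (subst B.proj_in_mspan_iff) auto
  {
    fix f assume f: "f \<in> mspan A G"
    then obtain p0 where p0: "f = proj A p0" "keys p0 \<subseteq> G" by (auto simp: mspan_def)
    define p where "p = restr NA p0"
    have p: "f = proj A p" "keys p \<subseteq> G" "keys p \<subseteq> NA"
      using p0 GV by (auto simp: p_def A.proj_eq_iff subset_iff)
    define S where "S = (\<lambda>m. lookup m y) ` keys p"
    define r where "r l = restr {m. lookup m y = l} p" for l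
    have S: "finite S" by (simp add: S_def)
    have pr: "p = (\<Sum>l\<in>S. r l)"
      using S by (intro poly_mapping_eqI) (auto simp: lookup_sum r_def S_def in_keys_iff)
    have "\<exists>q. keys q \<subseteq> exps (vars B) \<and> proj B q \<in> ?F l \<and> r l = q * X y ^ l" for l
    proof -
      obtain q where q: "r l = q * X y ^ l"
        using divide_by_X_power[of "r l" y l] by (auto simp: r_def)
      have lq: "lookup q u = lookup (r l) (u + single y l)" for u
        unfolding q by (simp add: X_power lookup_mult_single)
      have "u + single y l \<in> G \<and> u \<in> exps (vars B)" if "u \<in> keys q" for u
      proof -
        have "u + single y l \<in> keys (r l)" using lq that by (simp add: in_keys_iff)
        then have m: "u + single y l \<in> G" "lookup u y = 0" using p(2) by (auto simp: r_def lookup_add)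
        then have "u \<in> exps (vars A)" using GV by auto
        then show ?thesis using m by (auto simp: vars_A exps_iff) metis
      qed
      then have kq: "keys q \<subseteq> exps (vars B)" and "\<forall>u\<in>keys q \<inter> NB. u + single y l \<in> G" by blast+
      then have "proj B q \<in> ?F l" using inF[OF kq] by blast
      with kq show ?thesis using q by blast
    qed
    then have "\<forall>l. \<exists>q. keys q \<subseteq> exps (vars B) \<and> proj B q \<in> ?F l \<and> r l = q * X y ^ l" by blast
    from choice[OF this] obtain q where "\<forall>l. keys (q l) \<subseteq> exps (vars B) \<and> proj B (q l) \<in> ?F l \<and>
      r l = q l * X y ^ l" by blast
    then have q: "keys (q l) \<subseteq> exps (vars B)" "proj B (q l) \<in> ?F l" "r l = q l * X y ^ l" for l by simp_all
    have "S \<subseteq> ?L"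
    proof
      fix l assume "l \<in> S"
      then obtain m where m: "m \<in> keys p" "lookup m y = l" by (auto simp: S_def)
      obtain u where u: "m = u + single y (lookup m y)" "lookup u y = 0" by (rule exponent_split_at)
      have "u \<in> exps (vars A)" using m p(2) GV u(1) by (metis exps_add subsetD)
      then have "u \<in> exps (vars B)" using u(2) by (auto simp: vars_A exps_iff) metis
      then show "l \<in> ?L" using NA_iff[of u l] m p(3) u(1) by auto
    qed
    moreover have "(\<lambda>l. proj A (r l)) \<in> Pi S (\<lambda>l. shifted A B y (?F l) l)"
      using q by (auto simp: shifted_def)
    moreover have "finsum A (\<lambda>l. proj A (r l)) S = f"
    proof -
      have "keys (r l) \<subseteq> exps (vars A)" for l using p(2) GV by (auto simp: r_def)
      then have "finsum A (\<lambda>l. proj A (r l)) S = proj A (\<Sum>l\<in>S. r l)" by (intro A.proj_finsum[OF S])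
      then show ?thesis unfolding p(1) pr[symmetric] .
    qed
    ultimately show "f \<in> {finsum A g S | g S. finite S \<and> S \<subseteq> ?L \<and> g \<in> Pi S (\<lambda>l. shifted A B y (?F l) l)}"
      using S by blast
  }
  {
    fix f assume "f \<in> {finsum A g S | g S. finite S \<and> S \<subseteq> ?L \<and> g \<in> Pi S (\<lambda>l. shifted A B y (?F l) l)}"
    then obtain g S where g: "f = finsum A g S" "finite S" "g \<in> Pi S (\<lambda>l. shifted A B y (?F l) l)" by blast
    obtain q where q0: "\<forall>l\<in>S. keys (q l) \<subseteq> exps (vars B)" "\<forall>l\<in>S. proj B (q l) \<in> ?F l"
      "\<forall>l\<in>S. g l = proj A (q l * X y ^ l)" "finsum A g S = proj A (\<Sum>l\<in>S. q l * X y ^ l)"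
      by (rule shifted_finsum[OF g(2,3)])
    note q = q0(1-3)[rule_format] q0(4)
    have "m \<in> G" if m: "m \<in> keys (\<Sum>l\<in>S. q l * X y ^ l)" "m \<in> NA" for m
    proof -
      obtain u l where u: "m = u + single y l" "u \<in> exps (vars B)" "lookup u y = 0"
        using exps_insert_split[of m y "vars B"] m(2) A.N_subset vars_A y_notin by auto
      have "l \<in> S" "u \<in> keys (q l)"
        using lookup_sum_X_powers[where q = q, OF g(2) q(1) y_notin u(3), of l] m(1) u(1) by (auto simp: in_keys_iff split: if_splits)
      moreover have "u \<in> NB" using NA_iff u m(2) by auto
      ultimately show ?thesis using q(2)[of l] inF[OF q(1)] u(1) by auto
    qed
    then show "f \<in> mspan A G"
      using keys_sum_X_powers[where q = q, OF g(2) q(1)] GV q(4) g(1) by (auto simp: A.proj_in_mspan_iff)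
  }
  fix g S l
  assume g: "finite S \<and> S \<subseteq> ?L \<and> g \<in> Pi S (\<lambda>l. shifted A B y (?F l) l) \<and> finsum A g S = \<zero>\<^bsub>A\<^esub>"
  then have fin: "finite S" by blast
  show "\<forall>l\<in>S. g l = \<zero>\<^bsub>A\<^esub>"
  proof
    fix l assume l: "l \<in> S"
    have "g \<in> Pi S (\<lambda>l. shifted A B y (?F l) l)" using g by blast
    then obtain q where q0: "\<forall>l\<in>S. keys (q l) \<subseteq> exps (vars B)" "\<forall>l\<in>S. proj B (q l) \<in> ?F l"
      "\<forall>l\<in>S. g l = proj A (q l * X y ^ l)" "finsum A g S = proj A (\<Sum>l\<in>S. q l * X y ^ l)"
      by (rule shifted_finsum[OF fin])
    note q = q0(1-3)[rule_format] q0(4)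
    have zero: "keys (\<Sum>l\<in>S. q l * X y ^ l) \<inter> NA = {}"
      using q(4) g A.proj_eq_zero_iff[OF keys_sum_X_powers[where q = q, OF fin q(1)]] by simp
    have "keys (q l * X y ^ l) \<inter> NA = {}"
    proof (rule ccontr)
      assume "keys (q l * X y ^ l) \<inter> NA \<noteq> {}"
      then obtain m where m: "m \<in> keys (q l * X y ^ l)" "m \<in> NA" by blast
      obtain u l' where u: "m = u + single y l'" "u \<in> exps (vars B)" "lookup u y = 0"
        using exps_insert_split[of m y "vars B"] m(2) A.N_subset vars_A y_notin by auto
      have "l' = l" "lookup (q l) u \<noteq> 0"
        using lookup_mult_X_power[OF q(1)[OF l] y_notin u(3), of l l'] m(1) u(1)
        by (auto simp: in_keys_iff split: if_splits)
      then have "m \<in> keys (\<Sum>l\<in>S. q l * X y ^ l)"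
        using lookup_sum_X_powers[where q = q, OF fin q(1) y_notin u(3), of l] l u(1) by (simp add: in_keys_iff)
      with zero m(2) show False by blast
    qed
    then show "g l = \<zero>\<^bsub>A\<^esub>"
      using q(3)[OF l] A.proj_eq_zero_iff[OF keys_mult_X_power[OF q(1)[OF l]]] by simp
  qed
qed

text \<open>
  Monomial ideals are determined by their monomials, and \<open>x^u\<close> lies in the component \<open>F l\<close> iff \<open>x^u x\<^sub>y^l\<close>
  lies in the sum: the coefficient of \<open>x^u x\<^sub>y^l\<close> in an element of the sum comes from the summand with
  index \<open>l\<close>.
\<close>

lemma components_unique:
  assumes G: "upset (vars A) G" and H: "upset (vars B) H" and l: "enat l < b" and Fl: "F l = mspan B H"
    and sum: "internal_direct_sum A {l. enat l < b} (\<lambda>l. shifted A B y (F l) l) (mspan A G)"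
  shows "F l = mspan B {u \<in> exps (vars B). u + single y l \<in> G}"
proof -
  have GV: "G \<subseteq> exps (vars A)" "H \<subseteq> exps (vars B)" using G H by (auto simp: upset_def)
  have I: "mspan A G = {finsum A g S | g S. finite S \<and> S \<subseteq> {l. enat l < b} \<and> g \<in> Pi S (\<lambda>l. shifted A B y (F l) l)}"
    using sum by (simp add: internal_direct_sum_def)
  have "u \<in> H \<longleftrightarrow> u + single y l \<in> G" if u: "u \<in> NB" for u
  proof -
    have uV: "u \<in> exps (vars B)" using u B.N_subset by blast
    have uy: "lookup u y = 0" using uV y_notin by (rule exps_lookup_zero)
    have uA: "u + single y l \<in> NA" using NA_iff[OF uV] u l by simp
    then have uAV: "u + single y l \<in> exps (vars A)" using A.N_subset by blast
    show ?thesis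
    proof
      assume "u \<in> H"
      then have "proj B (monom_of u) \<in> F l" using B.amon_in_mspan[of u H] Fl by (simp add: amon_def)
      then have "proj A (monom_of u * X y ^ l) \<in> shifted A B y (F l) l"
        using uV unfolding shifted_def by (auto simp: monom_of_def)
      moreover have "monom_of u * X y ^ l = (monom_of (u + single y l) :: 'k mpoly)"
        by (simp add: monom_of_def X_power mult_single)
      ultimately have x: "amon A (u + single y l) \<in> shifted A B y (F l) l" by (simp add: amon_def)
      have "finsum A (\<lambda>_. amon A (u + single y l)) {l} = amon A (u + single y l)"
        using A.amon_closed[OF uAV] by simp
      then have "amon A (u + single y l) \<in> mspan A G"
        unfolding I using x l by (intro CollectI exI[of _ "\<lambda>_. amon A (u + single y l)"] exI[of _ "{l}"]) auto
      then show "u + single y l \<in> G" using A.amon_in_mspan_iff[OF uAV GV(1)] uA by simp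
    next
      assume "u + single y l \<in> G"
      then have "amon A (u + single y l) \<in> mspan A G" by (rule A.amon_in_mspan)
      then obtain g S where g: "amon A (u + single y l) = finsum A g S" "finite S"
        "g \<in> Pi S (\<lambda>l. shifted A B y (F l) l)" unfolding I by blast
      obtain q where q0: "\<forall>l\<in>S. keys (q l) \<subseteq> exps (vars B)" "\<forall>l\<in>S. proj B (q l) \<in> F l"
      "\<forall>l\<in>S. g l = proj A (q l * X y ^ l)" "finsum A g S = proj A (\<Sum>l\<in>S. q l * X y ^ l)"
      by (rule shifted_finsum[OF g(2,3)])
    note q = q0(1-3)[rule_format] q0(4)
      have "proj A (monom_of (u + single y l)) = proj A (\<Sum>l\<in>S. q l * X y ^ l)"
        using g(1) q(4) by (simp add: amon_def)
      moreover have "keys (monom_of (u + single y l) :: 'k mpoly) \<subseteq> exps (vars A)"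
        using uAV by (simp add: monom_of_def)
      ultimately have "\<forall>m\<in>NA. lookup (monom_of (u + single y l)) m = lookup (\<Sum>l\<in>S. q l * X y ^ l) m"
        using A.proj_eq_iff keys_sum_X_powers[where q = q, OF g(2) q(1)] by blast
      then have "lookup (monom_of (u + single y l)) (u + single y l)
          = lookup (\<Sum>l\<in>S. q l * X y ^ l) (u + single y l)" using uA by (rule bspec)
      then have "lookup (\<Sum>l\<in>S. q l * X y ^ l) (u + single y l) = 1" by (simp add: monom_of_def)
      then have "l \<in> S" "lookup (q l) u = 1"
        using lookup_sum_X_powers[where q = q, OF g(2) q(1) y_notin uy, of l] by (auto split: if_splits)
      then have "u \<in> keys (q l) \<inter> NB" "keys (q l) \<inter> NB \<subseteq> H"
        using u q(1,2)[of l] Fl B.proj_in_mspan_iff[OF q(1) GV(2)] by (auto simp: in_keys_iff)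
      then show "u \<in> H" by blast
    qed
  qed
  then show ?thesis unfolding Fl using GV B.N_subset by (subst B.mspan_eq_iff) auto
qed

lemma components_mspan:
  assumes G: "upset (vars A) G"
  shows "components A B y b (mspan A G)
    = (\<lambda>l. if enat l < b then mspan B {u \<in> exps (vars B). u + single y l \<in> G} else {})"
  unfolding components_def
proof (rule the_equality)
  let ?H = "\<lambda>l. {u \<in> exps (vars B). u + single y l \<in> G}"
  let ?F = "\<lambda>l. if enat l < b then mspan B (?H l) else {}"
  have upH: "upset (vars B) (?H l)" for l
    unfolding upset_def
  proof (intro conjI ballI)
    fix m m' assume m: "m \<in> ?H l" "m' \<in> exps (vars B)"
    then have "(m + single y l) + m' \<in> G" using G exps_mono by (auto simp: upset_def)
    then show "m + m' \<in> ?H l" using m by (simp add: ac_simps)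
  qed auto
  have "internal_direct_sum A {l. enat l < b} (\<lambda>l. shifted A B y (?F l) l) (mspan A G)"
  proof -
    have "(Pi S (\<lambda>l. shifted A B y (?F l) l)) = (Pi S (\<lambda>l. shifted A B y (mspan B (?H l)) l))"
      if "S \<subseteq> {l. enat l < b}" for S
    proof -
      have eq: "shifted A B y (?F l) l = shifted A B y (mspan B (?H l)) l" if "l \<in> S" for l
        using that \<open>S \<subseteq> {l. enat l < b}\<close> by auto
      show ?thesis
        unfolding Pi_def by (intro Collect_cong all_cong1 imp_cong refl) (simp only: eq)
    qed
    then show ?thesis
      using internal_direct_sum_components[OF G] unfolding internal_direct_sum_def
      by (simp cong: conj_cong)
  qed
  then show "(\<forall>l. enat l < b \<longrightarrow> monomial_ideal B (?F l)) \<and> (\<forall>l. \<not> enat l < b \<longrightarrow> ?F l = {}) \<and>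
      internal_direct_sum A {l. enat l < b} (\<lambda>l. shifted A B y (?F l) l) (mspan A G)"
    using upH B.monomial_ideal_iff by auto
  fix F assume F: "(\<forall>l. enat l < b \<longrightarrow> monomial_ideal B (F l)) \<and> (\<forall>l. \<not> enat l < b \<longrightarrow> F l = {}) \<and>
      internal_direct_sum A {l. enat l < b} (\<lambda>l. shifted A B y (F l) l) (mspan A G)"
  show "F = ?F"
  proof
    fix l
    show "F l = ?F l"
    proof (cases "enat l < b")
      case True
      then have "monomial_ideal B (F l)" using F by blast
      then obtain H where H: "upset (vars B) H" "F l = mspan B H" unfolding B.monomial_ideal_iff by blast
      have "internal_direct_sum A {l. enat l < b} (\<lambda>l. shifted A B y (F l) l) (mspan A G)"
        using F by (elim conjE)
      then have "F l = mspan B (?H l)" by (rule components_unique[of G H l F, OF G H(1) True H(2)])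
      then show ?thesis using True by simp
    next
      case False
      then show ?thesis using F by simp
    qed
  qed
qed

end

text \<open>
  Slices in the direction of \<open>x\<^sub>y\<close> commute with the passage from \<open>D\<close> to the monomials \<open>x^u x\<^sub>z^j\<close> with
  \<open>u \<in> D\<close>.
\<close>

lemma components_cone:
  assumes A: "truncated_algebra (insert y W) z e R" and B: "truncated_algebra W z e Rbar"
    and y: "y \<notin> W" and D: "truncated_algebra.order_ideal (insert y W) e D" and l: "enat l < e y"
  shows "components R Rbar y (e y) (truncated_algebra.cone_ideal (insert y W) z R D) l
    = truncated_algebra.cone_ideal W z Rbar (slice y l D)"
proof -
  interpret A: truncated_algebra "insert y W" z e R by (rule A)
  interpret B: truncated_algebra W z e Rbar by (rule B)
  have yz: "y \<noteq> z" using A.z_notin by auto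
  have zW: "z \<notin> W" using B.z_notin .
  have box: "v + single y l \<in> box (insert y W) e \<longleftrightarrow> v \<in> box W e \<and> enat l < e y" if v: "v \<in> exps W" for v l
  proof -
    have vy: "lookup v y = 0" using v y by (rule exps_lookup_zero)
    show ?thesis
    proof (cases "enat l < e y")
      case True
      then show ?thesis using slice_box[of y W l e, OF y True] vy by (auto simp: slice_def)
    next
      case False
      then show ?thesis using vy by (auto simp: box_def lookup_add)
    qed
  qed
  have cyl_iff: "u + single y l \<in> cyl z E \<longleftrightarrow> u \<in> cyl z (slice y l E)"
    if E: "E \<subseteq> exps (insert y W)" and u: "u \<in> exps (insert z W)" for u l E
  proof -
    obtain v j where v: "u = v + single z j" "v \<in> exps W" "lookup v z = 0"
      using exps_insert_split[OF u zW] .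
    have vy: "lookup v y = 0" using v(2) y by (rule exps_lookup_zero)
    have "slice y l E \<subseteq> exps W"
    proof
      fix x assume "x \<in> slice y l E"
      then have "x + single y l \<in> exps (insert y W)" "lookup x y = 0" using E by (auto simp: slice_def)
      then have "x \<in> exps (insert y W)" by simp
      then show "x \<in> exps W" using \<open>lookup x y = 0\<close> by (auto simp: exps_iff) metis
    qed
    then have "u \<in> cyl z (slice y l E) \<longleftrightarrow> v + single y l \<in> E"
      unfolding v(1) using add_single_in_cyl_iff[OF _ zW v(3)] vy by (simp add: slice_def)
    moreover have "u + single y l = (v + single y l) + single z j" using v by (simp add: ac_simps)
    moreover have "lookup (v + single y l) z = 0" using v(3) yz by (simp add: lookup_add lookup_single)
    ultimately show ?thesis using add_single_in_cyl_iff[OF E A.z_notin] by simp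
  qed
  interpret component_algebras R "cyl z A.M" Rbar "cyl z B.M" y "e y"
  proof
    show "vars R = insert y (vars Rbar)" by auto
    show "y \<notin> vars Rbar" using y yz by simp
    fix u l assume u: "u \<in> exps (vars Rbar)"
    have "slice y l A.M = (if enat l < e y then B.M else {})"
      using slice_box[of y W l e, OF y] slice_box_empty[of l e y A.M W] by auto
    then show "u + single y l \<in> cyl z A.M \<longleftrightarrow> u \<in> cyl z B.M \<and> enat l < e y"
      using cyl_iff[OF A.M_subset, of u l] u by (auto simp: cyl_def)
  qed
  have DE: "D \<subseteq> exps (insert y W)" using A.order_ideal_exps[OF D] .
  have "{u \<in> exps (insert z W). u + single y l \<in> exps (insert z (insert y W)) - cyl z D}
      = exps (insert z W) - cyl z (slice y l D)"
    using cyl_iff[OF DE, of _ l] by (auto simp: exps_iff lookup_add lookup_single when_def)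
  then show ?thesis
    unfolding A.cone_ideal_def B.cone_ideal_def
    using components_mspan[of "exps (insert z (insert y W)) - cyl z D"] A.upset_cone[OF D] l
    by simp
qed

section \<open>Extremality of the almost lex ideals\<close>

lemma (in truncated_algebra) C_ideal_almost_lex:
  assumes "Hilb d R \<noteq> {}" shows "almost_lex R (C_ideal d R)"
proof -
  obtain S where S: "initial M S" "C_ideal d R = cone_ideal S" using initial_of_Hilb[OF assms] by metis
  have "lex_lower S" using S(1) unfolding lex_lower_def initial_def deglex_less_def by metis
  then show ?thesis using S initial_order_ideal almost_lex_iff by auto
qed

lemma (in truncated_algebra) C_ideal_antimono:
  assumes "d1 < d2" "Hilb d1 R \<noteq> {}" "Hilb d2 R \<noteq> {}" shows "C_ideal d2 R \<subseteq> C_ideal d1 R"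
proof -
  obtain S1 where S1: "initial M S1" "finite S1" "card S1 = d1" "C_ideal d1 R = cone_ideal S1"
    using initial_of_Hilb[OF assms(2)] .
  obtain S2 where S2: "initial M S2" "finite S2" "card S2 = d2" "C_ideal d2 R = cone_ideal S2"
    using initial_of_Hilb[OF assms(3)] .
  have "S1 \<subseteq> S2" using initial_card_le[OF S1(1) S2(1) S1(2) S2(2)] S1(3) S2(3) assms(1) by simp
  then show ?thesis
    using cone_subset_iff[OF initial_order_ideal[OF S2(1)] initial_order_ideal[OF S1(1)]] S1(4) S2(4) by simp
qed

lemma (in truncated_algebra) multiplicity_nonlast_mult_le:
  assumes I: "I \<in> Hilb d R" "strongly_stable R I"
  shows "multiplicity_of R (nonlast_ideal R \<cdot>\<^bsub>R\<^esub> I) \<le> multiplicity_of R (nonlast_ideal R \<cdot>\<^bsub>R\<^esub> C_ideal d R)"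
proof -
  obtain D where D: "order_ideal D" "finite D" "card D = d" "costable W M D" "I = cone_ideal D"
    by (rule strongly_stable_Hilb[OF I])
  have "Hilb d R \<noteq> {}" using I(1) by blast
  then obtain S where S: "initial M S" "finite S" "card S = d" "C_ideal d R = cone_ideal S"
    by (rule initial_of_Hilb)
  have mult: "multiplicity_of R (nonlast_ideal R \<cdot>\<^bsub>R\<^esub> cone_ideal E) = card (envelope M E)"
    if "order_ideal E" "finite E" for E
    using nonlast_ideal_mult_cone[OF that(1)] order_ideal_envelope[OF that(1)]
      finite_envelope[OF finite_W M_subset that(2)] by (simp add: multiplicity_cone)
  have "card (envelope M D) \<le> card (envelope M S)"
    using envelope_bound[OF finite_W e_ge_1] D S unfolding envelope_bound_def order_ideal_def by simp
  then show ?thesis using mult D(1,2,5) S(2,4) initial_order_ideal[OF S(1)] by simp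
qed

theorem proposition3p2:
  fixes n d :: nat and e :: "nat \<Rightarrow> enat"
    and R Rbar :: "('k::field, 'k mpoly set) galg"
  assumes R: "R = trunc_alg {1..n+1} {1..n} e"
    and Rbar: "Rbar = trunc_alg ({1..n-1} \<union> {n+1}) {1..n-1} e"
    and e_ge: "\<forall>i\<in>{1..n}. 2 \<le> e i"
    and e_mono: "\<forall>i\<in>{1..n}. \<forall>j\<in>{1..n}. i \<le> j \<longrightarrow> e i \<le> e j"
    and d: "Hilb d R \<noteq> {}"
  shows
    "almost_lex R (C_ideal d R)
   \<and> (n \<ge> 1 \<longrightarrow> (\<forall>l. enat l < e n \<longrightarrow>
        (\<exists>dl. Hilb dl Rbar \<noteq> {} \<and>
              components R Rbar n (e n) (C_ideal d R) l = C_ideal dl Rbar)))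
   \<and> (\<forall>d1 d2. d1 < d2 \<and> Hilb d1 R \<noteq> {} \<and> Hilb d2 R \<noteq> {} \<longrightarrow> C_ideal d2 R \<subseteq> C_ideal d1 R)
   \<and> (n \<ge> 1 \<longrightarrow> (\<forall>I\<in>Hilb d R. strongly_stable R I \<longrightarrow> (\<forall>\<rho>. enat \<rho> < e n \<longrightarrow>
        (\<Sum>l=0..\<rho>. multiplicity_of Rbar (components R Rbar n (e n) I l))
          \<le> (\<Sum>l=0..\<rho>. multiplicity_of Rbar (components R Rbar n (e n) (C_ideal d R) l)))))
   \<and> (\<forall>I\<in>Hilb d R. strongly_stable R I \<longrightarrow>
        multiplicity_of R (nonlast_ideal R \<cdot>\<^bsub>R\<^esub> I)
          \<le> multiplicity_of R (nonlast_ideal R \<cdot>\<^bsub>R\<^esub> C_ideal d R))"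
proof -
  interpret R: truncated_algebra "{1..n}" "n + 1" e R
  proof
    have "insert (n + 1) {1..n} = {1..n + 1}" by auto
    then show "R = trunc_alg (insert (n + 1) {1..n}) {1..n} e" using R by simp
    show "\<forall>i\<in>{1..n}. 1 \<le> e i"
    proof
      fix i assume "i \<in> {1..n}"
      then have "2 \<le> e i" using e_ge by blast
      then show "1 \<le> e i" by (rule order_trans[rotated]) simp
    qed
  qed auto
  obtain S where S: "initial R.M S" "finite S" "card S = d" "C_ideal d R = R.cone_ideal S"
    using R.initial_of_Hilb[OF d] .
  note oS = R.initial_order_ideal[OF S(1)]
  have comp: "(\<exists>dl. Hilb dl Rbar \<noteq> {} \<and> components R Rbar n (e n) (C_ideal d R) l = C_ideal dl Rbar)
      \<and> (I \<in> Hilb d R \<longrightarrow> strongly_stable R I \<longrightarrow>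
        (\<Sum>l=0..\<rho>. multiplicity_of Rbar (components R Rbar n (e n) I l))
          \<le> (\<Sum>l=0..\<rho>. multiplicity_of Rbar (components R Rbar n (e n) (C_ideal d R) l)))"
    if n: "1 \<le> n" and l: "enat l < e n" and \<rho>: "enat \<rho> < e n" for l \<rho> I
  proof -
    let ?W = "{1..n-1}"
    have W: "insert n ?W = {1..n}" and nW: "n \<notin> ?W" "finite ?W" "\<forall>i\<in>?W. i < n" using n by auto
    interpret B: truncated_algebra ?W "n + 1" e Rbar
    proof
      show "Rbar = trunc_alg (insert (n + 1) ?W) ?W e" using Rbar by simp
      show "\<forall>i\<in>?W. 1 \<le> e i" using R.e_ge_1 by auto
    qed auto
    have A: "truncated_algebra (insert n ?W) (n + 1) e R" unfolding W by (rule R.truncated_algebra_axioms)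
    have comps: "components R Rbar n (e n) (R.cone_ideal D) k = B.cone_ideal (slice n k D)"
      if "R.order_ideal D" "enat k < e n" for D k
      by (rule components_cone[OF A B.truncated_algebra_axioms nW(1), unfolded W, OF that])
    have oslice: "B.order_ideal (slice n k D)" if "R.order_ideal D" for D k
      using that slice_divisor_closed slice_subset_box[OF nW(1), unfolded W]
      unfolding R.order_ideal_def B.order_ideal_def by blast
    have mult: "multiplicity_of Rbar (components R Rbar n (e n) (R.cone_ideal D) k) = card (slice n k D)"
      if "R.order_ideal D" "finite D" "enat k < e n" for D k
      using comps[OF that(1,3)] B.multiplicity_cone[OF oslice[OF that(1)] finite_slice[OF that(2)]] by simp
    have init: "initial B.M (slice n l S)"
      by (rule slice_initial[OF nW(1), unfolded W, OF S(1)])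
    have "components R Rbar n (e n) (C_ideal d R) l = C_ideal (card (slice n l S)) Rbar"
      using comps[OF oS l] S(4) B.C_ideal_eq_cone[OF init finite_slice[OF S(2)] refl] by simp
    moreover have "Hilb (card (slice n l S)) Rbar \<noteq> {}"
      using B.cone_in_Hilb[OF oslice[OF oS] finite_slice[OF S(2)]] by blast
    moreover have "(\<Sum>l=0..\<rho>. multiplicity_of Rbar (components R Rbar n (e n) I l))
          \<le> (\<Sum>l=0..\<rho>. multiplicity_of Rbar (components R Rbar n (e n) (C_ideal d R) l))"
      if I: "I \<in> Hilb d R" "strongly_stable R I"
    proof -
      obtain D where D: "R.order_ideal D" "finite D" "card D = d" "costable {1..n} R.M D" "I = R.cone_ideal D"
        by (rule R.strongly_stable_Hilb[OF I])
      have sums: "(\<Sum>l=0..\<rho>. multiplicity_of Rbar (components R Rbar n (e n) (R.cone_ideal E) l))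
          = (\<Sum>l\<le>\<rho>. card (slice n l E))" if "R.order_ideal E" "finite E" for E
        unfolding atLeast0AtMost using mult[OF that] enat_less_le_trans[OF \<rho>] by (intro sum.cong) auto
      have "(\<Sum>l\<le>\<rho>. card (slice n l D)) \<le> (\<Sum>l\<le>\<rho>. card (slice n l S))"
        using D(1,3) S(3) unfolding R.order_ideal_def
        by (intro partial_sums_initial[OF nW(2,3) envelope_bound[OF nW(2) B.e_ge_1], unfolded W] D(2,4) S(1,2)) auto
      then show ?thesis using sums[OF D(1,2)] sums[OF oS S(2)] D(5) S(4) by simp
    qed
    ultimately show ?thesis by blast
  qed
  show ?thesis
  proof (intro conjI impI allI ballI)
    show "almost_lex R (C_ideal d R)" using R.C_ideal_almost_lex[OF d] .
    show "\<exists>dl. Hilb dl Rbar \<noteq> {} \<and> components R Rbar n (e n) (C_ideal d R) l = C_ideal dl Rbar"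
      if "1 \<le> n" "enat l < e n" for l
      using comp[OF that that(2)] by blast
    show "C_ideal d2 R \<subseteq> C_ideal d1 R" if "d1 < d2 \<and> Hilb d1 R \<noteq> {} \<and> Hilb d2 R \<noteq> {}" for d1 d2
      using R.C_ideal_antimono that by blast
    show "(\<Sum>l=0..\<rho>. multiplicity_of Rbar (components R Rbar n (e n) I l))
          \<le> (\<Sum>l=0..\<rho>. multiplicity_of Rbar (components R Rbar n (e n) (C_ideal d R) l))"
      if "1 \<le> n" "I \<in> Hilb d R" "strongly_stable R I" "enat \<rho> < e n" for I \<rho>
      using comp[OF that(1,4,4), of I] that(2,3) by blast
    show "multiplicity_of R (nonlast_ideal R \<cdot>\<^bsub>R\<^esub> I)
          \<le> multiplicity_of R (nonlast_ideal R \<cdot>\<^bsub>R\<^esub> C_ideal d R)"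
      if "I \<in> Hilb d R" "strongly_stable R I" for I
      using R.multiplicity_nonlast_mult_le[OF that] .
  qed
qed

end
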